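(* For every $0<\xi<1$ there exists a positive integer $k_0$ such that for every $k\in\mathbb{Z}$ with $|k|>k_0$, the operator $\mathcal{A}_k$ on $H(T)$ has both a positive eigenvalue and a negative eigenvalue.
   Context: Fix $0<\xi<1$. Set $\psi(\eta):=1-\xi\cos\eta$ and $\mu(\varphi):=\xi^{-2}+(1-\xi^{-2})\cos\varphi$. Let $T$ be the unit circle (identified with $[0,2\pi)$), $H^{-1/2}(T)$ the Sobolev space with norm $\|\phi\|_{-1/2}^2=\sum_{l\in\mathbb{Z}}(1+l^2)^{-1/2}|\hat\phi(l)|^2$, $H(T):=\{g:\psi^{3/2}g\in H^{-1/2}(T)\}$ with norm $\|g\|_H:=\|\psi^{3/2}g\|_{-1/2}$. Define $a_k(\eta,\eta'):=\psi(\eta)^{-1}\int_0^{2\pi}\frac{e^{-ik\varphi'}}{(\mu(\varphi')-\cos(\eta-\eta'))^{1/2}}d\varphi'-\frac{1}{\xi^2}\int_0^{2\pi}\frac{(1-\cos\varphi')e^{-ik\varphi'}}{(\mu(\varphi')-\cos(\eta-\eta'))^{3/2}}d\varphi'$ and $\mathcal{A}_k[g](\eta):=\int_0^{2\pi}a_k(\eta,\eta')g(\eta')\,d\eta'$. $\mathcal{A}_k$ is a compact operator on $H(T)$, self-adjoint with respect to the inner product $\langle g_1,g_2\rangle_k:=\int_0^{2\pi}g_1(\eta)\overline{\mathcal{S}_k[g_2](\eta)}\,d\eta$, where $\mathcal{S}_k[g](\eta):=\int_0^{2\pi}s_k(\eta-\eta')g(\eta')d\eta'$ and $s_k(\eta):=\int_0^{2\pi}\frac{e^{-ik\varphi'}}{(\mu(\varphi')-\cos\eta)^{1/2}}d\varphi'$.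 *)

theory Defs
  imports "HOL-Analysis.Analysis"
begin

text \<open>Standing notation; all objects depend on the fixed parameter xi (0 < xi < 1).
  The circle T is identified with [0, 2 pi]; functions on T are functions real => complex
  of which only the values on [0, 2 pi] matter.\<close>

definition psi :: "real \<Rightarrow> real \<Rightarrow> real" where
  "psi \<xi> \<eta> = 1 - \<xi> * cos \<eta>"

definition mu :: "real \<Rightarrow> real \<Rightarrow> real" where
  "mu \<xi> \<phi> = 1 / \<xi>^2 + (1 - 1 / \<xi>^2) * cos \<phi>"

definition fourier_coeff :: "(real \<Rightarrow> complex) \<Rightarrow> int \<Rightarrow> complex" where
  "fourier_coeff f l =
     (LINT t:{0..2*pi}|lborel. f t * exp (- \<i> * of_int l * of_real t)) / of_real (2*pi)"

definition in_Hminus_half :: "(real \<Rightarrow> complex) \<Rightarrow> bool" where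
  "in_Hminus_half f \<longleftrightarrow>
     set_integrable lborel {0..2*pi} f \<and>
     ((\<lambda>l::int. (1 + (of_int l)^2) powr (-1/2) * (cmod (fourier_coeff f l))^2) summable_on UNIV)"

definition H_space :: "real \<Rightarrow> (real \<Rightarrow> complex) set" where
  "H_space \<xi> = {g. in_Hminus_half (\<lambda>\<eta>. of_real (psi \<xi> \<eta> powr (3/2)) * g \<eta>)}"

definition a_kernel :: "real \<Rightarrow> int \<Rightarrow> real \<Rightarrow> real \<Rightarrow> complex" where
  "a_kernel \<xi> k \<eta> \<eta>' =
     of_real (1 / psi \<xi> \<eta>) *
       (LINT \<phi>:{0..2*pi}|lborel.
          exp (- \<i> * of_int k * of_real \<phi>) *
          of_real ((mu \<xi> \<phi> - cos (\<eta> - \<eta>')) powr (-1/2)))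
     - of_real (1 / \<xi>^2) *
       (LINT \<phi>:{0..2*pi}|lborel.
          exp (- \<i> * of_int k * of_real \<phi>) *
          of_real ((1 - cos \<phi>) * (mu \<xi> \<phi> - cos (\<eta> - \<eta>')) powr (-3/2)))"

definition A_op :: "real \<Rightarrow> int \<Rightarrow> (real \<Rightarrow> complex) \<Rightarrow> real \<Rightarrow> complex" where
  "A_op \<xi> k g \<eta> = (LINT \<eta>':{0..2*pi}|lborel. a_kernel \<xi> k \<eta> \<eta>' * g \<eta>')"

definition is_eigenvalue_A :: "real \<Rightarrow> int \<Rightarrow> complex \<Rightarrow> bool" where
  "is_eigenvalue_A \<xi> k lam \<longleftrightarrow>
     (\<exists>g. g \<in> H_space \<xi> \<and>
        \<not> (AE \<eta> in lborel. \<eta> \<in> {0..2*pi} \<longrightarrow> g \<eta> = 0) \<and>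
        (AE \<eta> in lborel. \<eta> \<in> {0..2*pi} \<longrightarrow>
            set_integrable lborel {0..2*pi} (\<lambda>\<eta>'. a_kernel \<xi> k \<eta> \<eta>' * g \<eta>')) \<and>
        (AE \<eta> in lborel. \<eta> \<in> {0..2*pi} \<longrightarrow> A_op \<xi> k g \<eta> = lam * g \<eta>))"

end

theory Submission
  imports Defs
begin

text \<open>
  The operator is \<open>psi\<^sup>-\<^sup>1 S - D\<close> with two convolution operators \<open>S\<close>, \<open>D\<close> whose Fourier symbols
  \<open>s l\<close>, \<open>d l\<close> are real and even. Expanding \<open>(mu - cos)\<close> to the power \<open>-1/2\<close> in powers of cosines gives \<open>s l > 0\<close>, so that
  conjugation with the square root of \<open>S\<close> yields a real symmetric Hilbert-Schmidt matrix \<open>B\<close> on \<open>l\<^sup>2(\<int>)\<close>.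
  If the quadratic form of \<open>B\<close> takes a positive value, its maximum over the unit ball (compact in the product
  topology) is attained at an eigenvector; the same applies to \<open>-B\<close>.

  Since \<open>(1 - xi\<^sup>2) D = S - R\<close> with a bounded kernel of \<open>R\<close>, integration by parts gives
  \<open>(l + 1) s (l + 1) - l s l = (r l + r (l + 1)) / 2\<close>, and \<open>l s l\<close> has a positive limit. Hence, on average,
  \<open>r l\<close> is negligible against \<open>s l\<close>, and at high frequencies \<open>B\<close> behaves like
  \<open>1 / psi - 1 / (1 - xi\<^sup>2)\<close>, which changes sign on the circle. So single basis vectors give negative
  values, and long blocks of ones, which concentrate at \<open>0\<close>, give positive values.
  An eigenvector has absolutely summable Fourier coefficients, so it is a continuous eigenfunction.
\<close>

section \<open>Hilbert-Schmidt forms\<close>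

text \<open>The integer \<open>k\<close> stays fixed; the large parameter is the frequency
  \<open>l\<close>. Since \<open>l * s l\<close> has a positive limit, \<open>s l\<close> has exact
  order 1/l, whereas \<open>r\<close> is only known to be square summable, which does not by itself
  give r l = o(1/l). The recurrence closes this gap: a persistent one-sided bound of size 1/l on
  \<open>r\<close>, or on its sums over windows of fixed length, would make a convergent sequence
  grow like the harmonic series. So good frequencies exist, without an estimate at any prescribed
  one. With w = sqrt(1 - xi^2), the function 1/psi has mean 1/w and maximum 1/(1 - xi), and 1/w <
  1/w^2 < 1/(1 - xi). A basis vector sees the mean, a long block of ones sees the maximum, and 1/w^2
  is the threshold between them. Conjugation makes the matrix symmetric in plain l^2, but undoing it
  divides by the square root of \<open>s l\<close> and loses about half a derivative. The equation
  itself has to restore that loss, because the integral operator is to be evaluated pointwise on a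
  genuine function.\<close>

lemma summable_on_mult_square:
  fixes f g :: "'a \<Rightarrow> real"
  assumes "(\<lambda>i. (f i)\<^sup>2) summable_on A" "(\<lambda>i. (g i)\<^sup>2) summable_on A"
  shows "(\<lambda>i. f i * g i) summable_on A"
  using Infinite_Sum.abs_summable_product[of f A g] assms
  by (subst summable_on_iff_abs_summable_on_real) (simp add: power2_eq_square)

lemma infsum_Cauchy_Schwarz:
  fixes f g :: "'a \<Rightarrow> real"
  assumes "(\<lambda>i. (f i)\<^sup>2) summable_on A" "(\<lambda>i. (g i)\<^sup>2) summable_on A"
  shows "(\<Sum>\<^sub>\<infinity>i\<in>A. f i * g i)\<^sup>2 \<le> (\<Sum>\<^sub>\<infinity>i\<in>A. (f i)\<^sup>2) * (\<Sum>\<^sub>\<infinity>i\<in>A. (g i)\<^sup>2)"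
proof (rule tendsto_le[OF finite_subsets_at_top_neq_bot])
  show "((\<lambda>F. (\<Sum>i\<in>F. (f i)\<^sup>2) * (\<Sum>i\<in>F. (g i)\<^sup>2)) \<longlongrightarrow>
          (\<Sum>\<^sub>\<infinity>i\<in>A. (f i)\<^sup>2) * (\<Sum>\<^sub>\<infinity>i\<in>A. (g i)\<^sup>2)) (finite_subsets_at_top A)"
    by (intro tendsto_mult infsum_tendsto assms)
  show "((\<lambda>F. (\<Sum>i\<in>F. f i * g i)\<^sup>2) \<longlongrightarrow> (\<Sum>\<^sub>\<infinity>i\<in>A. f i * g i)\<^sup>2) (finite_subsets_at_top A)"
    by (intro tendsto_power infsum_tendsto summable_on_mult_square assms)
qed (auto intro!: always_eventually Cauchy_Schwarz_ineq_sum)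

text \<open>Enlarging \<open>G\<close> to the product of its two projections makes the sum
  factor.\<close>

lemma square_tensor_bound:
  fixes y :: "'i \<Rightarrow> real"
  assumes y: "\<And>F. finite F \<Longrightarrow> (\<Sum>i\<in>F. (y i)\<^sup>2) \<le> 1" and G: "finite G"
  shows "(\<Sum>p\<in>G. (y (fst p) * y (snd p))\<^sup>2) \<le> 1"
proof -
  have "(\<Sum>p\<in>G. (y (fst p) * y (snd p))\<^sup>2) \<le> (\<Sum>p\<in>fst ` G \<times> snd ` G. (y (fst p) * y (snd p))\<^sup>2)"
    by (rule sum_mono2) (use G in force)+
  also have "\<dots> = (\<Sum>i\<in>fst ` G. (y i)\<^sup>2) * (\<Sum>i\<in>snd ` G. (y i)\<^sup>2)"
    by (simp add: sum_product sum.cartesian_product power_mult_distrib case_prod_beta)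
  also have "\<dots> \<le> 1 * 1"
    by (intro mult_mono y finite_imageI G) (auto intro: sum_nonneg)
  finally show ?thesis by simp
qed

lemma summable_on_tensor:
  fixes u :: "'a \<Rightarrow> real" and v :: "'b \<Rightarrow> real"
  assumes "u summable_on UNIV" "v summable_on UNIV" "\<And>i. u i \<ge> 0" "\<And>i. v i \<ge> 0"
  shows "(\<lambda>p. u (fst p) * v (snd p)) summable_on UNIV"
proof -
  have "(\<lambda>p. norm (u (fst p) * v (snd p))) summable_on UNIV \<times> UNIV"
    using assms
    by (subst Infinite_Sum.abs_summable_on_Sigma_iff)
       (auto simp: abs_mult infsum_cmult_right' summable_on_cmult_right summable_on_cmult_left infsum_nonneg)
  then show ?thesis using assms by (simp add: abs_mult)
qed

lemma summable_on_square_tensor: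
  fixes y :: "'i \<Rightarrow> real"
  assumes "(\<lambda>i. (y i)\<^sup>2) summable_on UNIV"
  shows "(\<lambda>p. (y (fst p) * y (snd p))\<^sup>2) summable_on UNIV"
  using summable_on_tensor[OF assms assms] by (simp add: power_mult_distrib)

definition hs_form :: "('i \<Rightarrow> 'i \<Rightarrow> real) \<Rightarrow> ('i \<Rightarrow> real) \<Rightarrow> real" where
  "hs_form B y = (\<Sum>\<^sub>\<infinity>p. B (fst p) (snd p) * (y (fst p) * y (snd p)))"

text \<open>Stated through finite partial sums, the unit ball is an intersection of conditions on
  finitely many coordinates, hence visibly closed in the product topology.\<close>

definition ell2_ball :: "('i \<Rightarrow> real) set" where
  "ell2_ball = {y. \<forall>F. finite F \<longrightarrow> (\<Sum>i\<in>F. (y i)\<^sup>2) \<le> 1}"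

lemma ell2_ball_iff: "y \<in> ell2_ball \<longleftrightarrow> (\<lambda>i. (y i)\<^sup>2) summable_on UNIV \<and> (\<Sum>\<^sub>\<infinity>i. (y i)\<^sup>2) \<le> 1"
proof
  assume y: "y \<in> ell2_ball"
  have s: "(\<lambda>i. (y i)\<^sup>2) summable_on UNIV"
    by (rule nonneg_bdd_above_summable_on) (use y in \<open>auto simp: ell2_ball_def intro!: bdd_aboveI2\<close>)
  moreover have "(\<Sum>\<^sub>\<infinity>i. (y i)\<^sup>2) \<le> 1"
    by (rule infsum_le_finite_sums[OF s]) (use y in \<open>auto simp: ell2_ball_def\<close>)
  ultimately show "(\<lambda>i. (y i)\<^sup>2) summable_on UNIV \<and> (\<Sum>\<^sub>\<infinity>i. (y i)\<^sup>2) \<le> 1" by blast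
next
  assume *: "(\<lambda>i. (y i)\<^sup>2) summable_on UNIV \<and> (\<Sum>\<^sub>\<infinity>i. (y i)\<^sup>2) \<le> 1"
  have "(\<Sum>i\<in>F. (y i)\<^sup>2) \<le> 1" if "finite F" for F
    using finite_sum_le_infsum[of "\<lambda>i. (y i)\<^sup>2" UNIV F] * that by force
  then show "y \<in> ell2_ball" by (auto simp: ell2_ball_def)
qed

text \<open>Tychonoff: the ball is a closed subset of a product of intervals. The product topology
  stands in for the weak topology of l^2. The norm is in general not continuous for it, but
  Hilbert-Schmidt forms are, on the ball.\<close>

lemma compact_ell2_ball: "compact (ell2_ball :: ('i \<Rightarrow> real) set)"
proof -
  have "compactin (product_topology (\<lambda>i::'i. euclidean) UNIV) (PiE UNIV (\<lambda>i. {-1..1::real}))"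
    by (subst compactin_PiE) auto
  then have c: "compact (PiE UNIV (\<lambda>i::'i. {-1..1::real}))"
    by (simp add: euclidean_product_topology)
  have "ell2_ball = (\<Inter>F\<in>{F. finite F}. {y :: 'i \<Rightarrow> real. (\<Sum>i\<in>F. (y i)\<^sup>2) \<le> 1})"
    by (auto simp: ell2_ball_def)
  also have "closed \<dots>"
    by (intro closed_INT ballI closed_Collect_le continuous_intros) auto
  finally have cl: "closed (ell2_ball :: ('i \<Rightarrow> real) set)" .
  have "y i \<in> {-1..1}" if "y \<in> ell2_ball" for y :: "'i \<Rightarrow> real" and i
  proof -
    have "(y i)\<^sup>2 \<le> 1" using that[unfolded ell2_ball_def, simplified, rule_format, of "{i}"] by simp
    then show ?thesis using abs_square_le_1[of "y i"] by (auto simp: abs_le_iff)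
  qed
  then have "(ell2_ball :: ('i \<Rightarrow> real) set) \<subseteq> PiE UNIV (\<lambda>i. {-1..1})" by (auto simp: PiE_iff)
  then show ?thesis using compact_Int_closed[OF c cl] by (simp add: Int_absorb1)
qed

text \<open>Finite partial sums depend on finitely many coordinates. By Cauchy-Schwarz the remainder
  is bounded, uniformly over the ball, by the Hilbert-Schmidt tail of \<open>B\<close>, because the
  tensor square of \<open>y\<close> has norm at most 1.\<close>

lemma continuous_on_hs_form:
  fixes B :: "'i \<Rightarrow> 'i \<Rightarrow> real"
  assumes hs: "(\<lambda>p. (B (fst p) (snd p))\<^sup>2) summable_on UNIV"
  shows "continuous_on ell2_ball (hs_form B)"
proof (rule uniform_limit_theorem)
  let ?b = "\<lambda>p. B (fst p) (snd p)"
  let ?Q = "\<lambda>G y. \<Sum>p\<in>G. ?b p * (y (fst p) * y (snd p))"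
  show "\<forall>\<^sub>F G in finite_subsets_at_top UNIV. continuous_on ell2_ball (?Q G)"
    by (intro always_eventually allI continuous_intros continuous_on_subset[OF continuous_on_product_coordinates]) auto
  show "uniform_limit ell2_ball ?Q (hs_form B) (finite_subsets_at_top UNIV)"
    unfolding uniform_limit_iff
  proof (intro allI impI)
    fix e :: real assume e: "e > 0"
    have "(sum (\<lambda>p. (?b p)\<^sup>2) \<longlongrightarrow> (\<Sum>\<^sub>\<infinity>p. (?b p)\<^sup>2)) (finite_subsets_at_top UNIV)"
      using hs by (rule infsum_tendsto)
    then have "\<forall>\<^sub>F G in finite_subsets_at_top UNIV. (\<Sum>p\<in>G. (?b p)\<^sup>2) > (\<Sum>\<^sub>\<infinity>p. (?b p)\<^sup>2) - e\<^sup>2"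
      by (rule order_tendstoD) (use e in auto)
    moreover have "\<forall>\<^sub>F G :: ('i \<times> 'i) set in finite_subsets_at_top UNIV. finite G"
      by (simp add: eventually_finite_subsets_at_top_weakI)
    ultimately show "\<forall>\<^sub>F G in finite_subsets_at_top UNIV. \<forall>y\<in>ell2_ball. dist (?Q G y) (hs_form B y) < e"
    proof eventually_elim
      case (elim G)
      show ?case
      proof
        fix y :: "'i \<Rightarrow> real" assume y: "y \<in> ell2_ball"
        let ?y = "\<lambda>p. y (fst p) * y (snd p)"
        have sy: "(\<lambda>p. (?y p)\<^sup>2) summable_on UNIV"
          using y ell2_ball_iff summable_on_square_tensor by blast
        have syG: "(\<lambda>p. (?y p)\<^sup>2) summable_on (-G)" using sy by (rule summable_on_subset) auto
        have sbG: "(\<lambda>p. (?b p)\<^sup>2) summable_on (-G)" using hs by (rule summable_on_subset) auto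
        have split: "infsum h UNIV = sum h G + infsum h (-G)" if "h summable_on UNIV" for h :: "'i \<times> 'i \<Rightarrow> real"
        proof -
          have "infsum h (G \<union> -G) = infsum h G + infsum h (-G)"
            by (rule infsum_Un_disjoint) (use that elim in \<open>auto intro: summable_on_subset\<close>)
          then show ?thesis using elim by simp
        qed
        have "hs_form B y - ?Q G y = (\<Sum>\<^sub>\<infinity>p\<in>-G. ?b p * ?y p)"
          unfolding hs_form_def by (subst split) (auto intro: summable_on_mult_square hs sy)
        then have "(hs_form B y - ?Q G y)\<^sup>2 \<le> (\<Sum>\<^sub>\<infinity>p\<in>-G. (?b p)\<^sup>2) * (\<Sum>\<^sub>\<infinity>p\<in>-G. (?y p)\<^sup>2)"
          using infsum_Cauchy_Schwarz[OF sbG syG] by simp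
        also have "\<dots> \<le> (\<Sum>\<^sub>\<infinity>p\<in>-G. (?b p)\<^sup>2) * 1"
          by (intro mult_left_mono infsum_nonneg infsum_le_finite_sums[OF syG] square_tensor_bound)
             (use y in \<open>auto simp: ell2_ball_def\<close>)
        also have "\<dots> < e\<^sup>2" using split[OF hs] elim by simp
        finally show "dist (?Q G y) (hs_form B y) < e"
          using e power2_less_imp_less[of "\<bar>hs_form B y - ?Q G y\<bar>" e]
          by (simp add: dist_real_def abs_minus_commute)
      qed
    qed
  qed
qed simp

lemma hs_form_scale: "hs_form B (\<lambda>i. c * y i) = c\<^sup>2 * hs_form B y"
  unfolding hs_form_def by (subst infsum_cmult_right'[symmetric]) (simp add: power2_eq_square algebra_simps)

lemma hs_form_finite_support:
  assumes "finite F" "\<And>i. i \<notin> F \<Longrightarrow> x i = 0"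
  shows "hs_form B x = (\<Sum>i\<in>F. \<Sum>j\<in>F. B i j * x i * x j)"
proof -
  have "hs_form B x = (\<Sum>\<^sub>\<infinity>p\<in>F\<times>F. B (fst p) (snd p) * (x (fst p) * x (snd p)))"
    unfolding hs_form_def by (rule infsum_cong_neutral) (use assms(2) in force)+
  also have "\<dots> = (\<Sum>i\<in>F. \<Sum>j\<in>F. B i j * x i * x j)"
    using assms(1) by (simp add: sum.cartesian_product case_prod_beta mult.assoc)
  finally show ?thesis .
qed

lemma hs_row_summable:
  fixes B :: "'i \<Rightarrow> 'i \<Rightarrow> real"
  assumes hs: "(\<lambda>p. (B (fst p) (snd p))\<^sup>2) summable_on UNIV"
  shows "(\<lambda>j. (B i j)\<^sup>2) summable_on UNIV"
proof -
  have "(\<lambda>p. (B (fst p) (snd p))\<^sup>2) summable_on (Pair i ` UNIV)"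
    using hs by (rule summable_on_subset) auto
  then show ?thesis by (subst (asm) summable_on_reindex) (auto simp: inj_on_def o_def)
qed

text \<open>First and second variation in a coordinate direction; it yields the Euler-Lagrange
  equation of the maximum one coordinate at a time. Row \<open>i\<close> and column \<open>i\<close>
  give the linear term, the corner the quadratic one.\<close>

lemma hs_form_perturb:
  fixes B :: "'i \<Rightarrow> 'i \<Rightarrow> real"
  assumes hs: "(\<lambda>p. (B (fst p) (snd p))\<^sup>2) summable_on UNIV"
    and sym: "\<And>i j. B i j = B j i"
    and y: "(\<lambda>i. (y i)\<^sup>2) summable_on UNIV"
  shows "hs_form B (\<lambda>a. y a + (if a = i then t else 0)) =
    hs_form B y + 2 * t * (\<Sum>\<^sub>\<infinity>j. B i j * y j) + t\<^sup>2 * B i i"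
proof -
  let ?R = "\<Sum>\<^sub>\<infinity>j. B i j * y j"
  have R: "((\<lambda>j. B i j * y j) has_sum ?R) UNIV"
    using has_sum_infsum[OF summable_on_mult_square[OF hs_row_summable[OF hs, of i] y]] by simp
  have 1: "((\<lambda>p. B (fst p) (snd p) * (y (fst p) * y (snd p))) has_sum hs_form B y) UNIV"
    unfolding hs_form_def
    by (rule has_sum_infsum[OF summable_on_mult_square[OF hs summable_on_square_tensor[OF y]]])
  have "((\<lambda>p. B (fst p) (snd p) * y (snd p)) has_sum ?R) (Pair i ` UNIV)"
    using R by (subst has_sum_reindex) (auto simp: inj_on_def o_def)
  then have 2: "((\<lambda>p. if fst p = i then B (fst p) (snd p) * y (snd p) else 0) has_sum ?R) UNIV"
    by (subst has_sum_cong_neutral[where T = "Pair i ` UNIV"]) auto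
  have "((\<lambda>p. B (fst p) (snd p) * y (fst p)) has_sum ?R) ((\<lambda>j. (j,i)) ` UNIV)"
    using R by (subst has_sum_reindex) (auto simp: inj_on_def o_def sym)
  then have 3: "((\<lambda>p. if snd p = i then B (fst p) (snd p) * y (fst p) else 0) has_sum ?R) UNIV"
    by (subst has_sum_cong_neutral[where T = "(\<lambda>j. (j,i)) ` UNIV"]) auto
  have 4: "((\<lambda>p. if p = (i,i) then B i i else 0) has_sum B i i) UNIV"
    by (subst has_sum_cong_neutral[where T = "{(i,i)}" and g = "\<lambda>_. B i i"]) (auto intro!: has_sum_finiteI)
  have "((\<lambda>p. B (fst p) (snd p) * (y (fst p) * y (snd p)) +
      (t * (if fst p = i then B (fst p) (snd p) * y (snd p) else 0) +
       t * (if snd p = i then B (fst p) (snd p) * y (fst p) else 0) +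
       t\<^sup>2 * (if p = (i,i) then B i i else 0))) has_sum (hs_form B y + (t * ?R + t * ?R + t\<^sup>2 * B i i))) UNIV"
    by (intro has_sum_add has_sum_cmult_right 1 2 3 4)
  also have "(\<lambda>p. B (fst p) (snd p) * (y (fst p) * y (snd p)) +
      (t * (if fst p = i then B (fst p) (snd p) * y (snd p) else 0) +
       t * (if snd p = i then B (fst p) (snd p) * y (fst p) else 0) +
       t\<^sup>2 * (if p = (i,i) then B i i else 0))) =
     (\<lambda>p. B (fst p) (snd p) * ((y (fst p) + (if fst p = i then t else 0)) * (y (snd p) + (if snd p = i then t else 0))))"
    by (auto simp: fun_eq_iff algebra_simps power2_eq_square)
  finally show ?thesis
    unfolding hs_form_def by (intro infsumI) (simp add: algebra_simps)
qed

lemma linear_vanishes_if_quadratic_nonpos: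
  fixes p q :: real
  assumes "\<And>t. 2 * t * p + t\<^sup>2 * q \<le> 0"
  shows "p = 0"
proof (rule ccontr)
  assume p: "p \<noteq> 0"
  \<comment> \<open>With this choice |t * q| < |p|, so the linear term decides the sign.\<close>
  define t where "t = p / (\<bar>q\<bar> + 1)"
  have "t * (2 * p + t * q) \<le> 0" using assms[of t] by (simp add: power2_eq_square algebra_simps)
  moreover have "t * (2 * p + t * q) = p\<^sup>2 / (\<bar>q\<bar> + 1) * (2 + q / (\<bar>q\<bar> + 1))"
    by (simp add: t_def power2_eq_square field_simps)
  moreover have "q / (\<bar>q\<bar> + 1) > -2" by (simp add: field_simps)
  then have "p\<^sup>2 / (\<bar>q\<bar> + 1) * (2 + q / (\<bar>q\<bar> + 1)) > 0"
    using p by (intro mult_pos_pos divide_pos_pos) auto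
  ultimately show False by linarith
qed

text \<open>The form attains its maximum on the compact ball, and a maximiser with positive value is
  an eigenvector for that value. A single finitely supported vector certifies positivity, so finite
  sums suffice in the applications.\<close>

theorem hs_positive_eigenvalue:
  fixes B :: "'i \<Rightarrow> 'i \<Rightarrow> real"
  assumes hs: "(\<lambda>p. (B (fst p) (snd p))\<^sup>2) summable_on UNIV"
    and sym: "\<And>i j. B i j = B j i"
    and F: "finite F" and pos: "(\<Sum>i\<in>F. \<Sum>j\<in>F. B i j * x i * x j) > 0"
  obtains lam f where "lam > 0" "(\<lambda>i. (f i)\<^sup>2) summable_on UNIV" "\<exists>i. f i \<noteq> 0"
    "\<And>i. ((\<lambda>j. B i j * f j) has_sum lam * f i) UNIV"
proof -
  have "\<exists>y\<in>ell2_ball. \<forall>z\<in>ell2_ball. hs_form B z \<le> hs_form B y"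
    by (rule continuous_attains_sup[OF compact_ell2_ball _ continuous_on_hs_form[OF hs]])
       (auto simp: ell2_ball_def intro!: exI[of _ "\<lambda>_. 0"])
  then obtain y where y: "y \<in> ell2_ball" and ymax: "\<And>z. z \<in> ell2_ball \<Longrightarrow> hs_form B z \<le> hs_form B y"
    by blast
  define lam where "lam = hs_form B y"
  have sy: "(\<lambda>i. (y i)\<^sup>2) summable_on UNIV" and ny: "(\<Sum>\<^sub>\<infinity>i. (y i)\<^sup>2) \<le> 1"
    using y by (auto simp: ell2_ball_iff)
  \<comment> \<open>Scaling into the ball turns the maximum into a Rayleigh bound on all of
    l^2.\<close>
  have bound: "hs_form B z \<le> lam * (\<Sum>\<^sub>\<infinity>i. (z i)\<^sup>2)"
    if z: "(\<lambda>i. (z i)\<^sup>2) summable_on UNIV" for z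
  proof (cases "(\<Sum>\<^sub>\<infinity>i. (z i)\<^sup>2) = 0")
    case True
    have "z i = 0" for i
      using nonneg_infsum_le_0D[of "\<lambda>i. (z i)\<^sup>2" UNIV i] True z by simp
    then show ?thesis by (simp add: hs_form_def)
  next
    case False
    define n where "n = (\<Sum>\<^sub>\<infinity>i. (z i)\<^sup>2)"
    have n: "n > 0" using False infsum_nonneg[of UNIV "\<lambda>i. (z i)\<^sup>2"] by (simp add: n_def)
    have "((\<lambda>i. (1 / sqrt n * z i)\<^sup>2) has_sum (1 / n * n)) UNIV"
      using has_sum_cmult_right[OF has_sum_infsum[OF z], of "1/n"] n
      by (simp add: power_mult_distrib power_divide n_def)
    then have "(\<lambda>i. 1 / sqrt n * z i) \<in> ell2_ball"
      unfolding ell2_ball_iff using n by (simp add: has_sum_iff)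
    from ymax[OF this] have "(1 / sqrt n)\<^sup>2 * hs_form B z \<le> lam"
      by (simp add: hs_form_scale lam_def del: times_divide_eq_left)
    then show ?thesis using n by (simp add: power_divide field_simps n_def[symmetric])
  qed
  define x' where "x' = (\<lambda>i. if i \<in> F then x i else 0)"
  have "hs_form B x' = (\<Sum>i\<in>F. \<Sum>j\<in>F. B i j * x' i * x' j)"
    using F by (rule hs_form_finite_support) (simp add: x'_def)
  then have px: "hs_form B x' > 0" using pos by (simp add: x'_def)
  have "(\<lambda>i. (x' i)\<^sup>2) summable_on UNIV"
    by (rule finite_nonzero_values_imp_summable_on) (rule finite_subset[OF _ F], auto simp: x'_def)
  from bound[OF this] px have "lam * (\<Sum>\<^sub>\<infinity>i. (x' i)\<^sup>2) > 0" by linarith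
  moreover have "(\<Sum>\<^sub>\<infinity>i. (x' i)\<^sup>2) \<ge> 0" by (simp add: infsum_nonneg)
  ultimately have lam: "lam > 0" by (auto simp: zero_less_mult_iff)
  \<comment> \<open>A maximiser in the product topology might have norm below 1; the Rayleigh bound
    at \<open>y\<close> itself excludes this because \<open>lam > 0\<close>.\<close>
  have "lam \<le> lam * (\<Sum>\<^sub>\<infinity>i. (y i)\<^sup>2)" using bound[OF sy] by (simp add: lam_def)
  then have ny1: "(\<Sum>\<^sub>\<infinity>i. (y i)\<^sup>2) = 1" using ny lam by simp
  have eq: "(\<Sum>\<^sub>\<infinity>j. B i j * y j) - lam * y i = 0" for i
  proof (rule linear_vanishes_if_quadratic_nonpos)
    fix t :: real
    let ?z = "\<lambda>a. y a + (if a = i then t else 0)"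
    have d: "((\<lambda>a. if a = i then 2 * t * y i + t\<^sup>2 else 0) has_sum (2 * t * y i + t\<^sup>2)) UNIV"
      by (subst has_sum_cong_neutral[where T = "{i}" and g = "\<lambda>_. 2 * t * y i + t\<^sup>2"]) (auto intro!: has_sum_finiteI)
    have "((\<lambda>a. (y a)\<^sup>2 + (if a = i then 2 * t * y i + t\<^sup>2 else 0)) has_sum (1 + (2 * t * y i + t\<^sup>2))) UNIV"
      using has_sum_add[OF has_sum_infsum[OF sy] d] ny1 by simp
    also have "(\<lambda>a. (y a)\<^sup>2 + (if a = i then 2 * t * y i + t\<^sup>2 else 0)) = (\<lambda>a. (?z a)\<^sup>2)"
      by (auto simp: fun_eq_iff power2_eq_square algebra_simps)
    finally have z: "((\<lambda>a. (?z a)\<^sup>2) has_sum (1 + (2 * t * y i + t\<^sup>2))) UNIV" .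
    then have "hs_form B ?z \<le> lam * (1 + (2 * t * y i + t\<^sup>2))"
      using bound[of ?z] by (simp add: has_sum_iff)
    \<comment> \<open>The constant terms cancel since \<open>hs_form B y = lam\<close>; what is left
      is a quadratic polynomial in \<open>t\<close> vanishing at 0.\<close>
    then show "2 * t * ((\<Sum>\<^sub>\<infinity>j. B i j * y j) - lam * y i) + t\<^sup>2 * (B i i - lam) \<le> 0"
      unfolding hs_form_perturb[OF hs sym sy] lam_def[symmetric] by (simp add: algebra_simps)
  qed
  show thesis
  proof (rule that[OF lam sy])
    show "\<exists>i. y i \<noteq> 0" using ny1 by (rule contrapos_pp) simp
    show "((\<lambda>j. B i j * y j) has_sum lam * y i) UNIV" for i
      using eq[of i] has_sum_infsum[OF summable_on_mult_square[OF hs_row_summable[OF hs, of i] sy]] by simp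
  qed
qed

section \<open>The symbol operator on sequences\<close>

lemma summable_on_int_split:
  fixes f :: "int \<Rightarrow> real"
  assumes "\<And>l. f l \<ge> 0" "summable (\<lambda>n. f (int n))" "summable (\<lambda>n. f (- int n))"
  shows "f summable_on UNIV"
proof -
  have 1: "f summable_on range int"
    using assms by (subst summable_on_reindex) (auto simp: o_def summable_on_UNIV_nonneg_real_iff)
  have 2: "f summable_on range (\<lambda>n. - int n)"
    using assms by (subst summable_on_reindex) (auto simp: o_def summable_on_UNIV_nonneg_real_iff inj_on_def)
  have "range int \<union> range (\<lambda>n. - int n) = UNIV"
  proof (intro equalityI subsetI UnCI)
    fix l :: int assume *: "l \<notin> range (\<lambda>n. - int n)"
    have "l \<ge> 0"
    proof (rule ccontr)
      assume "\<not> l \<ge> 0"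
      then have "l = - int (nat (- l))" by simp
      then show False using * by blast
    qed
    then have "l = int (nat l)" by simp
    then show "l \<in> range int" by blast
  qed auto
  then show ?thesis using summable_on_union[OF 1 2] by simp
qed

section \<open>Convolution bounds for sequences on the integers\<close>

lemma summable_on_convolution_fst:
  fixes u v :: "int \<Rightarrow> real"
  assumes "u summable_on UNIV" "v summable_on UNIV" "\<And>l. u l \<ge> 0" "\<And>l. v l \<ge> 0"
  shows "(\<lambda>p. u (fst p) * v (fst p - snd p)) summable_on UNIV"
proof -
  have "(\<lambda>p. u (fst p) * v (snd p)) summable_on UNIV"
    using assms by (rule summable_on_tensor)
  also have "?this \<longleftrightarrow> ?thesis"
    by (rule summable_on_reindex_bij_witness[where j = "\<lambda>p. (fst p, fst p - snd p)" and i = "\<lambda>p. (fst p, fst p - snd p)"]) auto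
  finally show ?thesis .
qed

lemma summable_on_convolution_snd:
  fixes u v :: "int \<Rightarrow> real"
  assumes "u summable_on UNIV" "v summable_on UNIV" "\<And>l. u l \<ge> 0" "\<And>l. v l \<ge> 0"
  shows "(\<lambda>p. u (snd p) * v (fst p - snd p)) summable_on UNIV"
proof -
  have "(\<lambda>p. u (fst p) * v (snd p)) summable_on UNIV"
    using assms by (rule summable_on_tensor)
  also have "?this \<longleftrightarrow> ?thesis"
    by (rule summable_on_reindex_bij_witness[where j = "\<lambda>p. (snd p + fst p, fst p)" and i = "\<lambda>p. (snd p, fst p - snd p)"]) auto
  finally show ?thesis .
qed

lemma summable_on_convolution:
  fixes u v :: "int \<Rightarrow> real"
  assumes "u summable_on UNIV" "v summable_on UNIV" "\<And>l. u l \<ge> 0" "\<And>l. v l \<ge> 0"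
  shows "(\<lambda>i. \<Sum>\<^sub>\<infinity>j. u j * v (i - j)) summable_on UNIV"
    and "(\<lambda>j. u j * v (i - j)) summable_on UNIV"
proof -
  have *: "(\<lambda>p. u (snd p) * v (fst p - snd p)) summable_on UNIV \<times> UNIV"
    using summable_on_convolution_snd[OF assms] by simp
  show "(\<lambda>i. \<Sum>\<^sub>\<infinity>j. u j * v (i - j)) summable_on UNIV"
    by (rule summable_on_Sigma_banach) (use * in \<open>simp add: case_prod_beta'\<close>)
  have "(\<lambda>p. u (snd p) * v (fst p - snd p)) summable_on (Pair i ` UNIV)"
    using * by (rule summable_on_subset) auto
  then show "(\<lambda>j. u j * v (i - j)) summable_on UNIV"
    by (subst (asm) summable_on_reindex) (auto simp: inj_on_def o_def)
qed

text \<open>Young's inequality for l^1 and l^2: split \<open>v\<close> into two square roots, apply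
  Cauchy-Schwarz for each \<open>i\<close>, then sum over \<open>i\<close>.\<close>

lemma square_summable_convolution:
  fixes z v x :: "int \<Rightarrow> real"
  assumes z: "(\<lambda>l. (z l)\<^sup>2) summable_on UNIV" and v: "v summable_on UNIV" "\<And>l. v l \<ge> 0"
    and x: "\<And>i. ((\<lambda>j. v (i - j) * z j) has_sum x i) UNIV"
  shows "(\<lambda>i. (x i)\<^sup>2) summable_on UNIV"
proof -
  have sz: "(\<lambda>j. (z j)\<^sup>2 * v (i - j)) summable_on UNIV" for i
    by (rule summable_on_convolution) (use z v in auto)
  have vr: "((\<lambda>j. v (i - j)) has_sum infsum v UNIV) UNIV" for i
    using has_sum_infsum[OF v(1)]
    by (subst has_sum_reindex_bij_witness[where j = "\<lambda>j. i - j" and i = "\<lambda>j. i - j"]) auto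
  have "(\<lambda>i. infsum v UNIV * (\<Sum>\<^sub>\<infinity>j. (z j)\<^sup>2 * v (i - j))) summable_on UNIV"
    by (intro summable_on_cmult_right summable_on_convolution z v) auto
  moreover have "(x i)\<^sup>2 \<le> infsum v UNIV * (\<Sum>\<^sub>\<infinity>j. (z j)\<^sup>2 * v (i - j))" for i
  proof -
    let ?f = "\<lambda>j. sqrt (v (i - j))" and ?g = "\<lambda>j. sqrt (v (i - j)) * z j"
    have f: "(\<lambda>j. (?f j)\<^sup>2) summable_on UNIV" using vr[of i] v by (simp add: has_sum_imp_summable)
    have g2: "(\<lambda>j. (?g j)\<^sup>2) = (\<lambda>j. (z j)\<^sup>2 * v (i - j))"
      using v by (auto simp: power_mult_distrib mult.commute)
    have "(\<Sum>\<^sub>\<infinity>j. ?f j * ?g j)\<^sup>2 \<le> (\<Sum>\<^sub>\<infinity>j. (?f j)\<^sup>2) * (\<Sum>\<^sub>\<infinity>j. (?g j)\<^sup>2)"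
      by (rule infsum_Cauchy_Schwarz[OF f]) (use sz[of i] g2 in simp)
    moreover have "(\<lambda>j. ?f j * ?g j) = (\<lambda>j. v (i - j) * z j)"
      using v by (auto simp: mult.assoc[symmetric])
    ultimately show ?thesis using x[of i] vr[of i] v g2 by (simp add: infsumI)
  qed
  ultimately show ?thesis by (rule summable_on_comparison_test) auto
qed

lemma abs_summable_convolution:
  fixes z v x :: "int \<Rightarrow> real"
  assumes z: "(\<lambda>l. \<bar>z l\<bar>) summable_on UNIV" and v: "v summable_on UNIV" "\<And>l. v l \<ge> 0"
    and x: "\<And>i. ((\<lambda>j. v (i - j) * z j) has_sum x i) UNIV"
  shows "(\<lambda>i. \<bar>x i\<bar>) summable_on UNIV"
proof (rule summable_on_comparison_test)
  show "(\<lambda>i. \<Sum>\<^sub>\<infinity>j. \<bar>z j\<bar> * v (i - j)) summable_on UNIV"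
    by (rule summable_on_convolution) (use z v in auto)
  show "\<bar>x i\<bar> \<le> (\<Sum>\<^sub>\<infinity>j. \<bar>z j\<bar> * v (i - j))" for i
  proof -
    have "((\<lambda>j. \<bar>z j\<bar> * v (i - j)) has_sum (\<Sum>\<^sub>\<infinity>j. \<bar>z j\<bar> * v (i - j))) UNIV"
      by (intro has_sum_infsum summable_on_convolution z v) auto
    from norm_infsum_le[OF x this] v show ?thesis by (auto simp: abs_mult)
  qed
qed auto

text \<open>The mechanism behind both signs below: the increments of a convergent sequence are
  summable by telescoping, so they cannot dominate c/n. It takes the place of a decay rate for
  \<open>r\<close>.\<close>

lemma convergent_imp_not_harmonic_growth:
  fixes a :: "nat \<Rightarrow> real"
  assumes lim: "a \<longlonglongrightarrow> L" and c: "c > 0"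
    and grow: "\<And>n. n \<ge> n0 \<Longrightarrow> a (Suc n) - a n \<ge> c / real n"
  shows False
proof -
  have "summable (\<lambda>n. a (Suc n) - a n)" using lim by (rule telescope_summable)
  then have "summable (\<lambda>n. c / real n)"
    by (rule summable_comparison_test'[where N = n0]) (use grow c in auto)
  then have "summable (\<lambda>n. 1 / c * (c / real n))" by (rule summable_mult)
  then have "summable (\<lambda>n. 1 / real n)" using c by simp
  then show False using not_summable_harmonic[where 'a = real] by (simp add: inverse_eq_divide)
qed

text \<open>What the kernels will supply: \<open>s\<close> and \<open>r\<close> become the cosine
  coefficients of \<open>sK\<close> and \<open>rK\<close>, \<open>s_step\<close> is the outcome of
  integration by parts and \<open>r_square\<close> is Bessel's inequality.\<close>

locale torus_symbol =
  fixes xi :: real and s r :: "int \<Rightarrow> real" and yinf :: real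
  assumes xi: "0 < xi" "xi < 1"
    and s_pos: "\<And>l. s l > 0" and s_even: "\<And>l. s (- l) = s l"
    and yinf_pos: "yinf > 0"
    and s_asymp: "(\<lambda>n. real n * s (int n)) \<longlonglongrightarrow> yinf"
    and r_square: "(\<lambda>l. (r l)\<^sup>2) summable_on UNIV"
    and s_step: "\<And>n. real (Suc n) * s (int (Suc n)) - real n * s (int n) = (r (int n) + r (int (Suc n))) / 2"
begin

section \<open>Fourier coefficients of 1/psi\<close>

definition "w = sqrt (1 - xi\<^sup>2)"
text \<open>The root inside the unit disc of xi/2 * (z^2 + 1) = z, that is, the zero of psi written
  in z = exp(i eta).\<close>

definition "rho = (1 - w) / xi"
definition "P l = rho ^ nat \<bar>l\<bar> / w" for l :: int
definition "d l = (s l - r l) / (1 - xi\<^sup>2)" for l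

lemma xi2: "0 < xi\<^sup>2" "xi\<^sup>2 < 1"
  using xi by (auto simp: power_less_one_iff abs_square_less_1)

lemma w: "0 < w" "w < 1" "w\<^sup>2 = 1 - xi\<^sup>2"
  using xi2 by (auto simp: w_def)

text \<open>This is \<open>rho < 1\<close> with denominators cleared.\<close>

lemma w_gt: "1 - xi < w"
proof -
  have "(1 - xi)\<^sup>2 < w\<^sup>2" unfolding w(3) using xi by (simp add: power2_eq_square algebra_simps)
  then show ?thesis by (rule power2_less_imp_less) (use w in auto)
qed

lemma rho: "0 < rho" "rho < 1"
  using w w_gt xi by (auto simp: rho_def field_simps)

lemma rho_eq: "xi / 2 * (rho\<^sup>2 + 1) = rho" "xi * rho = 1 - w"
proof -
  show "xi * rho = 1 - w" using xi by (simp add: rho_def)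
  have "(xi * rho)\<^sup>2 + xi\<^sup>2 = 2 * (xi * rho)"
    using w by (simp add: \<open>xi * rho = 1 - w\<close> power2_eq_square algebra_simps)
  then have "xi * (xi / 2 * (rho\<^sup>2 + 1)) = xi * rho" by (simp add: power2_eq_square algebra_simps)
  then show "xi / 2 * (rho\<^sup>2 + 1) = rho" using xi by simp
qed

lemma P_pos: "P l > 0" using rho w by (simp add: P_def)
lemma P_even: "P (- l) = P l" by (simp add: P_def)

lemma P_summable: "P summable_on UNIV"
  by (rule summable_on_int_split)
     (use P_pos rho in \<open>auto simp: less_imp_le P_def intro!: summable_divide summable_geometric\<close>)

lemma P_le_1: "P l \<le> 1 / w"
  using rho w by (simp add: P_def divide_right_mono power_le_one)

text \<open>In Fourier coefficients: psi times 1/psi is 1. Away from 0 this is the quadratic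
  equation for \<open>rho\<close>; at 0 it reads 1 - xi * rho = w, which fixes the normalisation of
  \<open>P\<close>.\<close>

lemma P_green: "P l - xi / 2 * (P (l - 1) + P (l + 1)) = (if l = 0 then 1 else 0)"
proof -
  have pos: "P l - xi / 2 * (P (l - 1) + P (l + 1)) = 0" if "l > 0" for l
  proof -
    define n where "n = nat (l - 1)"
    have n: "l = int (Suc n)" using that by (simp add: n_def)
    have "nat \<bar>l\<bar> = Suc n" "nat \<bar>l - 1\<bar> = n" "nat \<bar>l + 1\<bar> = Suc (Suc n)" using n by auto
    then have "P l - xi / 2 * (P (l - 1) + P (l + 1)) = rho ^ n * (rho - xi / 2 * (rho\<^sup>2 + 1)) / w"
      by (simp add: P_def power2_eq_square algebra_simps add_divide_distrib diff_divide_distrib)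
    then show ?thesis by (simp only: rho_eq) simp
  qed
  consider "l = 0" | "l > 0" | "- l > 0" by linarith
  then show ?thesis
  proof cases
    case 1
    have "1 - xi * rho = w" using rho_eq by simp
    then show ?thesis using 1 w by (simp add: P_def field_simps)
  next
    case 2 then show ?thesis using pos by simp
  next
    case 3
    have "P (- l - 1) = P (l + 1)" "P (- l + 1) = P (l - 1)"
      using P_even[of "l + 1"] P_even[of "l - 1"] by (simp_all only: minus_add_distrib minus_diff_eq uminus_add_conv_diff) (simp_all add: P_def abs_minus_commute add.commute)
    then show ?thesis using pos[OF 3] 3 P_even[of l] by (simp only:) simp
  qed
qed

lemma s_square: "(\<lambda>l. (s l)\<^sup>2) summable_on UNIV"
proof -
  have "Bseq (\<lambda>n. real n * s (int n))"
    using s_asymp convergentI convergent_imp_Bseq by blast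
  then obtain C where C: "C > 0" "\<And>n. norm (real n * s (int n)) \<le> C" by (auto simp: Bseq_def)
  have "summable (\<lambda>n. C\<^sup>2 * (1 / real n ^ 2))"
    using inverse_power_summable[of 2, where 'a = real] by (intro summable_mult) (simp add: field_simps)
  then have sm: "summable (\<lambda>n. (s (int n))\<^sup>2)"
  proof (rule summable_comparison_test'[where N = 1])
    fix n :: nat assume "n \<ge> 1"
    have "(real n * s (int n))\<^sup>2 \<le> C\<^sup>2" using C(2)[of n] C(1) by (simp add: abs_le_square_iff[symmetric])
    then show "norm ((s (int n))\<^sup>2) \<le> C\<^sup>2 * (1 / (real n)\<^sup>2)"
      using \<open>n \<ge> 1\<close> by (simp add: power_mult_distrib field_simps)
  qed
  show ?thesis by (rule summable_on_int_split) (use sm s_even in auto)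
qed

lemma d_square: "(\<lambda>l. (d l)\<^sup>2) summable_on UNIV"
proof (rule summable_on_comparison_test)
  show "(\<lambda>l. 2 / (1 - xi\<^sup>2)\<^sup>2 * ((s l)\<^sup>2 + (r l)\<^sup>2)) summable_on UNIV"
    by (intro summable_on_cmult_right summable_on_add s_square r_square)
  show "(d l)\<^sup>2 \<le> 2 / (1 - xi\<^sup>2)\<^sup>2 * ((s l)\<^sup>2 + (r l)\<^sup>2)" for l
  proof -
    have "(s l - r l)\<^sup>2 \<le> 2 * ((s l)\<^sup>2 + (r l)\<^sup>2)"
      using sum_squares_bound[of "s l" "- r l"] by (simp add: power2_eq_square algebra_simps)
    then show ?thesis by (simp add: d_def power_divide divide_right_mono)
  qed
qed auto

text \<open>\<open>B\<close> is the matrix of the operator conjugated by the square root of \<open>S\<close>; \<open>P\<close> lists the Fourier coefficients of \<open>1 / psi\<close>.\<close>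

definition "B i j = sqrt (s i) * sqrt (s j) * P (i - j) - (if i = j then d i else 0)"

lemma B_sym: "B i j = B j i"
  using P_even[of "i - j"] by (simp add: B_def)

text \<open>The bounds 2 * s i * s j <= (s i)^2 + (s j)^2 and P^2 <= P/w dominate the squared
  entries by summable convolutions; the diagonal correction is covered by
  \<open>d_square\<close>.\<close>

lemma B_hs: "(\<lambda>p. (B (fst p) (snd p))\<^sup>2) summable_on UNIV"
proof (rule summable_on_comparison_test)
  let ?u = "\<lambda>p::int\<times>int. (s (fst p))\<^sup>2 * ((1/w) * P (fst p - snd p))"
  let ?v = "\<lambda>p::int\<times>int. (s (snd p))\<^sup>2 * ((1/w) * P (fst p - snd p))"
  let ?d = "\<lambda>p::int\<times>int. if fst p = snd p then (d (fst p))\<^sup>2 else 0"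
  have wP: "(\<lambda>l. (1/w) * P l) summable_on UNIV" by (intro summable_on_cmult_right P_summable)
  have wP0: "(1/w) * P l \<ge> 0" for l using w P_pos[of l] by simp
  have "(\<lambda>p. (d (fst p))\<^sup>2) summable_on ((\<lambda>i. (i,i)) ` UNIV)"
    using d_square by (subst summable_on_reindex) (auto simp: inj_on_def o_def)
  then have sd: "?d summable_on UNIV"
    by (subst summable_on_cong_neutral[where T = "(\<lambda>i. (i,i)) ` UNIV" and g = "\<lambda>p. (d (fst p))\<^sup>2"]) auto
  show "(\<lambda>p. ?u p + ?v p + 2 * ?d p) summable_on UNIV"
    by (intro summable_on_add summable_on_cmult_right sd summable_on_convolution_fst
        summable_on_convolution_snd s_square wP wP0) auto
  fix p :: "int \<times> int"
  obtain i j where p: "p = (i,j)" by (cases p)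
  have "(B i j)\<^sup>2 \<le> 2 * (sqrt (s i) * sqrt (s j) * P (i - j))\<^sup>2 + 2 * (if i = j then d i else 0)\<^sup>2"
    unfolding B_def using sum_squares_bound[of "sqrt (s i) * sqrt (s j) * P (i - j)" "- (if i = j then d i else 0)"]
    by (simp add: power2_eq_square algebra_simps split: if_splits)
  also have "(sqrt (s i) * sqrt (s j) * P (i - j))\<^sup>2 = s i * s j * (P (i - j) * P (i - j))"
    using s_pos[of i] s_pos[of j] by (simp add: power_mult_distrib power2_eq_square[of "P _"])
  also have "2 * (s i * s j * (P (i - j) * P (i - j))) \<le> ((s i)\<^sup>2 + (s j)\<^sup>2) * ((1/w) * P (i - j))"
  proof -
    have "2 * (s i * s j) * (P (i - j) * P (i - j)) \<le> ((s i)\<^sup>2 + (s j)\<^sup>2) * ((1/w) * P (i - j))"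
      using sum_squares_bound[of "s i" "s j"] P_pos[of "i - j"] P_le_1[of "i - j"] s_pos[of i] s_pos[of j] w
      by (intro mult_mono) auto
    then show ?thesis by (simp only: mult.assoc)
  qed
  finally show "(B (fst p) (snd p))\<^sup>2 \<le> ?u p + ?v p + 2 * ?d p"
    by (simp add: p algebra_simps split: if_splits)
qed auto

text \<open>Otherwise the increments of \<open>n * s n\<close> would dominate a multiple of the harmonic series.\<close>

lemma exists_negative_diagonal: "\<exists>l. B l l < 0"
proof (rule ccontr)
  assume *: "\<not> (\<exists>l. B l l < 0)"
  \<comment> \<open>Since P 0 = 1/w, the diagonal entry is s l / w - (s l - r l) / w^2, and
    multiplying by w^2 isolates \<open>r l\<close>. The factor 1 - w is positive because the mean
    1/w lies below 1/w^2.\<close>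
  have r: "r l \<ge> (1 - w) * s l" for l
  proof -
    have "0 \<le> s l / w - (s l - r l) / w\<^sup>2" using * s_pos[of l] w(3)
      by (auto simp: B_def P_def d_def not_less dest!: spec[of _ l])
    then have "0 \<le> w\<^sup>2 * (s l / w - (s l - r l) / w\<^sup>2)" by (intro mult_nonneg_nonneg) auto
    also have "\<dots> = w * s l - (s l - r l)" using w by (simp add: field_simps power2_eq_square)
    finally show ?thesis by (simp add: algebra_simps)
  qed
  have "\<forall>\<^sub>F n in sequentially. real n * s (int n) > yinf / 2"
    by (rule order_tendstoD[OF s_asymp]) (use yinf_pos in auto)
  then obtain n0 where n0: "\<And>n. n \<ge> n0 \<Longrightarrow> real n * s (int n) > yinf / 2"
    by (auto simp: eventually_sequentially)
  show False
  proof (rule convergent_imp_not_harmonic_growth[OF s_asymp])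
    \<comment> \<open>One factor 1/2 comes from the average of two \<open>r\<close> values, the
      other from n * s n > yinf / 2. The value at \<open>Suc n\<close> is only used as
      positive.\<close>
    show "(1 - w) * yinf / 4 > 0" using w yinf_pos by simp
    fix n assume "n \<ge> Suc n0"
    then have n: "real n > 0" "real n * s (int n) > yinf / 2" using n0[of n] by auto
    have "(1 - w) * yinf / 4 / real n = (1 - w) / 2 * (yinf / 2 / real n)" by simp
    also have "\<dots> \<le> (1 - w) / 2 * s (int n)"
      using n w by (intro mult_left_mono) (auto simp: field_simps)
    also have "\<dots> \<le> (r (int n) + r (int (Suc n))) / 2"
    proof -
      have "0 < (1 - w) * s (int (Suc n))" using w s_pos by simp
      then show ?thesis using r[of "int n"] r[of "int (Suc n)"] by argo
    qed
    finally show "(1 - w) * yinf / 4 / real n \<le> real (Suc n) * s (int (Suc n)) - real n * s (int n)"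
      unfolding s_step .
  qed
qed

section \<open>Blocks of ones against the Toeplitz matrix of 1/psi\<close>

lemma toeplitz_sum:
  "(\<Sum>i<N. \<Sum>j<N. P (int i - int j)) =
    (real N * (1 + rho) / (1 - rho) - 2 * rho * (1 - rho ^ N) / (1 - rho)\<^sup>2) / w"
\<comment> \<open>The step adds a last row and a last column, equal because \<open>P\<close> is
  even, and a corner; each of the two is a geometric sum.\<close>
proof (induction N)
  case (Suc N)
  have row: "(\<Sum>i<N. P (int N - int i)) = rho * (1 - rho ^ N) / (1 - rho) / w"
  proof -
    have "(\<Sum>i<N. P (int N - int i)) = (\<Sum>i<N. rho ^ Suc (N - Suc i) / w)"
    proof (intro sum.cong refl)
      fix i assume "i \<in> {..<N}"
      then have "nat \<bar>int N - int i\<bar> = Suc (N - Suc i)" by auto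
      then show "P (int N - int i) = rho ^ Suc (N - Suc i) / w" by (simp only: P_def)
    qed
    also have "\<dots> = (\<Sum>i<N. rho ^ Suc i / w)"
      by (rule sum.nat_diff_reindex)
    also have "\<dots> = rho * (\<Sum>i<N. rho ^ i) / w"
      by (simp add: sum_distrib_left sum_divide_distrib)
    also have "\<dots> = rho * (1 - rho ^ N) / (1 - rho) / w"
      using rho by (simp add: sum_gp_strict)
    finally show ?thesis .
  qed
  have col: "(\<Sum>i<N. P (int i - int N)) = (\<Sum>i<N. P (int N - int i))"
    using P_even[of "int N - int _"] by (intro sum.cong) (auto simp: P_def abs_minus_commute)
  have P0: "P 0 = 1 / w" by (simp add: P_def)
  have "(\<Sum>i<Suc N. \<Sum>j<Suc N. P (int i - int j)) =
     (\<Sum>i<N. \<Sum>j<N. P (int i - int j)) + (\<Sum>i<N. P (int i - int N)) + (\<Sum>i<N. P (int N - int i)) + P 0"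
    by (simp add: sum.distrib)
  also have "\<dots> = (real N * (1 + rho) / (1 - rho) - 2 * rho * (1 - rho ^ N) / (1 - rho)\<^sup>2
       + 2 * (rho * (1 - rho ^ N) / (1 - rho)) + 1) / w"
    unfolding Suc.IH col row P0 by (simp add: add_divide_distrib diff_divide_distrib)
  also have "real N * (1 + rho) / (1 - rho) - 2 * rho * (1 - rho ^ N) / (1 - rho)\<^sup>2
       + 2 * (rho * (1 - rho ^ N) / (1 - rho)) + 1 =
      real (Suc N) * (1 + rho) / (1 - rho) - 2 * rho * (1 - rho ^ Suc N) / (1 - rho)\<^sup>2"
  proof -
    have "2 * rho * (1 - rho ^ Suc N) / (1 - rho)\<^sup>2 = 2 * rho * (1 - rho ^ N) / (1 - rho)\<^sup>2 + 2 * rho * rho ^ N * (1 - rho) / (1 - rho)\<^sup>2"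
      by (simp add: add_divide_distrib[symmetric]) (simp add: algebra_simps)
    also have "2 * rho * rho ^ N * (1 - rho) / (1 - rho)\<^sup>2 = 2 * rho * rho ^ N / (1 - rho)"
      using rho by (simp add: power2_eq_square)
    finally have a: "2 * rho * (1 - rho ^ Suc N) / (1 - rho)\<^sup>2 = 2 * rho * (1 - rho ^ N) / (1 - rho)\<^sup>2 + 2 * rho * rho ^ N / (1 - rho)" .
    have "2 * (rho * (1 - rho ^ N) / (1 - rho)) + 1 = (1 + rho) / (1 - rho) - 2 * rho * rho ^ N / (1 - rho)"
      using rho by (simp add: divide_simps) (simp add: algebra_simps)
    moreover have "real (Suc N) * (1 + rho) / (1 - rho) = real N * (1 + rho) / (1 - rho) + (1 + rho) / (1 - rho)"
      by (simp add: add_divide_distrib[symmetric] algebra_simps)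
    ultimately show ?thesis unfolding a by linarith
  qed
  finally show ?case .
qed simp

text \<open>Each index contributes 1/(1 - xi), the sum of all \<open>P l\<close> and thus the value
  of 1/psi at 0, while the ends of the block cost at most the constant \<open>D\<close>. As 1/(1 -
  xi) exceeds 1/(1 - xi^2), a long block wins.\<close>

lemma toeplitz_sum_large: "\<exists>N. (\<Sum>i<N. \<Sum>j<N. P (int i - int j)) > real N / (1 - xi\<^sup>2)"
proof -
  have c: "(1 + rho) / (1 - rho) / w = 1 / (1 - xi)"
  proof -
    have "(1 + rho) * (1 - xi) = (1 - rho) * w"
    proof -
      \<comment> \<open>After multiplication by \<open>xi\<close>, the relation xi * rho = 1 - w
        eliminates \<open>rho\<close>.\<close>
      have "xi * ((1 + rho) * (1 - xi)) = xi * ((1 - rho) * w)"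
        using rho_eq(2) w(3) by (simp add: algebra_simps power2_eq_square) algebra
      then show ?thesis using xi by simp
    qed
    then show ?thesis using rho w xi by (simp add: field_simps)
  qed
  define e where "e = 1 / (1 - xi) - 1 / (1 - xi\<^sup>2)"
  have e: "e > 0" unfolding e_def using xi xi2 by (simp add: divide_strict_left_mono power2_eq_square)
  define D where "D = 2 * rho / (1 - rho)\<^sup>2 / w"
  obtain N where N: "real N * e > D" using e reals_Archimedean3 by blast
  have "2 * rho * (1 - rho ^ N) / (1 - rho)\<^sup>2 / w \<le> D"
    unfolding D_def using rho w by (intro divide_right_mono) (auto simp: mult_le_cancel_left1)
  moreover have "(\<Sum>i<N. \<Sum>j<N. P (int i - int j)) =
      real N * ((1 + rho) / (1 - rho) / w) - 2 * rho * (1 - rho ^ N) / (1 - rho)\<^sup>2 / w"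
    unfolding toeplitz_sum by (simp add: diff_divide_distrib)
  ultimately have "(\<Sum>i<N. \<Sum>j<N. P (int i - int j)) \<ge> real N / (1 - xi) - D" unfolding c by simp
  moreover have "real N / (1 - xi) - D > real N / (1 - xi\<^sup>2)" using N by (simp add: e_def algebra_simps)
  ultimately show ?thesis by (intro exI[of _ N]) linarith
qed

text \<open>The moving sum of N consecutive terms n * s n converges, and its increment is the
  average of two neighbouring windows of \<open>r\<close>. If all late windows were at most -dl / L,
  the moving sum would drift like the harmonic series.\<close>

lemma exists_r_window:
  assumes "dl > 0"
  shows "\<exists>L\<ge>L0. L > 0 \<and> real L * (\<Sum>i<N. r (int (L + i))) > - dl"
proof (rule ccontr)
  assume *: "\<not> ?thesis"
  define y where "y n = real n * s (int n)" for n
  \<comment> \<open>The sign is reversed so that negative windows make \<open>Y\<close>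
    increase.\<close>
  define Y where "Y n = - (\<Sum>i<N. y (n + i))" for n
  have "(\<lambda>n. y (n + i)) \<longlonglongrightarrow> yinf" for i
    using s_asymp unfolding y_def by (rule LIMSEQ_ignore_initial_segment)
  then have lim: "Y \<longlonglongrightarrow> - (\<Sum>i<N. yinf)" unfolding Y_def by (intro tendsto_intros)
  have neg: "(\<Sum>i<N. r (int (L + i))) \<le> - dl / real L" if "L \<ge> Suc L0" for L
    using * that by (auto simp: not_less field_simps dest!: spec[of _ L])
  have diff: "(\<Sum>i<N. (r (int (n + i)) + r (int (Suc (n + i)))) / 2) = y (n + N) - y n" for n
  proof -
    have "(\<Sum>i<N. (r (int (n + i)) + r (int (Suc (n + i)))) / 2) = (\<Sum>i<N. y (n + Suc i) - y (n + i))"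
      by (intro sum.cong refl) (use s_step[of "n + _"] in \<open>simp add: y_def\<close>)
    also have "\<dots> = y (n + N) - y (n + 0)" by (rule sum_lessThan_telescope)
    finally show ?thesis by simp
  qed
  show False
  proof (rule convergent_imp_not_harmonic_growth[OF lim])
    show "dl / 2 > 0" using assms by simp
    fix n assume n: "n \<ge> Suc L0"
    have "Y (Suc n) - Y n = - (\<Sum>i<N. y (n + Suc i) - y (n + i))"
      by (simp add: Y_def sum_subtractf)
    also have "(\<Sum>i<N. y (n + Suc i) - y (n + i)) = y (n + N) - y (n + 0)" by (rule sum_lessThan_telescope)
    also have "\<dots> = ((\<Sum>i<N. r (int (n + i))) + (\<Sum>i<N. r (int (Suc n + i)))) / 2"
      by (simp add: diff[symmetric] sum_divide_distrib[symmetric] sum.distrib)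
    finally have "Y (Suc n) - Y n \<ge> (dl / real n + dl / real (Suc n)) / 2"
      using neg[of n] neg[of "Suc n"] n by (simp only: le_SucI, simp only: minus_divide_left[symmetric]) argo
    \<comment> \<open>Dropping the contribution of the second window leaves the constant dl /
      2.\<close>
    moreover have "dl / real (Suc n) \<ge> 0" using assms by simp
    ultimately show "dl / 2 / real n \<le> Y (Suc n) - Y n" by simp
  qed
qed

text \<open>The order of choices is N, then L0, then L. The gain \<open>kap\<close> depends on N
  only; multiplied by L, the part of the form without \<open>r\<close> tends to yinf * kap; finally
  L is taken so that the \<open>r\<close> part costs less than half of this.\<close>

lemma exists_positive_window: "\<exists>F. finite F \<and> (\<Sum>i\<in>F. \<Sum>j\<in>F. B i j) > 0"
proof -
  obtain N where N: "(\<Sum>i<N. \<Sum>j<N. P (int i - int j)) > real N / (1 - xi\<^sup>2)"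
    using toeplitz_sum_large by blast
  define kap where "kap = (\<Sum>i<N. \<Sum>j<N. P (int i - int j)) - (\<Sum>i<N. 1 / (1 - xi\<^sup>2))"
  have kap: "kap > 0" using N by (simp add: kap_def)
  define h where "h L = (\<Sum>i<N. \<Sum>j<N. sqrt (real L * s (int (L + i))) * sqrt (real L * s (int (L + j))) * P (int i - int j))
     - (\<Sum>i<N. real L * s (int (L + i)) / (1 - xi\<^sup>2))" for L
  have ls: "(\<lambda>L. real L * s (int (L + i))) \<longlonglongrightarrow> yinf" for i
  proof -
    have "(\<lambda>L. real (L + i) * s (int (L + i))) \<longlonglongrightarrow> yinf"
      using s_asymp by (rule LIMSEQ_ignore_initial_segment)
    moreover have "(\<lambda>L. real L / real (L + i)) \<longlonglongrightarrow> 1"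
    proof -
      have "(\<lambda>L. inverse (real (L + i))) \<longlonglongrightarrow> 0"
        using lim_inverse_n by (rule LIMSEQ_ignore_initial_segment)
      then have "(\<lambda>L. 1 - real i * inverse (real (L + i))) \<longlonglongrightarrow> 1 - real i * 0"
        by (intro tendsto_intros)
      moreover have "\<forall>\<^sub>F L in sequentially. 1 - real i * inverse (real (L + i)) = real L / real (L + i)"
        using eventually_gt_at_top[of 0] by eventually_elim (simp add: field_simps)
      ultimately show ?thesis by (simp add: tendsto_cong)
    qed
    ultimately have "(\<lambda>L. real (L + i) * s (int (L + i)) * (real L / real (L + i))) \<longlonglongrightarrow> yinf * 1"
      by (rule tendsto_mult)
    moreover have "\<forall>\<^sub>F L in sequentially. real (L + i) * s (int (L + i)) * (real L / real (L + i)) = real L * s (int (L + i))"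
      using eventually_gt_at_top[of 0] by eventually_elim (simp add: field_simps)
    ultimately show ?thesis by (simp add: tendsto_cong)
  qed
  have "h \<longlonglongrightarrow> (\<Sum>i<N. \<Sum>j<N. sqrt yinf * sqrt yinf * P (int i - int j)) - (\<Sum>i<N. yinf / (1 - xi\<^sup>2))"
    unfolding h_def using xi2 by (intro tendsto_intros ls) auto
  also have "(\<Sum>i<N. \<Sum>j<N. sqrt yinf * sqrt yinf * P (int i - int j)) - (\<Sum>i<N. yinf / (1 - xi\<^sup>2)) = yinf * kap"
    using yinf_pos by (simp add: kap_def algebra_simps sum_distrib_left)
  finally have "\<forall>\<^sub>F L in sequentially. h L > yinf * kap / 2"
    by (rule order_tendstoD) (use yinf_pos kap in auto)
  then obtain L0 where L0: "\<And>L. L \<ge> L0 \<Longrightarrow> h L > yinf * kap / 2" by (auto simp: eventually_sequentially)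
  \<comment> \<open>The factor 1 - xi^2 compensates the denominator of \<open>d\<close>.\<close>
  have "(1 - xi\<^sup>2) * (yinf * kap / 2) > 0" using xi2 yinf_pos kap by simp
  from exists_r_window[OF this, of L0 N] obtain L where L: "L \<ge> L0" "L > 0"
    "real L * (\<Sum>i<N. r (int (L + i))) > - ((1 - xi\<^sup>2) * (yinf * kap / 2))" by blast
  have rw: "real L * (\<Sum>i<N. r (int (L + i))) / (1 - xi\<^sup>2) > - (yinf * kap / 2)"
    using L(3) xi2 by (simp add: field_simps)
  define F where "F = (\<lambda>i. int (L + i)) ` {..<N}"
  have inj: "inj_on (\<lambda>i. int (L + i)) {..<N}" by (auto simp: inj_on_def)
  have "(\<Sum>i\<in>F. \<Sum>j\<in>F. B i j) = (\<Sum>i<N. \<Sum>j<N. B (int (L + i)) (int (L + j)))"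
    unfolding F_def by (simp only: sum.reindex[OF inj] o_def)
  then have "real L * (\<Sum>i\<in>F. \<Sum>j\<in>F. B i j) =
      (\<Sum>i<N. \<Sum>j<N. real L * B (int (L + i)) (int (L + j)))"
    by (simp add: sum_distrib_left)
  also have "\<dots> = (\<Sum>i<N. \<Sum>j<N. sqrt (real L * s (int (L + i))) * sqrt (real L * s (int (L + j))) * P (int i - int j)
      - (if i = j then real L * d (int (L + i)) else 0))"
    by (intro sum.cong refl) (simp add: B_def real_sqrt_mult algebra_simps)
  also have "\<dots> = (\<Sum>i<N. \<Sum>j<N. sqrt (real L * s (int (L + i))) * sqrt (real L * s (int (L + j))) * P (int i - int j))
      - (\<Sum>i<N. real L * d (int (L + i)))"
    by (simp add: sum_subtractf)
  also have "(\<Sum>i<N. real L * d (int (L + i))) =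
      (\<Sum>i<N. real L * s (int (L + i)) / (1 - xi\<^sup>2)) - real L * (\<Sum>i<N. r (int (L + i))) / (1 - xi\<^sup>2)"
    by (simp add: d_def sum_distrib_left sum_divide_distrib sum_subtractf[symmetric] diff_divide_distrib right_diff_distrib)
  finally have "real L * (\<Sum>i\<in>F. \<Sum>j\<in>F. B i j) = h L + real L * (\<Sum>i<N. r (int (L + i))) / (1 - xi\<^sup>2)"
    by (simp add: h_def)
  then have "real L * (\<Sum>i\<in>F. \<Sum>j\<in>F. B i j) > 0" using rw L0[OF L(1)] by linarith
  then have "(\<Sum>i\<in>F. \<Sum>j\<in>F. B i j) > 0" using L(2) by (simp add: zero_less_mult_iff)
  moreover have "finite F" by (simp add: F_def)
  ultimately show ?thesis by blast
qed

text \<open>The eigenvalue equation multiplied by psi, in Fourier coefficients: psi acts by a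
  tridiagonal matrix, so no infinite convolution is left. Absolute summability makes the Fourier
  series a continuous function.\<close>

definition is_symbol_eigenvector :: "real \<Rightarrow> (int \<Rightarrow> real) \<Rightarrow> bool" where
  "is_symbol_eigenvector lam g \<longleftrightarrow> (\<lambda>l. \<bar>g l\<bar>) summable_on UNIV \<and> (\<exists>l. g l \<noteq> 0) \<and>
     (\<forall>l. (lam + d l) * g l - xi / 2 * ((lam + d (l - 1)) * g (l - 1) + (lam + d (l + 1)) * g (l + 1)) = s l * g l)"

text \<open>Square summability lets |d l| exceed |lam| / 2 only finitely often, so off a finite set
  one may divide by lam + d l.\<close>

lemma eventually_shift_bounded_below:
  assumes "lam \<noteq> 0"
  shows "finite {l. \<bar>lam + d l\<bar> < \<bar>lam\<bar> / 2}"
proof -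
  have "finite {l. (d l)\<^sup>2 \<ge> (\<bar>lam\<bar> / 2)\<^sup>2}"
  proof (rule ccontr)
    assume inf: "infinite {l. (d l)\<^sup>2 \<ge> (\<bar>lam\<bar> / 2)\<^sup>2}"
    obtain n :: nat where n: "real n * (\<bar>lam\<bar> / 2)\<^sup>2 > (\<Sum>\<^sub>\<infinity>l. (d l)\<^sup>2)"
      using assms reals_Archimedean3[of "(\<bar>lam\<bar> / 2)\<^sup>2"] by auto
    obtain F where F: "finite F" "card F = n" "F \<subseteq> {l. (d l)\<^sup>2 \<ge> (\<bar>lam\<bar> / 2)\<^sup>2}"
      using infinite_arbitrarily_large[OF inf] by blast
    have "real n * (\<bar>lam\<bar> / 2)\<^sup>2 \<le> (\<Sum>l\<in>F. (d l)\<^sup>2)"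
      using sum_bounded_below[of F "(\<bar>lam\<bar> / 2)\<^sup>2" "\<lambda>l. (d l)\<^sup>2"] F by auto
    also have "\<dots> \<le> (\<Sum>\<^sub>\<infinity>l. (d l)\<^sup>2)" by (rule finite_sum_le_infsum[OF d_square]) (use F in auto)
    finally show False using n by simp
  qed
  then show ?thesis
  proof (rule finite_subset[rotated], safe)
    fix l assume "\<bar>lam + d l\<bar> < \<bar>lam\<bar> / 2"
    then have "\<bar>lam\<bar> / 2 \<le> \<bar>d l\<bar>" by linarith
    then show "(\<bar>lam\<bar> / 2)\<^sup>2 \<le> (d l)\<^sup>2" using abs_le_square_iff[of "\<bar>lam\<bar> / 2" "d l"] by simp
  qed
qed

text \<open>The eigenvector gains regularity from \<open>(lam + d) g = P (s g)\<close>: it is first square summable, and then, since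
  \<open>s\<close> is square summable, absolutely summable.\<close>

lemma eigenvector_B_imp_symbol_eigenvector:
  assumes lam: "lam \<noteq> 0" and f: "(\<lambda>l. (f l)\<^sup>2) summable_on UNIV" "\<exists>l. f l \<noteq> 0"
    and eig: "\<And>i. ((\<lambda>j. B i j * f j) has_sum lam * f i) UNIV"
  shows "is_symbol_eigenvector lam (\<lambda>l. f l / sqrt (s l))"
proof -
  define g where "g l = f l / sqrt (s l)" for l
  define x where "x l = (lam + d l) * g l" for l
  have sqs: "sqrt (s l) > 0" for l using s_pos by simp
  have sg: "s l * g l = sqrt (s l) * f l" for l
    using s_pos[of l] by (simp add: g_def field_simps real_sqrt_mult[symmetric])
  \<comment> \<open>The eigenvalue equation of \<open>B\<close> divided by sqrt (s i), with the
    diagonal term moved to the right.\<close>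
  have x: "((\<lambda>j. P (i - j) * (s j * g j)) has_sum x i) UNIV" for i
  proof -
    have "((\<lambda>j. if j = i then d i * f i else 0) has_sum d i * f i) UNIV"
      by (subst has_sum_cong_neutral[where T = "{i}" and g = "\<lambda>_. d i * f i"]) (auto intro!: has_sum_finiteI)
    from has_sum_add[OF eig[of i] this]
    have "((\<lambda>j. B i j * f j + (if j = i then d i * f i else 0)) has_sum (lam + d i) * f i) UNIV"
      by (simp add: algebra_simps)
    also have "(\<lambda>j. B i j * f j + (if j = i then d i * f i else 0)) = (\<lambda>j. sqrt (s i) * (P (i - j) * (s j * g j)))"
      by (simp add: fun_eq_iff B_def sg) (simp add: algebra_simps)
    finally have "((\<lambda>j. 1 / sqrt (s i) * (sqrt (s i) * (P (i - j) * (s j * g j)))) has_sum 1 / sqrt (s i) * ((lam + d i) * f i)) UNIV"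
      by (rule has_sum_cmult_right)
    then show ?thesis using s_pos[of i] by (simp add: x_def g_def)
  qed
  \<comment> \<open>Off the finite exceptional set \<open>x\<close> controls \<open>g\<close>; on it
    \<open>g\<close> serves as its own bound, at no cost for summability.\<close>
  have dom: "\<exists>C. \<forall>l. \<bar>g l\<bar> \<le> C * \<bar>x l\<bar> + (if \<bar>lam + d l\<bar> < \<bar>lam\<bar> / 2 then \<bar>g l\<bar> else 0)"
  proof (intro exI[of _ "2 / \<bar>lam\<bar>"] allI)
    fix l
    show "\<bar>g l\<bar> \<le> 2 / \<bar>lam\<bar> * \<bar>x l\<bar> + (if \<bar>lam + d l\<bar> < \<bar>lam\<bar> / 2 then \<bar>g l\<bar> else 0)"
    proof (cases "\<bar>lam + d l\<bar> < \<bar>lam\<bar> / 2")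
      case False
      then have "\<bar>lam\<bar> / 2 * \<bar>g l\<bar> \<le> \<bar>x l\<bar>" unfolding x_def abs_mult by (intro mult_right_mono) auto
      then show ?thesis using lam False by (simp add: field_simps)
    qed auto
  qed
  then obtain C where C: "\<And>l. \<bar>g l\<bar> \<le> C * \<bar>x l\<bar> + (if \<bar>lam + d l\<bar> < \<bar>lam\<bar> / 2 then \<bar>g l\<bar> else 0)" by blast
  have fin: "(\<lambda>l. if \<bar>lam + d l\<bar> < \<bar>lam\<bar> / 2 then h l else 0) summable_on UNIV" for h :: "int \<Rightarrow> real"
    by (rule finite_nonzero_values_imp_summable_on, rule finite_subset[OF _ eventually_shift_bounded_below[OF lam]]) auto
  \<comment> \<open>Here (s l * g l)^2 = s l * (f l)^2, and s l <= 1 + (s l)^2 bounds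
    \<open>s\<close> by a constant.\<close>
  have z2: "(\<lambda>l. (s l * g l)\<^sup>2) summable_on UNIV"
  proof (rule summable_on_comparison_test)
    show "(\<lambda>l. (s l)\<^sup>2 + (f l)\<^sup>2 * (1 + infsum (\<lambda>l. (s l)\<^sup>2) UNIV)) summable_on UNIV"
      by (intro summable_on_add s_square summable_on_cmult_left f)
    show "(s l * g l)\<^sup>2 \<le> (s l)\<^sup>2 + (f l)\<^sup>2 * (1 + infsum (\<lambda>l. (s l)\<^sup>2) UNIV)" for l
    proof -
      have "(s l)\<^sup>2 \<le> infsum (\<lambda>l. (s l)\<^sup>2) UNIV"
        using finite_sum_le_infsum[OF s_square, of "{l}"] by simp
      moreover have "s l \<le> 1 + (s l)\<^sup>2"
        using sum_squares_bound[of "s l" 1] s_pos[of l] by (simp add: power2_eq_square) 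
      ultimately have "s l * (f l)\<^sup>2 \<le> (1 + infsum (\<lambda>l. (s l)\<^sup>2) UNIV) * (f l)\<^sup>2"
        by (intro mult_right_mono) auto
      moreover have "(s l * g l)\<^sup>2 = s l * (f l)\<^sup>2"
        using s_pos[of l] by (simp add: sg power_mult_distrib)
      ultimately show ?thesis by (smt (verit) mult.commute zero_le_power2)
    qed
  qed auto
  have P0: "P l \<ge> 0" for l using P_pos[of l] by simp
  have x2: "(\<lambda>l. (x l)\<^sup>2) summable_on UNIV"
    by (rule square_summable_convolution[OF z2 P_summable P0 x])
  have g2: "(\<lambda>l. (g l)\<^sup>2) summable_on UNIV"
  proof (rule summable_on_comparison_test)
    show "(\<lambda>l. C\<^sup>2 * (x l)\<^sup>2 + (if \<bar>lam + d l\<bar> < \<bar>lam\<bar> / 2 then (g l)\<^sup>2 else 0)) summable_on UNIV"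
      by (intro summable_on_add summable_on_cmult_right x2 fin)
    show "(g l)\<^sup>2 \<le> C\<^sup>2 * (x l)\<^sup>2 + (if \<bar>lam + d l\<bar> < \<bar>lam\<bar> / 2 then (g l)\<^sup>2 else 0)" for l
      using C[of l] power_mono[of "\<bar>g l\<bar>" "C * \<bar>x l\<bar>" 2] by (auto simp: power_mult_distrib)
  qed auto
  have z1: "(\<lambda>l. \<bar>s l * g l\<bar>) summable_on UNIV"
    using summable_on_mult_square[OF s_square g2] summable_on_iff_abs_summable_on_real[of "\<lambda>l. s l * g l"] by simp
  have x1: "(\<lambda>l. \<bar>x l\<bar>) summable_on UNIV"
    by (rule abs_summable_convolution[OF z1 P_summable P0 x])
  have g1: "(\<lambda>l. \<bar>g l\<bar>) summable_on UNIV"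
  proof (rule summable_on_comparison_test)
    show "(\<lambda>l. C * \<bar>x l\<bar> + (if \<bar>lam + d l\<bar> < \<bar>lam\<bar> / 2 then \<bar>g l\<bar> else 0)) summable_on UNIV"
      by (intro summable_on_add summable_on_cmult_right x1 fin)
  qed (use C in auto)
  \<comment> \<open>Applying psi undoes the convolution with \<open>P\<close>: by
    \<open>P_green\<close> only the diagonal term survives.\<close>
  have green: "x i - xi / 2 * (x (i - 1) + x (i + 1)) = s i * g i" for i
  proof -
    have "((\<lambda>j. P (i - j) * (s j * g j) + (- xi / 2) * (P (i - 1 - j) * (s j * g j) + P (i + 1 - j) * (s j * g j)))
        has_sum (x i + (- xi / 2) * (x (i - 1) + x (i + 1)))) UNIV"
      by (intro has_sum_add has_sum_cmult_right x)
    also have "(\<lambda>j. P (i - j) * (s j * g j) + (- xi / 2) * (P (i - 1 - j) * (s j * g j) + P (i + 1 - j) * (s j * g j)))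
      = (\<lambda>j. (P (i - j) - xi / 2 * (P (i - j - 1) + P (i - j + 1))) * (s j * g j))"
      by (simp add: algebra_simps)
    also have "\<dots> = (\<lambda>j. if j = i then s i * g i else 0)" by (simp only: P_green) auto
    finally have 1: "((\<lambda>j. if j = i then s i * g i else 0) has_sum (x i + (- xi / 2) * (x (i - 1) + x (i + 1)))) UNIV" .
    have 2: "((\<lambda>j. if j = i then s i * g i else 0) has_sum s i * g i) UNIV"
      by (subst has_sum_cong_neutral[where T = "{i}" and g = "\<lambda>_. s i * g i"]) (auto intro!: has_sum_finiteI)
    show ?thesis using has_sum_unique[OF 1 2] by simp
  qed
  have "\<exists>l. g l \<noteq> 0" using f(2) sqs by (auto simp: g_def less_imp_neq[symmetric])
  then show ?thesis
    using g1 green unfolding is_symbol_eigenvector_def x_def g_def by blast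
qed

lemma exists_positive_symbol_eigenvector: "\<exists>lam>0. \<exists>g. is_symbol_eigenvector lam g"
proof -
  obtain F where F: "finite F" "(\<Sum>i\<in>F. \<Sum>j\<in>F. B i j * 1 * 1) > 0"
    using exists_positive_window by auto
  obtain lam f where "lam > 0" "(\<lambda>i. (f i)\<^sup>2) summable_on UNIV" "\<exists>i. f i \<noteq> 0"
    "\<And>i. ((\<lambda>j. B i j * f j) has_sum lam * f i) UNIV"
    using hs_positive_eigenvalue[OF B_hs B_sym F] by blast
  then show ?thesis
    using eigenvector_B_imp_symbol_eigenvector[of lam f] by (intro exI[of _ lam]) auto
qed

lemma exists_negative_symbol_eigenvector: "\<exists>lam<0. \<exists>g. is_symbol_eigenvector lam g"
proof -
  obtain l where l: "B l l < 0" using exists_negative_diagonal by blast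
  have hs: "(\<lambda>p. (- B (fst p) (snd p))\<^sup>2) summable_on UNIV" using B_hs by simp
  have sym: "- B i j = - B j i" for i j using B_sym[of i j] by simp
  have pos: "(\<Sum>i\<in>{l}. \<Sum>j\<in>{l}. - B i j * 1 * 1) > 0" using l by simp
  obtain lam f where *: "lam > 0" "(\<lambda>i. (f i)\<^sup>2) summable_on UNIV" "\<exists>i. f i \<noteq> 0"
    "\<And>i. ((\<lambda>j. - B i j * f j) has_sum lam * f i) UNIV"
    using hs_positive_eigenvalue[of "\<lambda>i j. - B i j", OF hs sym _ pos] by blast
  have "((\<lambda>j. B i j * f j) has_sum (- lam) * f i) UNIV" for i
    using has_sum_uminusI[OF *(4)[of i]] by simp
  then show ?thesis
    using eigenvector_B_imp_symbol_eigenvector[of "- lam" f] * by (intro exI[of _ "- lam"]) auto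
qed

end

section \<open>The circle\<close>

text \<open>The closed interval as a finite measure space in its own right, so that Fubini and
  integrability of bounded functions apply directly.\<close>

definition circ :: "real measure" where "circ = restrict_space lborel {0..2*pi}"

lemma space_circ: "space circ = {0..2*pi}"
  by (simp add: circ_def space_restrict_space)

lemma borel_measurable_circ: "f \<in> borel_measurable borel \<Longrightarrow> f \<in> borel_measurable circ"
  unfolding circ_def by (intro measurable_restrict_space1) simp

lemma ident_measurable_circ [measurable]: "(\<lambda>x. x) \<in> borel_measurable circ"
  by (rule borel_measurable_circ) simp

lemma integral_circ:
  fixes f :: "real \<Rightarrow> 'a::{banach,second_countable_topology}"
  shows "integral\<^sup>L circ f = (LINT x:{0..2*pi}|lborel. f x)"
  unfolding circ_def set_lebesgue_integral_def by (subst integral_restrict_space) auto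

lemma integrable_circ:
  fixes f :: "real \<Rightarrow> 'a::{banach,second_countable_topology}"
  shows "integrable circ f \<longleftrightarrow> set_integrable lborel {0..2*pi} f"
  unfolding circ_def set_integrable_def by (subst integrable_restrict_space) auto

lemma emeasure_circ: "emeasure circ (space circ) = ennreal (2 * pi)"
  unfolding space_circ by (simp add: circ_def emeasure_restrict_space)

lemma measure_circ: "measure circ (space circ) = 2 * pi"
  by (simp add: measure_def emeasure_circ)

interpretation circ: finite_measure circ
  by standard (simp add: emeasure_circ)

interpretation circ2: pair_sigma_finite circ circ ..

interpretation circ2: finite_measure "circ \<Otimes>\<^sub>M circ"
  by (rule finite_measure_pair_measure) (rule circ.finite_measure_axioms)+

lemma AE_circ: "(AE x in circ. P x) \<longleftrightarrow> (AE x in lborel. x \<in> {0..2*pi} \<longrightarrow> P x)"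
  unfolding circ_def by (subst AE_restrict_space_iff) auto

lemma AE_circ_interior: "AE x in circ. 0 < x \<and> x < 2 * pi"
proof -
  have "AE x in lborel. x \<noteq> 0 \<and> x \<noteq> 2 * pi"
    using AE_lborel_singleton[of 0] AE_lborel_singleton[of "2 * pi"] by eventually_elim auto
  then show ?thesis unfolding AE_circ by eventually_elim auto
qed

lemma integrable_circ_bounded:
  fixes f :: "real \<Rightarrow> 'a::{banach,second_countable_topology}"
  assumes "f \<in> borel_measurable circ" "\<And>x. x \<in> {0..2*pi} \<Longrightarrow> norm (f x) \<le> C"
  shows "integrable circ f"
  by (rule circ.integrable_const_bound[of _ C]) (use assms in \<open>auto simp: space_circ\<close>)

lemma integrable_circ_continuous:
  fixes f :: "real \<Rightarrow> 'a::{banach,second_countable_topology}"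
  assumes "continuous_on UNIV f"
  shows "integrable circ f"
  unfolding integrable_circ by (rule borel_integrable_atLeastAtMost') (use assms continuous_on_subset in blast)

lemma integral_circ_FTC:
  fixes f F :: "real \<Rightarrow> real"
  assumes "\<And>x. 0 \<le> x \<Longrightarrow> x \<le> 2 * pi \<Longrightarrow> DERIV F x :> f x"
    and "\<And>x. 0 \<le> x \<Longrightarrow> x \<le> 2 * pi \<Longrightarrow> isCont f x"
  shows "(\<integral>x. f x \<partial>circ) = F (2 * pi) - F 0"
  unfolding integral_circ set_lebesgue_integral_def
  using integral_FTC_Icc_real[of 0 "2 * pi" F f] assms by (simp add: mult.commute)

lemma integral_circ_cos: "(\<integral>t. cos (of_int l * t) \<partial>circ) = (if l = 0 then 2 * pi else 0)"
proof (cases "l = 0")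
  case False
  have "(\<integral>t. cos (of_int l * t) \<partial>circ) = sin (of_int l * (2 * pi)) / of_int l - sin (of_int l * 0) / of_int l"
    by (rule integral_circ_FTC) (use False in \<open>auto intro!: derivative_eq_intros\<close>)
  then show ?thesis using False sin_int_2pin[of l] by (simp add: mult.commute)
qed (simp add: measure_circ)

lemma integral_circ_sin: "(\<integral>t. sin (of_int l * t) \<partial>circ) = 0"
proof (cases "l = 0")
  case False
  have "(\<integral>t. sin (of_int l * t) \<partial>circ) = (- cos (of_int l * (2 * pi)) / of_int l) - (- cos (of_int l * 0) / of_int l)"
    by (rule integral_circ_FTC) (use False in \<open>auto intro!: derivative_eq_intros\<close>)
  then show ?thesis using False cos_int_2pin[of l] by (simp add: mult.commute)
qed simp

definition fexp :: "int \<Rightarrow> real \<Rightarrow> complex" where "fexp l t = cis (of_int l * t)"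

lemma fexp_eq_exp: "fexp l t = exp (\<i> * of_int l * of_real t)"
  by (simp add: fexp_def cis_conv_exp mult.assoc)

lemma norm_fexp [simp]: "norm (fexp l t) = 1" by (simp add: fexp_def)
lemma cnj_fexp: "cnj (fexp l t) = fexp (- l) t" by (simp add: fexp_def cis_cnj)
lemma fexp_mult: "fexp l t * fexp m t = fexp (l + m) t" by (simp add: fexp_def cis_mult algebra_simps)
lemma fexp_0 [simp]: "fexp 0 t = 1" by (simp add: fexp_def)

lemma continuous_fexp [continuous_intros]: "continuous_on A (fexp l)"
  unfolding fexp_def cis_conv_exp by (intro continuous_intros)

lemma fexp_borel [measurable]: "fexp l \<in> borel_measurable borel"
  by (intro borel_measurable_continuous_onI continuous_intros)

lemma integral_circ_fexp: "(\<integral>t. fexp l t \<partial>circ) = (if l = 0 then 2 * pi else 0)"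
proof -
  have i: "integrable circ (fexp l)" by (intro integrable_circ_continuous continuous_intros)
  have "Re (\<integral>t. fexp l t \<partial>circ) = (\<integral>t. cos (of_int l * t) \<partial>circ)"
    by (subst integral_Re[OF i, symmetric]) (simp add: fexp_def)
  moreover have "Im (\<integral>t. fexp l t \<partial>circ) = (\<integral>t. sin (of_int l * t) \<partial>circ)"
    by (subst integral_Im[OF i, symmetric]) (simp add: fexp_def)
  ultimately show ?thesis by (simp add: complex_eq_iff integral_circ_cos integral_circ_sin)
qed

text \<open>Nonnegativity of the squared distance from \<open>h\<close> to its partial Fourier sum
  \<open>p\<close>. The coefficients carry no factor 1/(2 pi), hence the factor 2 * pi in the
  bound.\<close>

theorem Bessel_circ:
  fixes h :: "real \<Rightarrow> complex"
  assumes h[measurable]: "h \<in> borel_measurable circ" and bd: "\<And>t. t \<in> {0..2*pi} \<Longrightarrow> norm (h t) \<le> C"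
  shows "(\<lambda>l. (norm (\<integral>t. h t * fexp (- l) t \<partial>circ))\<^sup>2) summable_on UNIV"
proof -
  define c where "c l = (\<integral>t. h t * fexp (- l) t \<partial>circ)" for l
  have ih: "integrable circ (\<lambda>t. h t * fexp l t)" for l
    by (rule integrable_circ_bounded[where C = C]) (use bd in \<open>auto simp: norm_mult\<close>)
  have [measurable]: "(\<lambda>t. cnj (h t)) \<in> borel_measurable circ"
    by (rule measurable_compose[OF h]) (intro borel_measurable_continuous_onI continuous_intros)
  have ihh: "integrable circ (\<lambda>t. h t * cnj (h t))"
    by (rule integrable_circ_bounded[where C = "C * C"]) (use bd in \<open>auto simp: norm_mult intro!: mult_mono order_trans[OF norm_ge_zero]\<close>)
  have iex: "integrable circ (\<lambda>t. fexp l t)" for l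
    by (intro integrable_circ_continuous continuous_intros)
  have bound: "(\<Sum>l\<in>F. (norm (c l))\<^sup>2) \<le> 2 * pi * Re (\<integral>t. h t * cnj (h t) \<partial>circ)" if F: "finite F" for F
  proof -
    define p where "p t = (\<Sum>l\<in>F. c l / (2 * pi) * fexp l t)" for t
    have cnjp: "cnj (p t) = (\<Sum>l\<in>F. cnj (c l) / (2 * pi) * fexp (- l) t)" for t
      by (simp add: p_def cnj_fexp)
    have hp: "h t * cnj (p t) = (\<Sum>l\<in>F. cnj (c l) / (2 * pi) * (h t * fexp (- l) t))" for t
      by (simp add: cnjp sum_distrib_left mult_ac)
    have pp: "p t * cnj (p t) = (\<Sum>l\<in>F. \<Sum>m\<in>F. c l * cnj (c m) / (2 * pi)\<^sup>2 * fexp (l - m) t)" for t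
    proof -
      have "p t * cnj (p t) = (\<Sum>l\<in>F. \<Sum>m\<in>F. (c l / (2 * pi) * fexp l t) * (cnj (c m) / (2 * pi) * fexp (- m) t))"
        unfolding cnjp by (simp add: p_def sum_product)
      also have "\<dots> = (\<Sum>l\<in>F. \<Sum>m\<in>F. c l * cnj (c m) / (2 * pi)\<^sup>2 * (fexp l t * fexp (- m) t))"
        by (intro sum.cong refl) (simp add: power2_eq_square)
      finally show ?thesis by (simp add: fexp_mult)
    qed
    have i1: "integrable circ (\<lambda>t. h t * cnj (p t))"
      unfolding hp by (intro Bochner_Integration.integrable_sum integrable_mult_right ih)
    have i2: "integrable circ (\<lambda>t. p t * cnj (p t))"
      unfolding pp by (intro Bochner_Integration.integrable_sum integrable_mult_right iex)
    define S where "S = (\<Sum>l\<in>F. (norm (c l))\<^sup>2) / (2 * pi)"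
    have cc: "cnj (c l) * c l = complex_of_real ((norm (c l))\<^sup>2)" for l
      by (metis complex_norm_square mult.commute)
    have v1: "(\<integral>t. h t * cnj (p t) \<partial>circ) = of_real S"
    proof -
      have "(\<integral>t. h t * cnj (p t) \<partial>circ) = (\<Sum>l\<in>F. cnj (c l) / (2 * pi) * c l)"
        unfolding hp by (subst Bochner_Integration.integral_sum) (auto intro!: integrable_mult_right ih simp: c_def)
      also have "\<dots> = (\<Sum>l\<in>F. complex_of_real ((norm (c l))\<^sup>2) / complex_of_real (2 * pi))"
        by (intro sum.cong refl) (simp only: cc[symmetric] times_divide_eq_left)
      finally show ?thesis by (simp add: S_def sum_divide_distrib)
    qed
    have v2: "(\<integral>t. p t * cnj (p t) \<partial>circ) = of_real S"
    proof -
      have "(\<integral>t. p t * cnj (p t) \<partial>circ) =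
          (\<Sum>l\<in>F. \<Sum>m\<in>F. c l * cnj (c m) / (2 * pi)\<^sup>2 * (if l - m = 0 then 2 * pi else 0))"
        unfolding pp by (simp add: Bochner_Integration.integral_sum Bochner_Integration.integrable_sum integrable_mult_right iex integral_circ_fexp)
      also have "\<dots> = (\<Sum>l\<in>F. \<Sum>m\<in>F. if l = m then c l * cnj (c l) / (2 * pi) else 0)"
        by (intro sum.cong refl) (auto simp: power2_eq_square)
      also have "\<dots> = (\<Sum>l\<in>F. complex_of_real ((norm (c l))\<^sup>2) / complex_of_real (2 * pi))"
        using F by (simp only: cc[symmetric] sum.delta' sum.delta mult.commute) simp
      finally show ?thesis by (simp add: S_def sum_divide_distrib)
    qed
    have v3: "(\<integral>t. cnj (h t) * p t \<partial>circ) = of_real S"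
      using arg_cong[OF v1, of cnj] by (simp add: Bochner_Integration.integral_cnj[symmetric] del: Bochner_Integration.integral_cnj)
    have i3: "integrable circ (\<lambda>t. cnj (h t) * p t)"
      using integrable_cnj[of circ "\<lambda>t. h t * cnj (p t)"] i1 by simp
    have "(\<integral>t. (h t - p t) * cnj (h t - p t) \<partial>circ) =
        (\<integral>t. h t * cnj (h t) - h t * cnj (p t) - cnj (h t) * p t + p t * cnj (p t) \<partial>circ)"
      by (intro Bochner_Integration.integral_cong) (auto simp: algebra_simps)
    also have "\<dots> = (\<integral>t. h t * cnj (h t) \<partial>circ) - of_real S - of_real S + of_real S"
      using i1 i2 i3 ihh by (simp add: v1 v2 v3)
    finally have e: "(\<integral>t. (h t - p t) * cnj (h t - p t) \<partial>circ) = (\<integral>t. h t * cnj (h t) \<partial>circ) - of_real S" by simp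
    have "(\<lambda>t. (h t - p t) * cnj (h t - p t)) = (\<lambda>t. complex_of_real ((norm (h t - p t))\<^sup>2))"
      by (intro ext, rule complex_norm_square[symmetric])
    then have "Re (\<integral>t. (h t - p t) * cnj (h t - p t) \<partial>circ) = (\<integral>t. (norm (h t - p t))\<^sup>2 \<partial>circ)"
      by (simp only: integral_complex_of_real Re_complex_of_real)
    moreover have "(\<integral>t. (norm (h t - p t))\<^sup>2 \<partial>circ) \<ge> 0" by simp
    ultimately have "S \<le> Re (\<integral>t. h t * cnj (h t) \<partial>circ)" unfolding e
      by (simp only: minus_complex.sel Re_complex_of_real)
    then show ?thesis by (simp add: S_def field_simps)
  qed
  show ?thesis
    unfolding c_def[symmetric]
    by (rule nonneg_bdd_above_summable_on) (use bound in \<open>auto intro!: bdd_aboveI2\<close>)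
qed

text \<open>Reflection carries [0, a] to itself, while the rest of the interval has to be shifted by
  one period; therefore the integral is cut at \<open>a\<close>.\<close>

lemma integral_circ_reflect:
  fixes f :: "real \<Rightarrow> 'a::{banach,second_countable_topology}"
  assumes fb: "f \<in> borel_measurable borel" and f: "integrable circ f" and per: "\<And>t. f (t + 2 * pi) = f t" and a: "0 \<le> a" "a \<le> 2 * pi"
  shows "integrable circ (\<lambda>t. f (a - t))" "(\<integral>t. f (a - t) \<partial>circ) = (\<integral>t. f t \<partial>circ)"
proof -
  let ?g1 = "\<lambda>x. indicator {0..a} x *\<^sub>R f x" and ?g2 = "\<lambda>x. indicator {a<..2*pi} x *\<^sub>R f x"
  have fi: "set_integrable lborel {0..2*pi} f" using f by (simp add: integrable_circ)
  have 1: "integrable lborel ?g1" 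
    using set_integrable_subset[OF fi, of "{0..a}"] a by (auto simp: set_integrable_def)
  have 2: "integrable lborel ?g2"
    using set_integrable_subset[OF fi, of "{a<..2*pi}"] a by (force simp: set_integrable_def)
  have "indicator {0..2*pi} x *\<^sub>R f x = ?g1 x + ?g2 x" for x
    using a by (auto simp: indicator_def)
  then have I: "(\<integral>t. f t \<partial>circ) = (\<integral>x. ?g1 x \<partial>lborel) + (\<integral>x. ?g2 x \<partial>lborel)"
    using 1 2 by (simp add: integral_circ set_lebesgue_integral_def)
  have h1: "has_bochner_integral lborel (\<lambda>x. ?g1 (a + (-1) * x)) (\<integral>x. ?g1 x \<partial>lborel)"
    using lborel_has_bochner_integral_real_affine_iff[of "-1" ?g1 "\<integral>x. ?g1 x \<partial>lborel" a] 1
    by (simp add: has_bochner_integral_integrable)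
  have h2: "has_bochner_integral lborel (\<lambda>x. ?g2 ((a + 2 * pi) + (-1) * x)) (\<integral>x. ?g2 x \<partial>lborel)"
    using lborel_has_bochner_integral_real_affine_iff[of "-1" ?g2 "\<integral>x. ?g2 x \<partial>lborel" "a + 2 * pi"] 2
    by (simp add: has_bochner_integral_integrable)
  have p: "f (a + 2 * pi - x) = f (a - x)" for x using per[of "a - x"] by (simp add: algebra_simps)
  have ae: "AE x in lborel. ?g1 (a + (-1) * x) + ?g2 ((a + 2 * pi) + (-1) * x) = indicator {0..2*pi} x *\<^sub>R f (a - x)"
    using AE_lborel_singleton[of 0] AE_lborel_singleton[of a] AE_lborel_singleton[of "2 * pi"]
    by eventually_elim (use a p in \<open>auto simp: indicator_def algebra_simps\<close>)
  have s: "has_bochner_integral lborel (\<lambda>x. ?g1 (a + (-1) * x) + ?g2 ((a + 2 * pi) + (-1) * x)) (\<integral>t. f t \<partial>circ)"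
    unfolding I by (intro has_bochner_integral_add h1 h2)
  have fa: "(\<lambda>x. f (c + (-1) * x)) \<in> borel_measurable borel" for c
    by (rule measurable_compose[OF _ fb]) simp
  note fa' = fa[of a, simplified] fa[of "a + 2 * pi", simplified]
  have m: "(\<lambda>x. indicator {0..2*pi} x *\<^sub>R f (a - x)) \<in> borel_measurable lborel" using fa' by simp
  have m': "(\<lambda>x. ?g1 (a + (-1) * x) + ?g2 ((a + 2 * pi) + (-1) * x)) \<in> borel_measurable lborel"
    using fa' by simp
  have "has_bochner_integral lborel (\<lambda>x. indicator {0..2*pi} x *\<^sub>R f (a - x)) (\<integral>t. f t \<partial>circ)"
    using s has_bochner_integral_cong_AE[OF m' m ae] by blast
  then show "integrable circ (\<lambda>t. f (a - t))" "(\<integral>t. f (a - t) \<partial>circ) = (\<integral>t. f t \<partial>circ)"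
    by (auto simp: integrable_circ integral_circ set_integrable_def set_lebesgue_integral_def has_bochner_integral_iff)
qed

section \<open>Integrability of the singular weight\<close>

lemma sin_ge_quarter:
  assumes "0 \<le> x" "x \<le> pi / 2"
  shows "x / 4 \<le> sin x"
\<comment> \<open>Up to pi/3 the derivative cos is at least 1/2; beyond, sin x >= 1/2 while x / 4 <=
  1/2. Any positive slope would do.\<close>
proof (cases "x \<le> pi / 3")
  case True
  have "sin 0 - 0 / 4 \<le> sin x - x / 4"
  proof (rule DERIV_nonneg_imp_nondecreasing[OF assms(1)])
    fix y assume y: "0 \<le> y" "y \<le> x"
    have "cos y \<ge> cos (pi / 3)" using y True by (intro cos_monotone_0_pi_le) auto
    then have "cos y - 1 / 4 \<ge> 0" by (simp add: cos_60)
    moreover have "((\<lambda>y. sin y - y / 4) has_real_derivative (cos y - 1 / 4)) (at y)"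
      by (auto intro!: derivative_eq_intros)
    ultimately show "\<exists>z. ((\<lambda>y. sin y - y / 4) has_real_derivative z) (at y) \<and> 0 \<le> z" by blast
  qed
  then show ?thesis by simp
next
  case False
  have "sin (pi / 6) \<le> sin x" using False assms pi_gt_zero by (intro sin_monotone_2pi_le) auto
  then have "1 / 2 \<le> sin x" by (simp add: sin_30)
  moreover have "x / 4 \<le> 1 / 2" using assms pi_less_4 by simp
  ultimately show ?thesis by linarith
qed

lemma one_minus_cos: "1 - cos x = 2 * (sin (x / 2))\<^sup>2" for x :: real
  using cos_double_sin[of "x / 2"] by simp

lemma one_minus_cos_lower:
  assumes "0 \<le> x" "x \<le> pi"
  shows "x\<^sup>2 / 32 \<le> 1 - cos x"
proof -
  have "(x / 2 / 4)\<^sup>2 \<le> (sin (x / 2))\<^sup>2"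
    using sin_ge_quarter[of "x / 2"] assms by (intro power_mono) auto
  then show ?thesis by (simp add: one_minus_cos power2_eq_square)
qed

lemma integrable_circ_powr: "integrable circ (\<lambda>x. x powr (-1/2))"
proof -
  have "(\<lambda>x::real. x powr (-1/2)) integrable_on {0..2*pi}"
    by (rule integrable_on_powr_from_0) auto
  then have "(\<lambda>x::real. x powr (-1/2)) absolutely_integrable_on {0..2*pi}"
    by (intro nonnegative_absolutely_integrable_1) auto
  then show ?thesis unfolding integrable_circ set_integrable_def
    by (subst (asm) integrable_completion) auto
qed

lemma integrable_circ_powr_reflected: "integrable circ (\<lambda>x. (2 * pi - x) powr (-1/2))"
proof -
  have "integrable lborel (\<lambda>x. indicator {0..2*pi} x *\<^sub>R x powr (-1/2 :: real))"
    using integrable_circ_powr by (simp add: integrable_circ set_integrable_def)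
  from lborel_integrable_real_affine[OF this, of "-1" "2 * pi"]
  have "integrable lborel (\<lambda>x. indicator {0..2*pi} (2 * pi + - 1 * x) *\<^sub>R (2 * pi + - 1 * x) powr (- 1 / 2 :: real))" by simp
  also have "(\<lambda>x. indicator {0..2*pi} (2 * pi + - 1 * x) *\<^sub>R (2 * pi + - 1 * x) powr (- 1 / 2 :: real)) =
      (\<lambda>x. indicator {0..2*pi} x *\<^sub>R (2 * pi - x) powr (- 1 / 2))"
    by (auto simp: indicator_def fun_eq_iff)
  finally show ?thesis unfolding integrable_circ set_integrable_def .
qed

text \<open>1 - cos x vanishes quadratically at both ends of the interval, so its power -1/4 has two
  integrable singularities of order -1/2.\<close>

lemma one_minus_cos_powr_bound:
  assumes "0 < x" "x < 2 * pi"
  shows "(1 - cos x) powr (-1/4) \<le> 32 powr (1/4) * (x powr (-1/2) + (2 * pi - x) powr (-1/2))"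
proof -
  have main: "(1 - cos x) powr (-1/4) \<le> 32 powr (1/4) * x powr (-1/2)" if "0 < x" "x \<le> pi" for x
  proof -
    have "(1 - cos x) powr (-1/4) \<le> (x\<^sup>2 / 32) powr (-1/4)"
      using that one_minus_cos_lower[of x] by (intro powr_mono2') auto
    also have "\<dots> = 32 powr (1/4) * x powr (-1/2)"
      using that by (simp add: powr_divide powr_minus field_simps powr_powr powr_numeral[symmetric] del: powr_numeral)
    finally show ?thesis .
  qed
  show ?thesis
  proof (cases "x \<le> pi")
    case True
    have "(1 - cos x) powr (-1/4) \<le> 32 powr (1/4) * x powr (-1/2)" using main assms True by simp
    also have "\<dots> \<le> 32 powr (1/4) * (x powr (-1/2) + (2 * pi - x) powr (-1/2))" by (intro mult_left_mono) auto
    finally show ?thesis .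
  next
    case False
    have "(1 - cos (2 * pi - x)) powr (-1/4) \<le> 32 powr (1/4) * (2 * pi - x) powr (-1/2)" using main[of "2 * pi - x"] assms False by simp
    also have "\<dots> \<le> 32 powr (1/4) * (x powr (-1/2) + (2 * pi - x) powr (-1/2))" by (intro mult_left_mono) auto
    finally show ?thesis by (simp add: cos_diff)
  qed
qed

lemma integrable_one_minus_cos_powr: "integrable circ (\<lambda>x. (1 - cos x) powr (-1/4))"
proof (rule Bochner_Integration.integrable_bound)
  show "integrable circ (\<lambda>x. 32 powr (1/4) * (x powr (-1/2) + (2 * pi - x) powr (-1/2)) :: real)"
    by (intro integrable_mult_right Bochner_Integration.integrable_add integrable_circ_powr integrable_circ_powr_reflected)
  show "AE x in circ. norm ((1 - cos x) powr (-1/4)) \<le> norm (32 powr (1/4) * (x powr (-1/2) + (2 * pi - x) powr (-1/2)) :: real)"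
    using AE_circ_interior
  proof eventually_elim
    case (elim x)
    then show ?case using one_minus_cos_powr_bound[of x] by simp
  qed
qed measurable

section \<open>The kernels\<close>

lemma AE_circ2_interior: "AE z in circ \<Otimes>\<^sub>M circ. 0 < fst z \<and> fst z < 2 * pi \<and> 0 < snd z \<and> snd z < 2 * pi"
proof (rule circ2.AE_pair_measure)
  show "AE x in circ. AE y in circ. 0 < fst (x, y) \<and> fst (x, y) < 2 * pi \<and> 0 < snd (x, y) \<and> snd (x, y) < 2 * pi"
    using AE_circ_interior
  proof eventually_elim
    case (elim x)
    show ?case using AE_circ_interior by eventually_elim (use elim in auto)
  qed
qed measurable

lemma integrable_circ2_product:
  fixes u v :: "real \<Rightarrow> real"
  assumes u: "integrable circ u" and v: "integrable circ v"
  shows "integrable (circ \<Otimes>\<^sub>M circ) (\<lambda>z. u (fst z) * v (snd z))"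
proof (rule circ2.Fubini_integrable)
  have [measurable]: "u \<in> borel_measurable circ" "v \<in> borel_measurable circ" using u v by auto
  show "(\<lambda>z. u (fst z) * v (snd z)) \<in> borel_measurable (circ \<Otimes>\<^sub>M circ)" by measurable
  show "integrable circ (\<lambda>x. \<integral>y. norm (u (fst (x, y)) * v (snd (x, y))) \<partial>circ)"
    using u v by (simp add: abs_mult)
  show "AE x in circ. integrable circ (\<lambda>y. u (fst (x, y)) * v (snd (x, y)))"
    using v by simp
qed

lemma integral_circ2_product:
  fixes u v :: "real \<Rightarrow> real"
  assumes u: "integrable circ u" and v: "integrable circ v"
  shows "(\<integral>z. u (fst z) * v (snd z) \<partial>(circ \<Otimes>\<^sub>M circ)) = (\<integral>x. u x \<partial>circ) * (\<integral>x. v x \<partial>circ)"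
  using circ2.integral_fst'[OF integrable_circ2_product[OF u v]] by simp

lemma one_minus_cos_pos:
  assumes "0 < x" "x < 2 * pi"
  shows "1 - cos x > 0"
proof -
  have "sin (x / 2) > 0" by (rule sin_gt_zero) (use assms in auto)
  then show ?thesis by (simp add: one_minus_cos)
qed

lemma abs_sin_mult_le: "\<bar>sin (real n * x)\<bar> \<le> real n * \<bar>sin x\<bar>"
proof (induction n)
  case (Suc n)
  have "sin (real (Suc n) * x) = sin (real n * x) * cos x + cos (real n * x) * sin x"
    by (simp add: distrib_right sin_add add.commute)
  also have "\<bar>\<dots>\<bar> \<le> \<bar>sin (real n * x)\<bar> * \<bar>cos x\<bar> + \<bar>cos (real n * x)\<bar> * \<bar>sin x\<bar>"
    by (metis abs_mult abs_triangle_ineq)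
  also have "\<dots> \<le> \<bar>sin (real n * x)\<bar> * 1 + 1 * \<bar>sin x\<bar>"
    by (intro add_mono mult_mono) auto
  also have "\<dots> \<le> real n * \<bar>sin x\<bar> + \<bar>sin x\<bar>" using Suc by simp
  finally show ?case by (simp add: algebra_simps)
qed simp

text \<open>The half-angle form of |sin (n x)| <= n |sin x|. It says that cos (k p) differs from 1
  by at most a multiple of 1 - cos p, the quantity that \<open>X\<close> controls.\<close>

lemma one_minus_cos_int_mult_le: "1 - cos (of_int k * x) \<le> (of_int k)\<^sup>2 * (1 - cos x)" for x :: real
proof -
  have "\<bar>sin (of_int k * (x / 2))\<bar> = \<bar>sin (real (nat \<bar>k\<bar>) * (x / 2))\<bar>" by (cases "k \<ge> 0") auto
  also have "\<dots> \<le> real (nat \<bar>k\<bar>) * \<bar>sin (x / 2)\<bar>" by (rule abs_sin_mult_le)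
  finally have "\<bar>sin (of_int k * (x / 2))\<bar>\<^sup>2 \<le> (real (nat \<bar>k\<bar>) * \<bar>sin (x / 2)\<bar>)\<^sup>2"
    by (intro power_mono) auto
  then have "(sin (of_int k * x / 2))\<^sup>2 \<le> (of_int k)\<^sup>2 * (sin (x / 2))\<^sup>2"
    by (simp add: power_mult_distrib)
  then show ?thesis by (simp add: one_minus_cos)
qed

locale torus =
  fixes xi :: real and k :: int
  assumes xi: "0 < xi" "xi < 1"
begin

definition "b = 1 / xi\<^sup>2 - 1"
text \<open>The base mu(p) - cos e of the kernels as a sum of two nonnegative terms; it vanishes
  only where both \<open>p\<close> and \<open>e\<close> are multiples of 2 pi.\<close>

definition "X p e = b * (1 - cos p) + (1 - cos e)" for p e :: real

lemma b_pos: "b > 0"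
proof -
  have "xi\<^sup>2 < 1" using xi by (simp add: abs_square_less_1)
  then show ?thesis using xi by (simp add: b_def field_simps)
qed

lemma X_eq_mu: "mu xi p - cos e = X p e"
  by (simp add: mu_def X_def b_def left_diff_distrib right_diff_distrib)

lemma X_ge: "X p e \<ge> 1 - cos e" "X p e \<ge> b * (1 - cos p)" "X p e \<ge> 0"
  using b_pos by (auto simp: X_def)

lemma X_pos: "1 - cos e > 0 \<Longrightarrow> X p e > 0" "1 - cos p > 0 \<Longrightarrow> X p e > 0"
  using X_ge(1)[of e p] X_ge(2)[of p e] b_pos mult_pos_pos[of b "1 - cos p"] by linarith+

lemma X_measurable [measurable]: "(\<lambda>z. X (fst z) (snd z)) \<in> borel_measurable (circ \<Otimes>\<^sub>M circ)"
  "(\<lambda>z. X (snd z) (fst z)) \<in> borel_measurable (borel \<Otimes>\<^sub>M circ)"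
  "(\<lambda>p. X p e) \<in> borel_measurable circ" "(\<lambda>e. X p e) \<in> borel_measurable circ"
  unfolding X_def by measurable

text \<open>The inequality of arithmetic and geometric means separates the singularity of two
  variables into a product of two integrable powers of order -1/4.\<close>

lemma X_powr_le:
  assumes "1 - cos p > 0" "1 - cos e > 0"
  shows "X p e powr (-1/2) \<le> b powr (-1/4) * ((1 - cos p) powr (-1/4) * (1 - cos e) powr (-1/4))"
proof -
  let ?u = "1 - cos p" and ?v = "1 - cos e"
  have "(X p e)\<^sup>2 = (b * ?u - ?v)\<^sup>2 + 4 * (b * ?u * ?v)" by (simp add: X_def power2_eq_square algebra_simps)
  moreover have buv: "b * ?u * ?v > 0" using assms b_pos by simp
  ultimately have le: "b * ?u * ?v \<le> (X p e)\<^sup>2" by (smt (verit) zero_le_power2)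
  have "X p e powr (-1/2) = ((X p e)\<^sup>2) powr (-1/4)"
    using X_pos(2)[OF assms(1), of e] by (simp add: powr_powr powr_numeral[symmetric] del: powr_numeral)
  also have "\<dots> \<le> (b * ?u * ?v) powr (-1/4)" using le buv by (intro powr_mono2') auto
  also have "\<dots> = b powr (-1/4) * (?u powr (-1/4) * ?v powr (-1/4))"
    using assms b_pos by (simp add: powr_mult)
  finally show ?thesis .
qed

lemma X_integrable2: "integrable (circ \<Otimes>\<^sub>M circ) (\<lambda>z. X (fst z) (snd z) powr (-1/2))"
proof (rule Bochner_Integration.integrable_bound)
  show "integrable (circ \<Otimes>\<^sub>M circ) (\<lambda>z. b powr (-1/4) * ((1 - cos (fst z)) powr (-1/4) * (1 - cos (snd z)) powr (-1/4)))"
    by (intro integrable_mult_right integrable_circ2_product integrable_one_minus_cos_powr)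
  show "AE z in circ \<Otimes>\<^sub>M circ. norm (X (fst z) (snd z) powr (-1/2))
     \<le> norm (b powr (-1/4) * ((1 - cos (fst z)) powr (-1/4) * (1 - cos (snd z)) powr (-1/4)))"
    using AE_circ2_interior
    by eventually_elim (use X_powr_le one_minus_cos_pos in auto)
qed measurable

lemma integrable_circ2_by_X:
  fixes f :: "real \<times> real \<Rightarrow> real"
  assumes "f \<in> borel_measurable (circ \<Otimes>\<^sub>M circ)"
    and "\<And>p e. 0 < p \<Longrightarrow> p < 2 * pi \<Longrightarrow> 0 < e \<Longrightarrow> e < 2 * pi \<Longrightarrow> \<bar>f (p, e)\<bar> \<le> C * X p e powr (-1/2)"
  shows "integrable (circ \<Otimes>\<^sub>M circ) f"
proof (rule Bochner_Integration.integrable_bound)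
  show "integrable (circ \<Otimes>\<^sub>M circ) (\<lambda>z. C * X (fst z) (snd z) powr (-1/2))"
    by (intro integrable_mult_right X_integrable2)
  show "AE z in circ \<Otimes>\<^sub>M circ. norm (f z) \<le> norm (C * X (fst z) (snd z) powr (-1/2))"
    using AE_circ2_interior
  proof eventually_elim
    case (elim z)
    then have "\<bar>f (fst z, snd z)\<bar> \<le> C * X (fst z) (snd z) powr (-1/2)" by (intro assms) auto
    then show ?case by simp
  qed
qed fact

text \<open>The kernels \<open>sK\<close>, \<open>dK\<close> are those of the convolutions \<open>S\<close>, \<open>D\<close>;
  \<open>rK\<close> is the bounded kernel in \<open>(1 - xi\<^sup>2) D = S - R\<close>.\<close>

definition "sK e = (\<integral>p. cos (of_int k * p) * X p e powr (-1/2) \<partial>circ)" for e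
definition "tK e = (\<integral>p. cos (of_int k * p) * X p e powr (-3/2) \<partial>circ)" for e
definition "rK e = (1 - cos e) * tK e" for e
definition "dK e = 1 / xi\<^sup>2 * (\<integral>p. cos (of_int k * p) * ((1 - cos p) * X p e powr (-3/2)) \<partial>circ)" for e

lemma X_powr_bound:
  assumes "1 - cos e > 0" "a \<le> 0"
  shows "X p e powr a \<le> (1 - cos e) powr a"
  using assms X_ge[of e p] by (intro powr_mono2') auto

lemma X_powr_integrable:
  fixes F :: "real \<Rightarrow> real"
  assumes "1 - cos e > 0" "a \<le> 0" and [measurable]: "F \<in> borel_measurable borel" and F: "\<And>p. \<bar>F p\<bar> \<le> C"
  shows "integrable circ (\<lambda>p. F p * X p e powr a)"
proof (rule integrable_circ_bounded[where C = "C * (1 - cos e) powr a"])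
  show "norm (F p * X p e powr a) \<le> C * (1 - cos e) powr a" for p
    unfolding norm_mult using F[of p] X_powr_bound[OF assms(1,2), of p]
    by (intro mult_mono) auto
qed measurable

lemma XY_powr: assumes "X p e > 0" shows "X p e powr (-1/2) = X p e * X p e powr (-3/2)"
  using powr_mult_base[of "X p e" "-3/2"] assms by simp

text \<open>Write \<open>X\<close> to the power -1/2 as \<open>X\<close> times its power -3/2 and
  split the factor \<open>X\<close>: the summand 1 - cos e produces \<open>rK\<close>, the summand b
  * (1 - cos p) produces \<open>dK\<close>, up to the constant 1 / xi^2 = b / (1 - xi^2).\<close>

lemma dK_eq:
  assumes "1 - cos e > 0"
  shows "dK e = (sK e - rK e) / (1 - xi\<^sup>2)"
proof -
  have "xi\<^sup>2 < 1" using xi by (simp add: abs_square_less_1)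
  then have "b = (1 - xi\<^sup>2) * (1 / xi\<^sup>2)" using xi by (simp add: b_def diff_divide_distrib)
  then have c: "1 / xi\<^sup>2 = b / (1 - xi\<^sup>2)" using \<open>xi\<^sup>2 < 1\<close> by simp
  have rk: "rK e = (\<integral>p. cos (of_int k * p) * ((1 - cos e) * X p e powr (-3/2)) \<partial>circ)"
    unfolding rK_def tK_def by (subst integral_mult_right_zero[symmetric]) (simp add: mult_ac)
  have i1: "integrable circ (\<lambda>p. cos (of_int k * p) * X p e powr (-1/2))"
    by (rule X_powr_integrable[where C = 1]) (use assms in auto)
  have i2: "integrable circ (\<lambda>p. (cos (of_int k * p) * (1 - cos e)) * X p e powr (-3/2))"
  proof (rule X_powr_integrable[where C = "1 * \<bar>1 - cos e\<bar>"])
    show "\<bar>cos (of_int k * p) * (1 - cos e)\<bar> \<le> 1 * \<bar>1 - cos e\<bar>" for p :: real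
      unfolding abs_mult by (intro mult_right_mono) auto
  qed (use assms in auto)
  then have i2': "integrable circ (\<lambda>p. cos (of_int k * p) * ((1 - cos e) * X p e powr (-3/2)))"
    by (simp add: mult.assoc)
  have pw: "cos (of_int k * p) * X p e powr (-1/2) - cos (of_int k * p) * ((1 - cos e) * X p e powr (-3/2)) =
        b * (cos (of_int k * p) * ((1 - cos p) * X p e powr (-3/2)))" for p
  proof -
    define q where "q = X p e powr (-3/2)"
    have 1: "X p e powr (-1/2) = X p e * q"
      unfolding q_def by (rule XY_powr[OF X_pos(1)[OF assms]])
    have 2: "X p e * q = b * (1 - cos p) * q + (1 - cos e) * q"
      unfolding X_def by (rule distrib_right)
    show ?thesis
      unfolding 1 2 q_def[symmetric] by (simp add: algebra_simps)
  qed
  have "sK e - (\<integral>p. cos (of_int k * p) * ((1 - cos e) * X p e powr (-3/2)) \<partial>circ) =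
     (\<integral>p. cos (of_int k * p) * X p e powr (-1/2) - cos (of_int k * p) * ((1 - cos e) * X p e powr (-3/2)) \<partial>circ)"
    unfolding sK_def using i1 i2' by (rule Bochner_Integration.integral_diff[symmetric])
  also have "\<dots> = (\<integral>p. b * (cos (of_int k * p) * ((1 - cos p) * X p e powr (-3/2))) \<partial>circ)"
    unfolding pw ..
  finally have "sK e - rK e = b * (\<integral>p. (cos (of_int k * p) * ((1 - cos p) * X p e powr (-3/2))) \<partial>circ)"
    unfolding rk by (simp only: integral_mult_right_zero)
  then show ?thesis unfolding dK_def c by (simp only: times_divide_eq_left)
qed

lemma sK_borel [measurable]: "sK \<in> borel_measurable borel"
  and tK_borel [measurable]: "tK \<in> borel_measurable borel"
  and dK_borel [measurable]: "dK \<in> borel_measurable borel"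
proof -
  have m: "(\<lambda>e. \<integral>p. F p * X p e powr a \<partial>circ) \<in> borel_measurable borel"
    if [measurable]: "F \<in> borel_measurable borel" for F :: "real \<Rightarrow> real" and a
    by (rule circ.borel_measurable_lebesgue_integral) (unfold case_prod_beta, measurable)
  show "sK \<in> borel_measurable borel" "tK \<in> borel_measurable borel"
    unfolding sK_def[abs_def] tK_def[abs_def] by (rule m, simp)+
  have "(\<lambda>e. \<integral>p. (cos (of_int k * p) * (1 - cos p)) * X p e powr (-3/2) \<partial>circ) \<in> borel_measurable borel"
    by (rule m) simp
  then show "dK \<in> borel_measurable borel"
    unfolding dK_def[abs_def] by (simp add: mult.assoc)
qed

lemma rK_borel [measurable]: "rK \<in> borel_measurable borel"
  unfolding rK_def by measurable

lemma K_periodic: "sK (e + 2 * pi) = sK e" "dK (e + 2 * pi) = dK e"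
  by (simp_all add: sK_def dK_def X_def)

lemma K_even: "sK (- e) = sK e" "dK (- e) = dK e"
  by (simp_all add: sK_def dK_def X_def)

lemma sK_integrand2: "integrable (circ \<Otimes>\<^sub>M circ) (\<lambda>(p, e). cos (of_int k * p) * X p e powr (-1/2))"
proof (rule integrable_circ2_by_X[where C = 1])
  show "(\<lambda>(p, e). cos (of_int k * p) * X p e powr (-1/2)) \<in> borel_measurable (circ \<Otimes>\<^sub>M circ)"
    unfolding case_prod_beta by measurable
  show "\<bar>case (p, e) of (p, e) \<Rightarrow> cos (of_int k * p) * X p e powr (-1/2)\<bar> \<le> 1 * X p e powr (-1/2)" for p e
    unfolding prod.case abs_mult by (intro mult_mono) auto
qed

lemma sK_integrable: "integrable circ sK"
  using circ2.integrable_snd[OF sK_integrand2] by (simp add: sK_def[abs_def])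

text \<open>Replacing \<open>cos (k p)\<close> by \<open>\<bar>cos (p / 2)\<bar>\<close> makes the integral defining \<open>tK\<close> elementary,
  and the two weights differ by a multiple of \<open>1 - cos p\<close>, which removes the singularity of the difference.\<close>

lemma integral_abs_cos_half:
  assumes Y: "1 - cos e > 0"
  shows "(\<integral>p. \<bar>cos (p / 2)\<bar> * X p e powr (-3/2) \<partial>circ) = 4 / ((1 - cos e) * sqrt (2 * b + (1 - cos e)))"
proof -
  let ?Y = "1 - cos e"
  let ?R = "\<lambda>p. 2 * b * (sin (p / 2))\<^sup>2 + ?Y"
  have XR: "X p e = ?R p" for p by (simp add: X_def one_minus_cos[of p])
  have R: "?R p > 0" for p using Y b_pos by (simp add: add_nonneg_pos)
  \<comment> \<open>With u = sin (p / 2) the integrand becomes 2 * (2 b u^2 + Y) to the power -3/2,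
    whose primitive is 2 u / (Y sqrt (2 b u^2 + Y)).\<close>
  define F where "F p = 2 * sin (p / 2) / (?Y * sqrt (?R p))" for p
  have D: "(F has_real_derivative cos (p / 2) * X p e powr (-3/2)) (at p)" for p
  proof -
    have q: "X p e powr (-3/2) = 1 / (?R p * sqrt (?R p))"
      using R[of p] unfolding XR by (simp add: powr_minus_divide powr_half_sqrt[symmetric] powr_mult_base)
    have "(F has_real_derivative
        ((2 * (cos (p / 2) * (1 / 2))) * (?Y * sqrt (?R p)) - 2 * sin (p / 2) * (?Y * ((2 * b * (2 * sin (p / 2) * (cos (p / 2) * (1 / 2)))) / (2 * sqrt (?R p)))))
        / ((?Y * sqrt (?R p)) * (?Y * sqrt (?R p)))) (at p)"
      unfolding F_def
      by (rule derivative_eq_intros refl | use Y R[of p] in \<open>force simp: field_simps power2_eq_square\<close>)+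
    also have "((2 * (cos (p / 2) * (1 / 2))) * (?Y * sqrt (?R p)) - 2 * sin (p / 2) * (?Y * ((2 * b * (2 * sin (p / 2) * (cos (p / 2) * (1 / 2)))) / (2 * sqrt (?R p)))))
        / ((?Y * sqrt (?R p)) * (?Y * sqrt (?R p))) = cos (p / 2) * X p e powr (-3/2)"
    proof -
      define q where "q = sqrt (?R p)"
      have qq: "q * q = ?R p" "q > 0" using R[of p] by (auto simp: q_def)
      have "(2 * (cos (p / 2) * (1 / 2))) * (?Y * q) - 2 * sin (p / 2) * (?Y * ((2 * b * (2 * sin (p / 2) * (cos (p / 2) * (1 / 2)))) / (2 * q)))
          = cos (p / 2) * ?Y * (q * q - 2 * b * (sin (p / 2))\<^sup>2) / q"
        using qq(2) by (simp add: field_simps power2_eq_square)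
      also have "q * q - 2 * b * (sin (p / 2))\<^sup>2 = ?Y" using qq(1) by simp
      finally have n: "(2 * (cos (p / 2) * (1 / 2))) * (?Y * q) - 2 * sin (p / 2) * (?Y * ((2 * b * (2 * sin (p / 2) * (cos (p / 2) * (1 / 2)))) / (2 * q)))
         = cos (p / 2) * ?Y * ?Y / q" .
      have aux: "c * y * y / q / ((y * q) * (y * q)) = c * (1 / (q * q * q))" if "y > 0" for c y :: real
        using that qq(2) by (simp add: field_simps)
      show ?thesis unfolding q unfolding q_def[symmetric] unfolding n unfolding qq(1)[symmetric] by (rule aux[OF Y])
    qed
    finally show ?thesis .
  qed
  have ic: "isCont (\<lambda>p. cos (p / 2) * X p e powr (-3/2)) p" for p
    unfolding X_def using X_pos(1)[OF Y, of p] by (intro continuous_intros) (auto simp: X_def)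
  have F0: "F 0 = 0" "F (2 * pi) = 0" by (simp_all add: F_def)
  have Fpi: "F pi = 2 / (?Y * sqrt (2 * b + ?Y))" by (simp add: F_def)
  \<comment> \<open>cos (p / 2) changes sign at pi, so the two halves are integrated
    separately.\<close>
  have h1: "has_bochner_integral lborel (\<lambda>p. (cos (p / 2) * X p e powr (-3/2)) * indicator {0..pi} p) (F pi - F 0)"
    by (rule has_bochner_integral_FTC_Icc_real) (use D ic in auto)
  have h2: "has_bochner_integral lborel (\<lambda>p. (- (cos (p / 2) * X p e powr (-3/2))) * indicator {pi..2*pi} p) (- F (2 * pi) - (- F pi))"
    by (rule has_bochner_integral_FTC_Icc_real) (use D ic in \<open>auto intro!: derivative_eq_intros\<close>)
  have "has_bochner_integral lborel (\<lambda>p. indicator {0..2*pi} p *\<^sub>R (\<bar>cos (p / 2)\<bar> * X p e powr (-3/2))) (F pi - F 0 + (- F (2 * pi) - (- F pi)))"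
  proof (rule has_bochner_integralI_AE[OF has_bochner_integral_add[OF h1 h2]])
    show "AE p in lborel. cos (p / 2) * X p e powr (-3/2) * indicator {0..pi} p + - (cos (p / 2) * X p e powr (-3/2)) * indicator {pi..2*pi} p =
        indicator {0..2*pi} p *\<^sub>R (\<bar>cos (p / 2)\<bar> * X p e powr (-3/2))"
      using AE_lborel_singleton[of pi]
    proof eventually_elim
      case (elim p)
      consider "p < 0" | "0 \<le> p" "p < pi" | "pi < p" "p \<le> 2 * pi" | "p > 2 * pi" using elim by linarith
      then show ?case
      proof cases
        case 2
        then have "cos (p / 2) \<ge> 0" by (intro cos_ge_zero) auto
        then show ?thesis using 2 by (simp add: indicator_def)
      next
        case 3
        have "cos (p / 2) = - sin (p / 2 - pi / 2)" by (simp add: sin_diff)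
        moreover have "sin (p / 2 - pi / 2) \<ge> 0" using 3 by (intro sin_ge_zero) auto
        ultimately have "cos (p / 2) \<le> 0" by simp
        then show ?thesis using 3 by (simp add: indicator_def)
      qed (use pi_gt_zero in \<open>auto simp: indicator_def\<close>)
    qed
    show "(\<lambda>p. indicator {0..2*pi} p *\<^sub>R (\<bar>cos (p / 2)\<bar> * X p e powr (-3/2))) \<in> borel_measurable lborel"
    proof -
      note ident_measurable_circ [measurable del]
      show ?thesis unfolding X_def by measurable
    qed
  qed
  then show ?thesis
    unfolding integral_circ set_lebesgue_integral_def has_bochner_integral_iff F0 Fpi by simp
qed

text \<open>The limit of \<open>rK\<close> at 0; the value \<open>rK 0\<close> itself is 0 because
  of the factor 1 - cos e.\<close>

definition "r0 = 4 / sqrt (2 * b)"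

lemma r0_pos: "r0 > 0" using b_pos by (simp add: r0_def)

text \<open>The weights differ by at most (k^2 + 1) (1 - cos p), hence by (k^2 + 1) / b times
  \<open>X\<close>. This raises the exponent from -3/2 to -1/2, where the bound by 1 - cos e costs
  only its power -1/2, and the factor 1 - cos e of \<open>rK\<close> leaves a square root.\<close>

lemma rK_close:
  assumes Y: "1 - cos e > 0"
  shows "\<bar>rK e - 4 / sqrt (2 * b + (1 - cos e))\<bar> \<le> 2 * pi * ((of_int k)\<^sup>2 + 1) / b * sqrt (1 - cos e)"
proof -
  let ?Y = "1 - cos e"
  let ?h = "\<lambda>p. (cos (of_int k * p) - \<bar>cos (p / 2)\<bar>) * X p e powr (-3/2)"
  have i1: "integrable circ (\<lambda>p. cos (of_int k * p) * X p e powr (-3/2))"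
    by (rule X_powr_integrable[where C = 1]) (use Y in auto)
  have i2: "integrable circ (\<lambda>p. \<bar>cos (p / 2)\<bar> * X p e powr (-3/2))"
    by (rule X_powr_integrable[where C = 1]) (use Y in auto)
  have "tK e - (\<integral>p. \<bar>cos (p / 2)\<bar> * X p e powr (-3/2) \<partial>circ) = (\<integral>p. ?h p \<partial>circ)"
    unfolding tK_def by (subst Bochner_Integration.integral_diff[symmetric, OF i1 i2]) (simp add: left_diff_distrib)
  then have "?Y * (\<integral>p. ?h p \<partial>circ) = ?Y * (tK e - 4 / (?Y * sqrt (2 * b + ?Y)))"
    unfolding integral_abs_cos_half[OF Y] by simp
  also have "\<dots> = ?Y * tK e - ?Y * (4 / (?Y * sqrt (2 * b + ?Y)))" by (rule right_diff_distrib)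
  also have "?Y * (4 / (?Y * sqrt (2 * b + ?Y))) = 4 / sqrt (2 * b + ?Y)"
  proof -
    have "y * (4 / (y * s)) = 4 / s" if "y > 0" for y s :: real using that by simp
    from this[OF Y] show ?thesis .
  qed
  finally have e1: "rK e - 4 / sqrt (2 * b + ?Y) = ?Y * (\<integral>p. ?h p \<partial>circ)"
    by (simp add: rK_def)
  have hb: "norm (?h p) \<le> ((of_int k)\<^sup>2 + 1) / b * ?Y powr (-1/2)" for p
  proof -
    have "\<bar>cos (p / 2)\<bar>\<^sup>2 \<le> \<bar>cos (p / 2)\<bar>" by (simp add: power2_eq_square mult_left_le del: abs_mult_self_eq)
    then have "1 - \<bar>cos (p / 2)\<bar> \<le> (sin (p / 2))\<^sup>2" by (simp add: sin_squared_eq)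
    also have "\<dots> \<le> 1 - cos p" by (simp add: one_minus_cos[of p])
    finally have c1: "1 - \<bar>cos (p / 2)\<bar> \<le> 1 - cos p" .
    have c2: "\<bar>cos (p / 2)\<bar> \<le> 1" "cos (of_int k * p) \<le> 1" by auto
    have c3: "(of_int k)\<^sup>2 * (1 - cos p) \<ge> 0" by simp
    have "\<bar>cos (of_int k * p) - \<bar>cos (p / 2)\<bar>\<bar> \<le> (of_int k)\<^sup>2 * (1 - cos p) + (1 - cos p)"
      using c1 c2 c3 one_minus_cos_int_mult_le[of k p] by linarith
    also have "\<dots> = ((of_int k)\<^sup>2 + 1) / b * (b * (1 - cos p))" using b_pos by (simp add: field_simps)
    also have "\<dots> \<le> ((of_int k)\<^sup>2 + 1) / b * X p e"
      using b_pos X_ge(2)[of p e] by (intro mult_left_mono) auto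
    finally have "norm (?h p) \<le> ((of_int k)\<^sup>2 + 1) / b * X p e * X p e powr (-3/2)"
      unfolding norm_mult by (intro mult_mono) auto
    also have "\<dots> = ((of_int k)\<^sup>2 + 1) / b * X p e powr (-1/2)"
      unfolding XY_powr[OF X_pos(1)[OF Y]] by (simp only: mult.assoc)
    also have "\<dots> \<le> ((of_int k)\<^sup>2 + 1) / b * ?Y powr (-1/2)"
      using b_pos X_powr_bound[OF Y, of "-1/2" p] by (intro mult_left_mono) auto
    finally show ?thesis .
  qed
  have "norm (\<integral>p. ?h p \<partial>circ) \<le> (\<integral>p. norm (?h p) \<partial>circ)" by (rule integral_norm_bound)
  also have "\<dots> \<le> (\<integral>p. ((of_int k)\<^sup>2 + 1) / b * ?Y powr (-1/2) \<partial>circ)"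
    by (intro integral_mono' circ.integrable_const hb order_trans[OF norm_ge_zero hb])
  also have "\<dots> = 2 * pi * (((of_int k)\<^sup>2 + 1) / b * ?Y powr (-1/2))" by (simp add: measure_circ)
  finally have "\<bar>?Y * (\<integral>p. ?h p \<partial>circ)\<bar> \<le> ?Y * (2 * pi * (((of_int k)\<^sup>2 + 1) / b * ?Y powr (-1/2)))"
    using Y unfolding abs_mult by (intro mult_mono) auto
  also have "\<dots> = 2 * pi * ((of_int k)\<^sup>2 + 1) / b * (?Y * ?Y powr (-1/2))" by simp
  also have "?Y * ?Y powr (-1/2) = sqrt ?Y"
    using Y powr_mult_base[of ?Y "-1/2"] by (simp add: powr_half_sqrt)
  finally show ?thesis unfolding e1 .
qed

text \<open>Near 0 the square root of 1 - cos e is comparable to |e|. This first-order bound is what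
  the singular factor cos (e / 2) / sin (e / 2) in \<open>n_sl_eq\<close> consumes. Besides
  \<open>rK_close\<close>, subadditivity of the square root enters.\<close>

lemma rK_Lipschitz:
  "\<exists>C. \<forall>e. 1 - cos e > 0 \<longrightarrow> \<bar>rK e - r0\<bar> \<le> C * sqrt (1 - cos e)"
proof (intro exI allI impI)
  fix e :: real assume Y: "1 - cos e > 0"
  let ?Y = "1 - cos e"
  let ?u = "sqrt (2 * b)" and ?v = "sqrt (2 * b + ?Y)"
  have uv: "0 < ?u" "?u \<le> ?v" using b_pos Y by auto
  have "?v \<le> ?u + sqrt ?Y" using b_pos Y by (intro sqrt_add_le_add_sqrt) auto
  then have "\<bar>4 / ?v - r0\<bar> \<le> 4 / (?u * ?u) * sqrt ?Y"
  proof -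
    have "\<bar>4 / ?v - r0\<bar> = 4 * (?v - ?u) / (?u * ?v)"
    proof -
      have "4 / ?v - r0 = - (4 * (?v - ?u) / (?u * ?v))"
      proof -
        have "4 / v - 4 / u = - (4 * (v - u) / (u * v))" if "u > 0" "v > 0" for u v :: real
          using that by (simp add: field_simps)
        from this[OF uv(1) less_le_trans[OF uv]] show ?thesis unfolding r0_def .
      qed
      then show ?thesis using uv by simp
    qed
    also have "\<dots> \<le> 4 * sqrt ?Y / (?u * ?u)"
      using uv \<open>?v \<le> ?u + sqrt ?Y\<close> by (intro frac_le mult_left_mono) auto
    finally show ?thesis by simp
  qed
  then show "\<bar>rK e - r0\<bar> \<le> (2 * pi * ((of_int k)\<^sup>2 + 1) / b + 4 / (?u * ?u)) * sqrt ?Y"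
    using rK_close[OF Y] by (simp only: distrib_right)
qed

end

section \<open>Fourier coefficients of the kernels and the limit of
  \<open>real n * sl (int n)\<close>\<close>

context torus begin

text \<open>Cosine coefficients without the factor 1/(2 pi): these are the eigenvalues of the
  convolution on exponentials.\<close>

definition "sl l = (\<integral>e. sK e * cos (of_int l * e) \<partial>circ)" for l :: int
definition "rl l = (\<integral>e. rK e * cos (of_int l * e) \<partial>circ)" for l :: int

lemma sl_even: "sl (- l) = sl l" by (simp add: sl_def)

lemma rK_bounded: "\<exists>C. \<forall>e. \<bar>rK e\<bar> \<le> C"
proof -
  obtain C where C: "\<And>e. 1 - cos e > 0 \<Longrightarrow> \<bar>rK e - r0\<bar> \<le> C * sqrt (1 - cos e)"
    using rK_Lipschitz by blast
  show ?thesis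
  proof (intro exI[of _ "\<bar>C\<bar> * sqrt 2 + r0"] allI)
    fix e :: real
    show "\<bar>rK e\<bar> \<le> \<bar>C\<bar> * sqrt 2 + r0"
    proof (cases "1 - cos e > 0")
      case True
      have "C * sqrt (1 - cos e) \<le> \<bar>C\<bar> * sqrt 2"
        using True cos_ge_minus_one[of e] by (intro mult_mono real_sqrt_le_mono) auto
      then show ?thesis using C[OF True] r0_pos by linarith
    next
      case False
      then have "1 - cos e = 0" using cos_le_one[of e] by linarith
      then show ?thesis using r0_pos by (simp add: rK_def)
    qed
  qed
qed

lemma rl_square_summable: "(\<lambda>l. (rl l)\<^sup>2) summable_on UNIV"
proof -
  obtain C where C: "\<And>e. \<bar>rK e\<bar> \<le> C" using rK_bounded by blast
  have m: "(\<lambda>e. complex_of_real (rK e)) \<in> borel_measurable circ"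
    by (rule borel_measurable_circ) measurable
  have "(\<lambda>l. (norm (\<integral>t. complex_of_real (rK t) * fexp (- l) t \<partial>circ))\<^sup>2) summable_on UNIV"
    by (rule Bessel_circ[OF m, of C]) (use C in auto)
  then show ?thesis
  proof (rule summable_on_comparison_test)
    fix l :: int
    have i: "integrable circ (\<lambda>t. complex_of_real (rK t) * fexp (- l) t)"
    proof (rule integrable_circ_bounded[where C = C])
      show "(\<lambda>t. complex_of_real (rK t) * fexp (- l) t) \<in> borel_measurable circ"
        by (rule borel_measurable_circ) measurable
    qed (use C in \<open>auto simp: norm_mult\<close>)
    have "rl l = Re (\<integral>t. complex_of_real (rK t) * fexp (- l) t \<partial>circ)"
      by (subst integral_Re[OF i, symmetric]) (simp add: rl_def fexp_def)
    then have "\<bar>rl l\<bar> \<le> norm (\<integral>t. complex_of_real (rK t) * fexp (- l) t \<partial>circ)"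
      using abs_Re_le_cmod by simp
    then show "(rl l)\<^sup>2 \<le> (norm (\<integral>t. complex_of_real (rK t) * fexp (- l) t \<partial>circ))\<^sup>2"
      using power_mono[of "\<bar>rl l\<bar>" _ 2] by simp
  qed auto
qed

text \<open>For fixed \<open>p\<close> off the singularity the integrand is smooth in
  \<open>e\<close>, and sin (n e) kills the boundary terms at 0 and 2 pi.\<close>

lemma by_parts_circle:
  assumes p: "1 - cos p > 0"
  shows "real n * (\<integral>e. cos (real n * e) * X p e powr (-1/2) \<partial>circ) =
    (\<integral>e. sin (real n * e) * sin e * X p e powr (-3/2) \<partial>circ) / 2"
proof -
  have Xp: "X p e > 0" for e using X_pos(2)[OF p] .
  have cont: "continuous_on UNIV (\<lambda>e. X p e powr a)" for a
    unfolding X_def using Xp by (intro continuous_intros) (auto simp: X_def less_imp_neq[symmetric])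
  let ?f = "\<lambda>e. real n * (cos (real n * e) * X p e powr (-1/2))" and ?g = "\<lambda>e. sin (real n * e) * sin e * X p e powr (-3/2) / 2"
  have D: "((\<lambda>e. sin (real n * e) * X p e powr (-1/2)) has_real_derivative (?f e - ?g e)) (at e)" for e
  proof -
    have "((\<lambda>e. X p e powr (-1/2)) has_real_derivative ((-1/2) * X p e powr (-1/2 - 1) * sin e)) (at e)"
      by (rule DERIV_fun_powr[of "\<lambda>e. X p e" "sin e" e "-1/2", simplified of_nat_1])
         (use Xp[of e] in \<open>auto simp: X_def intro!: derivative_eq_intros\<close>)
    then have dX: "((\<lambda>e. X p e powr (-1/2)) has_real_derivative ((-1/2) * X p e powr (-3/2) * sin e)) (at e)"
      by simp
    have ds: "((\<lambda>e. sin (real n * e)) has_real_derivative cos (real n * e) * real n) (at e)"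
      by (auto intro!: derivative_eq_intros)
    from DERIV_mult[OF ds dX] show ?thesis by (rule DERIV_cong) (simp add: algebra_simps)
  qed
  have cf: "continuous_on UNIV (\<lambda>e. ?f e - ?g e)"
    by (intro continuous_intros cont) auto
  have "(\<integral>e. ?f e - ?g e \<partial>circ) = sin (real n * (2 * pi)) * X p (2 * pi) powr (-1/2) - sin (real n * 0) * X p 0 powr (-1/2)"
    by (rule integral_circ_FTC) (use D cf continuous_on_eq_continuous_at[OF open_UNIV] in blast)+
  also have "sin (real n * (2 * pi)) = 0" using sin_int_2pin[of "int n"] by (simp add: mult.commute)
  finally have "(\<integral>e. ?f e - ?g e \<partial>circ) = 0" by simp
  moreover have "integrable circ ?f" "integrable circ ?g"
    by (intro integrable_circ_continuous continuous_intros cont; simp)+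
  ultimately have "(\<integral>e. ?f e \<partial>circ) = (\<integral>e. ?g e \<partial>circ)" by simp
  then show ?thesis by simp
qed

text \<open>Exchange the integrals, integrate by parts in \<open>e\<close>, and exchange back. Since
  sin e = cos (e / 2) / sin (e / 2) * (1 - cos e), the sine from differentiation supplies the factor
  that turns the singular \<open>tK\<close> into the bounded \<open>rK\<close>.\<close>

lemma n_sl_eq:
  "real n * sl (int n) = (\<integral>e. sin (real n * e) * (cos (e / 2) / sin (e / 2)) * rK e \<partial>circ) / 2"
proof -
  let ?F = "\<lambda>p e. cos (of_int k * p) * (cos (real n * e) * X p e powr (-1/2))"
  let ?G = "\<lambda>p e. cos (of_int k * p) * (sin (real n * e) * sin e * X p e powr (-3/2))"
  have iF: "integrable (circ \<Otimes>\<^sub>M circ) (case_prod ?F)"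
  proof (rule integrable_circ2_by_X[where C = 1])
    show "case_prod ?F \<in> borel_measurable (circ \<Otimes>\<^sub>M circ)" unfolding case_prod_beta by measurable
    show "\<bar>case_prod ?F (p, e)\<bar> \<le> 1 * X p e powr (-1/2)" for p e
    proof -
      have "\<bar>cos (of_int k * p)\<bar> * (\<bar>cos (real n * e)\<bar> * \<bar>X p e powr (-1/2)\<bar>) \<le> 1 * (1 * \<bar>X p e powr (-1/2)\<bar>)"
        by (intro mult_mono) auto
      then show ?thesis by (simp add: abs_mult)
    qed
  qed
  have iG: "integrable (circ \<Otimes>\<^sub>M circ) (case_prod ?G)"
  proof (rule integrable_circ2_by_X[where C = "2 * real n"])
    show "case_prod ?G \<in> borel_measurable (circ \<Otimes>\<^sub>M circ)" unfolding case_prod_beta by measurable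
    show "\<bar>case_prod ?G (p, e)\<bar> \<le> 2 * real n * X p e powr (-1/2)" if "0 < e" "e < 2 * pi" for p e
    proof -
      have Y: "1 - cos e > 0" using one_minus_cos_pos that by simp
      have "(sin e)\<^sup>2 = (1 - cos e) * (1 + cos e)" by (simp add: sin_squared_eq power2_eq_square algebra_simps)
      also have "\<dots> \<le> (1 - cos e) * 2" using Y by (intro mult_left_mono) auto
      finally have s2: "(sin e)\<^sup>2 \<le> 2 * (1 - cos e)" by simp
      \<comment> \<open>Both sines vanish with 1 - cos e; their product is bounded by a multiple of
        \<open>X\<close>, which raises the exponent from -3/2 to the integrable -1/2.\<close>
      have "\<bar>sin (real n * e)\<bar> * \<bar>sin e\<bar> \<le> real n * \<bar>sin e\<bar> * \<bar>sin e\<bar>"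
        by (intro mult_right_mono abs_sin_mult_le) auto
      also have "\<dots> = real n * (sin e)\<^sup>2" by (simp add: power2_eq_square)
      also have "\<dots> \<le> real n * (2 * X p e)" using s2 X_ge(1)[of e p] by (intro mult_left_mono) auto
      finally have "\<bar>cos (of_int k * p)\<bar> * (\<bar>sin (real n * e)\<bar> * \<bar>sin e\<bar> * X p e powr (-3/2))
          \<le> 1 * (real n * (2 * X p e) * X p e powr (-3/2))"
        by (intro mult_mono[of _ 1] mult_right_mono) auto
      also have "\<dots> = 2 * real n * X p e powr (-1/2)" unfolding XY_powr[OF X_pos(1)[OF Y]] by simp
      finally show ?thesis by (simp add: abs_mult)
    qed
  qed
  have "sl (int n) = (\<integral>e. (\<integral>p. ?F p e \<partial>circ) \<partial>circ)"
    unfolding sl_def sK_def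
    by (subst integral_mult_left_zero[symmetric]) (simp add: mult_ac)
  also have "\<dots> = (\<integral>p. (\<integral>e. ?F p e \<partial>circ) \<partial>circ)" by (rule circ2.Fubini_integral[OF iF])
  finally have "real n * sl (int n) = (\<integral>p. real n * (\<integral>e. ?F p e \<partial>circ) \<partial>circ)" by simp
  also have "\<dots> = (\<integral>p. (\<integral>e. ?G p e \<partial>circ) / 2 \<partial>circ)"
  proof (rule integral_cong_AE)
    show "AE p in circ. real n * (\<integral>e. ?F p e \<partial>circ) = (\<integral>e. ?G p e \<partial>circ) / 2"
      using AE_circ_interior
    proof eventually_elim
      case (elim p)
      then have "1 - cos p > 0" using one_minus_cos_pos by simp
      from by_parts_circle[OF this, of n] show ?case by simp
    qed
    have "integrable circ (\<lambda>p. \<integral>e. ?F p e \<partial>circ)" using circ2.integrable_fst[OF iF] .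
    then show "(\<lambda>p. real n * (\<integral>e. ?F p e \<partial>circ)) \<in> borel_measurable circ"
      by (intro borel_measurable_integrable integrable_mult_right)
    have "integrable circ (\<lambda>p. \<integral>e. ?G p e \<partial>circ)" using circ2.integrable_fst[OF iG] .
    then show "(\<lambda>p. (\<integral>e. ?G p e \<partial>circ) / 2) \<in> borel_measurable circ"
      by (intro borel_measurable_integrable integrable_divide_zero)
  qed
  also have "\<dots> = (\<integral>p. (\<integral>e. ?G p e \<partial>circ) \<partial>circ) / 2" by simp
  also have "(\<integral>p. (\<integral>e. ?G p e \<partial>circ) \<partial>circ) = (\<integral>e. (\<integral>p. ?G p e \<partial>circ) \<partial>circ)"
    by (rule circ2.Fubini_integral[OF iG, symmetric])
  also have "\<dots> = (\<integral>e. sin (real n * e) * (cos (e / 2) / sin (e / 2)) * rK e \<partial>circ)"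
  proof (rule integral_cong_AE)
    show "AE e in circ. (\<integral>p. ?G p e \<partial>circ) = sin (real n * e) * (cos (e / 2) / sin (e / 2)) * rK e"
      using AE_circ_interior
    proof eventually_elim
      case (elim e)
      have s: "sin (e / 2) > 0" by (rule sin_gt_zero) (use elim in auto)
      have "sin e = cos (e / 2) / sin (e / 2) * (1 - cos e)"
        using s sin_double[of "e / 2"] by (simp add: one_minus_cos power2_eq_square)
      then have "sin (real n * e) * sin e * tK e = sin (real n * e) * (cos (e / 2) / sin (e / 2)) * rK e"
        unfolding rK_def by (simp only: mult.assoc)
      moreover have "(\<integral>p. ?G p e \<partial>circ) = sin (real n * e) * sin e * tK e"
        unfolding tK_def by (subst integral_mult_right_zero[symmetric]) (simp add: mult_ac)
      ultimately show ?case by (simp only:)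
    qed
    have "integrable circ (\<lambda>e. \<integral>p. ?G p e \<partial>circ)" using circ2.integrable_snd[OF iG] .
    then show "(\<lambda>e. \<integral>p. ?G p e \<partial>circ) \<in> borel_measurable circ" by (rule borel_measurable_integrable)
    show "(\<lambda>e. sin (real n * e) * (cos (e / 2) / sin (e / 2)) * rK e) \<in> borel_measurable circ"
      by (rule borel_measurable_circ) (use ident_measurable_circ[measurable del] in measurable)
  qed
  finally show ?thesis .
qed

text \<open>Apply \<open>abs_sin_mult_le\<close> to 2 n times the angle e / 2. Where sin (e / 2) =
  0, the quotient is 0 by convention.\<close>

lemma half_cot_bound: "\<bar>sin (real n * e) * (cos (e / 2) / sin (e / 2))\<bar> \<le> 2 * real n"
proof (cases "sin (e / 2) = 0")
  case False
  have "\<bar>sin (real (2 * n) * (e / 2))\<bar> \<le> real (2 * n) * \<bar>sin (e / 2)\<bar>" by (rule abs_sin_mult_le)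
  then have "\<bar>sin (real n * e)\<bar> * \<bar>cos (e / 2)\<bar> \<le> (2 * real n * \<bar>sin (e / 2)\<bar>) * 1"
    by (intro mult_mono) auto
  then show ?thesis using False by (simp add: abs_mult field_simps)
qed auto

text \<open>sin (n e) cos (e / 2) / sin (e / 2) is the modified Dirichlet kernel 1 + 2 cos e + ... +
  2 cos ((n - 1) e) + cos (n e); this is its increment.\<close>

lemma half_cot_step:
  assumes "sin (e / 2) \<noteq> 0"
  shows "sin (real (Suc n) * e) * (cos (e / 2) / sin (e / 2)) - sin (real n * e) * (cos (e / 2) / sin (e / 2))
     = cos (real (Suc n) * e) + cos (real n * e)"
proof -
  have "sin (real (Suc n) * e) - sin (real n * e) = 2 * sin (e / 2) * cos (real n * e + e / 2)"
    using sin_diff_sin[of "real (Suc n) * e" "real n * e"] by (simp add: field_simps)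
  moreover have "cos (real (Suc n) * e) + cos (real n * e) = 2 * cos (real n * e + e / 2) * cos (e / 2)"
    using cos_plus_cos[of "real (Suc n) * e" "real n * e"] by (simp add: field_simps)
  ultimately show ?thesis
    unfolding left_diff_distrib[symmetric] using assms by (simp only: mult_ac) simp
qed

lemma half_cot_measurable:
  assumes "h \<in> borel_measurable borel"
  shows "(\<lambda>e. sin (real n * e) * (cos (e / 2) / sin (e / 2)) * h e) \<in> borel_measurable circ"
  by (rule borel_measurable_circ) (use assms ident_measurable_circ[measurable del] in measurable)

lemma half_cot_integrable:
  assumes "h \<in> borel_measurable borel" "\<And>e. \<bar>h e\<bar> \<le> C"
  shows "integrable circ (\<lambda>e. sin (real n * e) * (cos (e / 2) / sin (e / 2)) * h e)"
proof (rule integrable_circ_bounded[where C = "2 * real n * C"])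
  show "norm (sin (real n * e) * (cos (e / 2) / sin (e / 2)) * h e) \<le> 2 * real n * C" for e
    unfolding norm_mult[of _ "h e"] using assms(2)[of e] half_cot_bound[of n e]
    by (intro mult_mono) auto
qed (rule half_cot_measurable[OF assms(1)])

lemma half_cot_integral_step:
  assumes h: "h \<in> borel_measurable borel" "\<And>e. \<bar>h e\<bar> \<le> C"
  shows "(\<integral>e. sin (real (Suc n) * e) * (cos (e / 2) / sin (e / 2)) * h e \<partial>circ)
     - (\<integral>e. sin (real n * e) * (cos (e / 2) / sin (e / 2)) * h e \<partial>circ)
     = (\<integral>e. h e * cos (of_int (int (Suc n)) * e) \<partial>circ) + (\<integral>e. h e * cos (of_int (int n) * e) \<partial>circ)"
proof -
  have i: "integrable circ (\<lambda>e. h e * cos (of_int l * e))" for l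
  proof (rule integrable_circ_bounded[where C = "C * 1"])
    show "(\<lambda>e. h e * cos (of_int l * e)) \<in> borel_measurable circ"
      by (rule borel_measurable_circ) (use h in measurable)
    show "norm (h e * cos (of_int l * e)) \<le> C * 1" for e
      unfolding norm_mult using h(2)[of e] by (intro mult_mono) auto
  qed
  note j = half_cot_integrable[OF h]
  have "(\<integral>e. sin (real (Suc n) * e) * (cos (e / 2) / sin (e / 2)) * h e \<partial>circ)
     - (\<integral>e. sin (real n * e) * (cos (e / 2) / sin (e / 2)) * h e \<partial>circ) =
     (\<integral>e. sin (real (Suc n) * e) * (cos (e / 2) / sin (e / 2)) * h e - sin (real n * e) * (cos (e / 2) / sin (e / 2)) * h e \<partial>circ)"
    by (rule Bochner_Integration.integral_diff[OF j j, symmetric])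
  also have "\<dots> = (\<integral>e. h e * cos (of_int (int (Suc n)) * e) + h e * cos (of_int (int n) * e) \<partial>circ)"
  proof (rule integral_cong_AE)
    show "AE e in circ. sin (real (Suc n) * e) * (cos (e / 2) / sin (e / 2)) * h e - sin (real n * e) * (cos (e / 2) / sin (e / 2)) * h e
        = h e * cos (of_int (int (Suc n)) * e) + h e * cos (of_int (int n) * e)"
      using AE_circ_interior
    proof eventually_elim
      case (elim e)
      have s: "sin (e / 2) \<noteq> 0" using sin_gt_zero[of "e / 2"] elim by force
      have "sin (real (Suc n) * e) * (cos (e / 2) / sin (e / 2)) * h e - sin (real n * e) * (cos (e / 2) / sin (e / 2)) * h e
          = (sin (real (Suc n) * e) * (cos (e / 2) / sin (e / 2)) - sin (real n * e) * (cos (e / 2) / sin (e / 2))) * h e"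
        by (rule left_diff_distrib[symmetric])
      then show ?case unfolding half_cot_step[OF s] by (simp only: distrib_right distrib_left mult.commute of_int_of_nat_eq)
    qed
  qed (intro borel_measurable_integrable Bochner_Integration.integrable_diff Bochner_Integration.integrable_add i j)+
  also have "\<dots> = (\<integral>e. h e * cos (of_int (int (Suc n)) * e) \<partial>circ) + (\<integral>e. h e * cos (of_int (int n) * e) \<partial>circ)"
    by (rule Bochner_Integration.integral_add[OF i i])
  finally show ?thesis .
qed

lemma n_sl_step: "real (Suc n) * sl (int (Suc n)) - real n * sl (int n) = (rl (int n) + rl (int (Suc n))) / 2"
proof -
  obtain C where C: "\<And>e. \<bar>rK e\<bar> \<le> C" using rK_bounded by blast
  show ?thesis unfolding n_sl_eq rl_def
    using half_cot_integral_step[OF rK_borel C, of n] by argo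
qed

lemma half_cot_integral: "n > 0 \<Longrightarrow> (\<integral>e. sin (real n * e) * (cos (e / 2) / sin (e / 2)) \<partial>circ) = 2 * pi"
proof (induction n rule: nat_induct_non_zero)
  case 1
  show ?case
    using half_cot_integral_step[of "\<lambda>_. 1" 1 0] integral_circ_cos[of 1] integral_circ_cos[of 0] by simp
next
  case (Suc n)
  show ?case
    using half_cot_integral_step[of "\<lambda>_. 1" 1 n] integral_circ_cos[of "int n"] integral_circ_cos[of "int (Suc n)"] Suc
    by simp
qed

text \<open>Split \<open>rK\<close> into r0 and rK - r0. The constant part integrates exactly to pi
  * r0, because the modified Dirichlet kernel has integral 2 pi. In the rest, \<open>q\<close> is
  bounded by \<open>rK_Lipschitz\<close>, so its Fourier coefficients tend to 0 by Bessel.\<close>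

lemma n_sl_tendsto: "(\<lambda>n. real n * sl (int n)) \<longlonglongrightarrow> pi * r0"
proof -
  obtain C where C: "\<And>e. 1 - cos e > 0 \<Longrightarrow> \<bar>rK e - r0\<bar> \<le> C * sqrt (1 - cos e)"
    using rK_Lipschitz by blast
  obtain C' where C': "\<And>e. \<bar>rK e\<bar> \<le> C'" using rK_bounded by blast
  define q where "q e = (cos (e / 2) / sin (e / 2)) * (rK e - r0)" for e
  have qb: "\<bar>q e\<bar> \<le> \<bar>C\<bar> * sqrt 2" for e
  proof (cases "sin (e / 2) = 0")
    case False
    then have Y: "1 - cos e > 0" by (simp add: one_minus_cos)
    have "sqrt (1 - cos e) = sqrt 2 * \<bar>sin (e / 2)\<bar>" by (simp add: one_minus_cos real_sqrt_mult)
    then have "\<bar>rK e - r0\<bar> \<le> \<bar>C\<bar> * (sqrt 2 * \<bar>sin (e / 2)\<bar>)"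
      using C[OF Y] by (smt (verit) abs_ge_self mult_right_mono real_sqrt_ge_zero Y)
    then have "\<bar>cos (e / 2)\<bar> * \<bar>rK e - r0\<bar> \<le> 1 * (\<bar>C\<bar> * (sqrt 2 * \<bar>sin (e / 2)\<bar>))"
      by (intro mult_mono) auto
    then show ?thesis using False
      unfolding q_def abs_mult abs_divide by (simp add: pos_divide_le_eq mult.assoc)
  qed (simp add: q_def)
  have qm: "q \<in> borel_measurable borel"
    unfolding q_def using ident_measurable_circ[measurable del] by measurable
  have "(\<lambda>l. (norm (\<integral>t. complex_of_real (q t) * fexp (- l) t \<partial>circ))\<^sup>2) summable_on UNIV"
    by (rule Bessel_circ[of _ "\<bar>C\<bar> * sqrt 2"], rule borel_measurable_circ) (use qb qm in \<open>auto\<close>)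
  then have "(\<lambda>l. (norm (\<integral>t. complex_of_real (q t) * fexp (- l) t \<partial>circ))\<^sup>2) summable_on range int"
    by (rule summable_on_subset) auto
  then have "(\<lambda>n. (norm (\<integral>t. complex_of_real (q t) * fexp (- int n) t \<partial>circ))\<^sup>2) summable_on UNIV"
    by (subst (asm) summable_on_reindex) (auto simp: o_def)
  then have "summable (\<lambda>n. (norm (\<integral>t. complex_of_real (q t) * fexp (- int n) t \<partial>circ))\<^sup>2)"
    by (rule summable_on_imp_summable)
  then have "(\<lambda>n. (norm (\<integral>t. complex_of_real (q t) * fexp (- int n) t \<partial>circ))\<^sup>2) \<longlonglongrightarrow> 0"
    by (rule summable_LIMSEQ_zero)
  then have "(\<lambda>n. sqrt ((norm (\<integral>t. complex_of_real (q t) * fexp (- int n) t \<partial>circ))\<^sup>2)) \<longlonglongrightarrow> sqrt 0"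
    by (rule tendsto_real_sqrt)
  then have lim: "(\<lambda>n. norm (\<integral>t. complex_of_real (q t) * fexp (- int n) t \<partial>circ)) \<longlonglongrightarrow> 0" by simp
  have iq: "integrable circ (\<lambda>t. complex_of_real (q t) * fexp (- l) t)" for l
  proof (rule integrable_circ_bounded[where C = "\<bar>C\<bar> * sqrt 2"])
    show "(\<lambda>t. complex_of_real (q t) * fexp (- l) t) \<in> borel_measurable circ"
      by (rule borel_measurable_circ) (use qm in measurable)
  qed (use qb in \<open>auto simp: norm_mult\<close>)
  have bnd: "norm (\<integral>e. sin (real n * e) * q e \<partial>circ) \<le> norm (\<integral>t. complex_of_real (q t) * fexp (- int n) t \<partial>circ)" for n
  proof -
    have "(\<integral>e. - (sin (real n * e) * q e) \<partial>circ) = Im (\<integral>t. complex_of_real (q t) * fexp (- int n) t \<partial>circ)"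
      by (subst integral_Im[OF iq, symmetric]) (simp add: fexp_def mult.commute)
    then have "(\<integral>e. sin (real n * e) * q e \<partial>circ) = - Im (\<integral>t. complex_of_real (q t) * fexp (- int n) t \<partial>circ)"
      by simp
    then show ?thesis using abs_Im_le_cmod by simp
  qed
  have l0: "(\<lambda>n. \<integral>e. sin (real n * e) * q e \<partial>circ) \<longlonglongrightarrow> 0"
    by (rule Lim_null_comparison[OF always_eventually lim]) (use bnd in blast)
  have eq: "real n * sl (int n) = pi * r0 + (\<integral>e. sin (real n * e) * q e \<partial>circ) / 2" if "n > 0" for n
  proof -
    let ?c = "\<lambda>e. sin (real n * e) * (cos (e / 2) / sin (e / 2))"
    have i1: "integrable circ (\<lambda>e. ?c e * rK e)" by (rule half_cot_integrable[OF rK_borel C'])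
    have i2: "integrable circ (\<lambda>e. ?c e * r0)" by (rule half_cot_integrable[of _ "\<bar>r0\<bar>"]) auto
    have "(\<integral>e. sin (real n * e) * q e \<partial>circ) = (\<integral>e. ?c e * rK e - ?c e * r0 \<partial>circ)"
      by (simp add: q_def right_diff_distrib mult.assoc)
    also have "\<dots> = (\<integral>e. ?c e * rK e \<partial>circ) - (\<integral>e. ?c e * r0 \<partial>circ)"
      by (rule Bochner_Integration.integral_diff[OF i1 i2])
    also have "(\<integral>e. ?c e * r0 \<partial>circ) = 2 * pi * r0"
      unfolding integral_mult_left_zero half_cot_integral[OF that] ..
    finally show ?thesis unfolding n_sl_eq by argo
  qed
  have "(\<lambda>n. pi * r0 + (\<integral>e. sin (real n * e) * q e \<partial>circ) / 2) \<longlonglongrightarrow> pi * r0 + 0 / 2"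
    by (intro tendsto_intros l0) auto
  then show ?thesis
    by (rule Lim_transform_eventually[THEN back_subst[of "\<lambda>x. _ \<longlonglongrightarrow> x"]])
       (auto simp: eq eventually_sequentially intro!: exI[of _ 1])
qed

end

section \<open>Positivity of the symbol\<close>

definition cos_moment :: "int \<Rightarrow> nat \<Rightarrow> real" where
  "cos_moment l m = (\<integral>t. cos (of_int l * t) * cos t ^ m \<partial>circ)"

lemma cos_moment_integrable: "integrable circ (\<lambda>t. cos (of_int l * t) * cos t ^ m)"
  by (intro integrable_circ_continuous continuous_intros)

lemma cos_moment_Suc: "cos_moment l (Suc m) = (cos_moment (l + 1) m + cos_moment (l - 1) m) / 2"
proof -
  have "cos (of_int l * t) * cos t ^ Suc m =
     (cos (of_int (l + 1) * t) * cos t ^ m + cos (of_int (l - 1) * t) * cos t ^ m) / 2" for t :: real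
  proof -
    have "cos (of_int l * t) * cos t = (cos (of_int (l + 1) * t) + cos (of_int (l - 1) * t)) / 2"
      using cos_times_cos[of "of_int l * t" t] by (simp add: algebra_simps)
    then have "cos (of_int l * t) * cos t * cos t ^ m = (cos (of_int (l + 1) * t) + cos (of_int (l - 1) * t)) / 2 * cos t ^ m"
      by simp
    then show ?thesis by (simp add: algebra_simps)
  qed
  then have "cos_moment l (Suc m) =
      (\<integral>t. (cos (of_int (l + 1) * t) * cos t ^ m + cos (of_int (l - 1) * t) * cos t ^ m) / 2 \<partial>circ)"
    unfolding cos_moment_def by (simp only:)
  also have "\<dots> = (cos_moment (l + 1) m + cos_moment (l - 1) m) / 2"
    unfolding integral_divide_zero cos_moment_def
    by (simp only: Bochner_Integration.integral_add[OF cos_moment_integrable cos_moment_integrable])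
  finally show ?thesis .
qed

lemma cos_moment_nonneg: "cos_moment l m \<ge> 0"
proof (induction m arbitrary: l)
  case 0 show ?case using integral_circ_cos[of l] by (simp add: cos_moment_def)
next
  case (Suc m) show ?case using Suc[of "l + 1"] Suc[of "l - 1"] by (simp add: cos_moment_Suc)
qed

text \<open>By \<open>cos_moment_Suc\<close> each further cosine averages over the two neighbours of
  \<open>l\<close>. The mass at 0 reaches \<open>l\<close> after |l| steps, and nonnegativity rules
  out cancellation.\<close>

lemma cos_moment_pos: "cos_moment l (nat \<bar>l\<bar>) > 0"
proof (induction "nat \<bar>l\<bar>" arbitrary: l)
  case 0
  then show ?case using integral_circ_cos[of 0] by (simp add: cos_moment_def)
next
  case (Suc m)
  show ?case
  proof (cases "l > 0")
    case True
    then have "m = nat \<bar>l - 1\<bar>" using Suc(2) by auto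
    then have "cos_moment (l - 1) m > 0" using Suc(1)[of "l - 1"] by simp
    then show ?thesis using cos_moment_nonneg[of "l + 1" m]
      unfolding Suc(2)[symmetric] cos_moment_Suc by simp
  next
    case False
    then have "m = nat \<bar>l + 1\<bar>" using Suc(2) by auto
    then have "cos_moment (l + 1) m > 0" using Suc(1)[of "l + 1"] by simp
    then show ?thesis using cos_moment_nonneg[of "l - 1" m]
      unfolding Suc(2)[symmetric] cos_moment_Suc by simp
  qed
qed

text \<open>Negating the upper index gives the Pochhammer quotient (1/2)_n / n!, a product of
  positive factors.\<close>

lemma neg_half_gchoose_pos: "(-1) ^ n * ((-1/2 :: real) gchoose n) > 0"
proof -
  have "(-1) ^ n * ((- (1/2) :: real) gchoose n) = (1/2 + of_nat n - 1) gchoose n"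
    unfolding gbinomial_minus by (simp add: mult.assoc[symmetric] power_mult_distrib[symmetric])
  also have "\<dots> = pochhammer (1/2) n / fact n"
    by (simp add: gbinomial_pochhammer')
  also have "\<dots> > 0" by (simp add: pochhammer_pos)
  finally show ?thesis by simp
qed

context torus begin

text \<open>\<open>X\<close> equals b + 1 - W. As \<open>W\<close> reaches b + 1, its binomial
  series is used with a larger constant c first, and c decreases to b + 1 in
  \<open>sl_pos\<close>.\<close>

abbreviation "W z \<equiv> b * cos (fst z) + cos (snd z)"

lemma W_bound: "\<bar>W z\<bar> \<le> b + 1"
proof -
  have "\<bar>b * cos (fst z)\<bar> \<le> b * 1" using b_pos unfolding abs_mult by (intro mult_mono) auto
  then show ?thesis using abs_cos_le_one[of "snd z"] by linarith
qed

lemma trig_W_moment: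
  "integrable (circ \<Otimes>\<^sub>M circ) (\<lambda>z. cos (of_int k * fst z) * cos (of_int l * snd z) * W z ^ n)"
  "(\<integral>z. cos (of_int k * fst z) * cos (of_int l * snd z) * W z ^ n \<partial>(circ \<Otimes>\<^sub>M circ)) =
    (\<Sum>m\<le>n. (of_nat (n choose m) * b ^ m) * (cos_moment k m * cos_moment l (n - m)))"
proof -
  have e: "cos (of_int k * fst z) * cos (of_int l * snd z) * W z ^ n =
    (\<Sum>m\<le>n. (of_nat (n choose m) * b ^ m) * ((cos (of_int k * fst z) * cos (fst z) ^ m) * (cos (of_int l * snd z) * cos (snd z) ^ (n - m))))" for z
    unfolding binomial_ring by (simp add: sum_distrib_left power_mult_distrib mult_ac)
  have i: "integrable (circ \<Otimes>\<^sub>M circ) (\<lambda>z. (cos (of_int k * fst z) * cos (fst z) ^ m) * (cos (of_int l * snd z) * cos (snd z) ^ j))" for m j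
    by (rule integrable_circ2_product[OF cos_moment_integrable cos_moment_integrable])
  show "integrable (circ \<Otimes>\<^sub>M circ) (\<lambda>z. cos (of_int k * fst z) * cos (of_int l * snd z) * W z ^ n)"
    unfolding e by (intro Bochner_Integration.integrable_sum integrable_mult_right i)
  show "(\<integral>z. cos (of_int k * fst z) * cos (of_int l * snd z) * W z ^ n \<partial>(circ \<Otimes>\<^sub>M circ)) =
    (\<Sum>m\<le>n. (of_nat (n choose m) * b ^ m) * (cos_moment k m * cos_moment l (n - m)))"
    unfolding e cos_moment_def
    by (subst Bochner_Integration.integral_sum)
       (auto intro!: integrable_mult_right i simp: integral_circ2_product[OF cos_moment_integrable cos_moment_integrable])
qed

lemma trig_W_moment_nonneg:
  "(\<integral>z. cos (of_int k * fst z) * cos (of_int l * snd z) * W z ^ n \<partial>(circ \<Otimes>\<^sub>M circ)) \<ge> 0"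
  unfolding trig_W_moment using b_pos
  by (intro sum_nonneg mult_nonneg_nonneg cos_moment_nonneg) auto

text \<open>The power |k| + |l| contains the binomial term with |k| cosines of the first variable
  and |l| of the second, where both moments are positive.\<close>

lemma trig_W_moment_pos:
  "(\<integral>z. cos (of_int k * fst z) * cos (of_int l * snd z) * W z ^ (nat \<bar>k\<bar> + nat \<bar>l\<bar>) \<partial>(circ \<Otimes>\<^sub>M circ)) > 0"
  unfolding trig_W_moment
proof (rule sum_pos2[of _ "nat \<bar>k\<bar>"])
  show "of_nat ((nat \<bar>k\<bar> + nat \<bar>l\<bar>) choose nat \<bar>k\<bar>) * b ^ nat \<bar>k\<bar> *
      (cos_moment k (nat \<bar>k\<bar>) * cos_moment l (nat \<bar>k\<bar> + nat \<bar>l\<bar> - nat \<bar>k\<bar>)) > 0"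
    using b_pos by (intro mult_pos_pos) (auto simp: cos_moment_pos)
qed (use b_pos in \<open>auto intro!: mult_nonneg_nonneg cos_moment_nonneg\<close>)

text \<open>The expansion of \<open>(c - W) powr (-1/2)\<close> in powers of \<open>W\<close> has positive coefficients.\<close>

lemma shifted_kernel_moment_ge:
  assumes c: "c > b + 1"
  shows "(\<integral>z. cos (of_int k * fst z) * cos (of_int l * snd z) * (c - W z) powr (-1/2) \<partial>(circ \<Otimes>\<^sub>M circ)) \<ge>
    ((-1) ^ n * ((-1/2) gchoose n)) * c powr (-1/2 - real n) *
    (\<integral>z. cos (of_int k * fst z) * cos (of_int l * snd z) * W z ^ n \<partial>(circ \<Otimes>\<^sub>M circ))"
proof -
  let ?t = "\<lambda>z. cos (of_int k * fst z) * cos (of_int l * snd z)"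
  define al where "al n = ((-1) ^ n * ((-1/2) gchoose n)) * c powr (-1/2 - real n)" for n
  have c0: "c > 0" using c b_pos by linarith
  have al: "al n > 0" for n unfolding al_def using neg_half_gchoose_pos[of n] c0 by simp
  have ser: "(\<lambda>n. al n * w ^ n) sums (c - w) powr (-1/2)" if "\<bar>w\<bar> < c" for w
  proof -
    have "(\<lambda>n. ((-1/2) gchoose n) * c powr (-1/2 - real n) * (- w) ^ n) sums (c + - w) powr (-1/2)"
      by (rule gen_binomial_real'') (use that in simp)
    moreover have "((-1/2) gchoose n) * c powr (-1/2 - real n) * (- w) ^ n = al n * w ^ n" for n
      by (simp add: al_def power_minus[of w])
    ultimately show ?thesis by simp
  qed
  have t1: "\<bar>?t z\<bar> \<le> 1" for z :: "real \<times> real"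
  proof -
    have "\<bar>cos (of_int k * fst z)\<bar> * \<bar>cos (of_int l * snd z)\<bar> \<le> 1 * 1" by (intro mult_mono) auto
    then show ?thesis by (simp add: abs_mult)
  qed
  let ?f = "\<lambda>n z. al n * (?t z * W z ^ n)"
  have i: "integrable (circ \<Otimes>\<^sub>M circ) (?f n)" for n
    by (intro integrable_mult_right trig_W_moment)
  have nb: "norm (?f n z) \<le> al n * (b + 1) ^ n" for n z
  proof -
    have "\<bar>al n\<bar> * (\<bar>?t z\<bar> * \<bar>W z\<bar> ^ n) \<le> al n * (1 * (b + 1) ^ n)"
      using al[of n] b_pos W_bound[of z] t1[of z] by (intro mult_mono power_mono) auto
    then show ?thesis by (simp add: abs_mult power_abs)
  qed
  \<comment> \<open>The series at b + 1 < c has positive terms and dominates all others, since |W|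
    <= b + 1.\<close>
  have sb: "summable (\<lambda>n. al n * (b + 1) ^ n)"
    using ser[of "b + 1"] b_pos c by (auto simp: sums_iff)
  have s1: "AE z in circ \<Otimes>\<^sub>M circ. summable (\<lambda>n. norm (?f n z))"
    by (intro AE_I2 summable_comparison_test'[OF sb, of 0]) (use nb in auto)
  have s2: "summable (\<lambda>n. \<integral>z. norm (?f n z) \<partial>(circ \<Otimes>\<^sub>M circ))"
  proof (rule summable_comparison_test'[of "\<lambda>n. measure (circ \<Otimes>\<^sub>M circ) (space (circ \<Otimes>\<^sub>M circ)) * (al n * (b + 1) ^ n)" 0])
    show "summable (\<lambda>n. measure (circ \<Otimes>\<^sub>M circ) (space (circ \<Otimes>\<^sub>M circ)) * (al n * (b + 1) ^ n))"
      by (rule summable_mult[OF sb])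
    fix n
    have "(\<integral>z. norm (?f n z) \<partial>(circ \<Otimes>\<^sub>M circ)) \<le> (\<integral>z. al n * (b + 1) ^ n \<partial>(circ \<Otimes>\<^sub>M circ))"
      by (intro integral_mono integrable_norm i circ2.integrable_const nb)
    then show "norm (\<integral>z. norm (?f n z) \<partial>(circ \<Otimes>\<^sub>M circ)) \<le> measure (circ \<Otimes>\<^sub>M circ) (space (circ \<Otimes>\<^sub>M circ)) * (al n * (b + 1) ^ n)"
      by simp
  qed
  have "(\<lambda>n. \<integral>z. ?f n z \<partial>(circ \<Otimes>\<^sub>M circ)) sums (\<integral>z. (\<Sum>n. ?f n z) \<partial>(circ \<Otimes>\<^sub>M circ))"
    by (rule sums_integral[OF i s1 s2])
  moreover have "(\<Sum>n. ?f n z) = ?t z * (c - W z) powr (-1/2)" for z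
  proof -
    have "\<bar>W z\<bar> < c" using W_bound[of z] c by linarith
    from sums_mult[OF ser[OF this], of "?t z"] show ?thesis by (simp add: sums_iff mult_ac)
  qed
  ultimately have S: "(\<lambda>n. al n * (\<integral>z. ?t z * W z ^ n \<partial>(circ \<Otimes>\<^sub>M circ))) sums
      (\<integral>z. ?t z * (c - W z) powr (-1/2) \<partial>(circ \<Otimes>\<^sub>M circ))" by simp
  have nn: "al n * (\<integral>z. ?t z * W z ^ n \<partial>(circ \<Otimes>\<^sub>M circ)) \<ge> 0" for n
    using al[of n] trig_W_moment_nonneg by simp
  \<comment> \<open>All terms are nonnegative, so any single one bounds the sum from below.\<close>
  have "(\<Sum>n\<in>{n}. al n * (\<integral>z. ?t z * W z ^ n \<partial>(circ \<Otimes>\<^sub>M circ))) \<le> (\<Sum>n. al n * (\<integral>z. ?t z * W z ^ n \<partial>(circ \<Otimes>\<^sub>M circ)))"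
    by (rule sum_le_suminf) (use S nn in \<open>auto simp: sums_iff\<close>)
  then show ?thesis using S by (simp add: sums_iff al_def)
qed

lemma sl_eq_double:
  "sl l = (\<integral>z. cos (of_int k * fst z) * cos (of_int l * snd z) * X (fst z) (snd z) powr (-1/2) \<partial>(circ \<Otimes>\<^sub>M circ))"
proof -
  let ?F = "\<lambda>p e. cos (of_int k * p) * cos (of_int l * e) * X p e powr (-1/2)"
  have iF: "integrable (circ \<Otimes>\<^sub>M circ) (case_prod ?F)"
  proof (rule integrable_circ2_by_X[where C = 1])
    show "case_prod ?F \<in> borel_measurable (circ \<Otimes>\<^sub>M circ)" unfolding case_prod_beta by measurable
    show "\<bar>case_prod ?F (p, e)\<bar> \<le> 1 * X p e powr (-1/2)" for p e
    proof -
      have "\<bar>cos (of_int k * p)\<bar> * \<bar>cos (of_int l * e)\<bar> * \<bar>X p e powr (-1/2)\<bar> \<le> 1 * 1 * \<bar>X p e powr (-1/2)\<bar>"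
        by (intro mult_mono) auto
      then show ?thesis by (simp add: abs_mult)
    qed
  qed
  have "sl l = (\<integral>e. (\<integral>p. ?F p e \<partial>circ) \<partial>circ)"
    unfolding sl_def sK_def
    by (subst integral_mult_left_zero[symmetric]) (simp add: mult_ac)
  also have "\<dots> = integral\<^sup>L (circ \<Otimes>\<^sub>M circ) (case_prod ?F)" by (rule circ2.integral_snd[OF iF])
  finally show "sl l = (\<integral>z. cos (of_int k * fst z) * cos (of_int l * snd z) * X (fst z) (snd z) powr (-1/2) \<partial>(circ \<Otimes>\<^sub>M circ))"
    by (simp add: case_prod_beta')
qed

text \<open>Let c decrease to b + 1 by dominated convergence. A mere limit of positive numbers could
  vanish, so one positive term of the series is kept with a bound independent of c.\<close>

lemma sl_pos: "sl l > 0"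
proof -
  let ?t = "\<lambda>z::real\<times>real. cos (of_int k * fst z) * cos (of_int l * snd z)"
  let ?c = "\<lambda>j. b + 1 + 1 / real (Suc j)"
  define n where "n = nat \<bar>k\<bar> + nat \<bar>l\<bar>"
  define m where "m = (\<integral>z. ?t z * W z ^ n \<partial>(circ \<Otimes>\<^sub>M circ))"
  define al where "al = (-1) ^ n * ((-1/2 :: real) gchoose n)"
  have m: "m > 0" unfolding m_def n_def by (rule trig_W_moment_pos)
  have al: "al > 0" unfolding al_def by (rule neg_half_gchoose_pos)
  have X: "?c j - W z = X (fst z) (snd z) + 1 / real (Suc j)" for j z
    by (simp add: X_def algebra_simps)
  have lim: "(\<lambda>j. \<integral>z. ?t z * (?c j - W z) powr (-1/2) \<partial>(circ \<Otimes>\<^sub>M circ)) \<longlonglongrightarrow>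
      (\<integral>z. ?t z * X (fst z) (snd z) powr (-1/2) \<partial>(circ \<Otimes>\<^sub>M circ))"
  proof (rule integral_dominated_convergence[where w = "\<lambda>z. X (fst z) (snd z) powr (-1/2)"])
    show "integrable (circ \<Otimes>\<^sub>M circ) (\<lambda>z. X (fst z) (snd z) powr (-1/2))" by (rule X_integrable2)
    show "AE z in circ \<Otimes>\<^sub>M circ. (\<lambda>j. ?t z * (?c j - W z) powr (-1/2)) \<longlonglongrightarrow> ?t z * X (fst z) (snd z) powr (-1/2)"
      using AE_circ2_interior
    proof eventually_elim
      case (elim z)
      then have Xp: "X (fst z) (snd z) > 0" using X_pos(2) one_minus_cos_pos by auto
      have "(\<lambda>j. X (fst z) (snd z) + 1 / real (Suc j)) \<longlonglongrightarrow> X (fst z) (snd z) + 0"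
        by (intro tendsto_intros LIMSEQ_Suc lim_1_over_n)
      then show ?case unfolding X using Xp by (intro tendsto_intros) auto
    qed
    show "AE z in circ \<Otimes>\<^sub>M circ. norm (?t z * (?c j - W z) powr (-1/2)) \<le> X (fst z) (snd z) powr (-1/2)" for j
      using AE_circ2_interior
    proof eventually_elim
      case (elim z)
      then have Xp: "X (fst z) (snd z) > 0" using X_pos(2) one_minus_cos_pos by auto
      have "\<bar>cos (of_int k * fst z)\<bar> * \<bar>cos (of_int l * snd z)\<bar> * \<bar>(?c j - W z) powr (-1/2)\<bar> \<le> 1 * 1 * X (fst z) (snd z) powr (-1/2)"
        unfolding X using Xp by (intro mult_mono) (auto intro!: powr_mono2')
      then show ?case by (simp add: abs_mult)
    qed
  qed measurable
  have "al * (b + 2) powr (-1/2 - real n) * m \<le> (\<integral>z. ?t z * (?c j - W z) powr (-1/2) \<partial>(circ \<Otimes>\<^sub>M circ))" for j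
  proof -
    \<comment> \<open>The exponent is negative and c <= b + 2, so c = b + 2 gives a bound uniform in
      \<open>j\<close>.\<close>
    have "(b + 2) powr (-1/2 - real n) \<le> ?c j powr (-1/2 - real n)"
    proof (rule powr_mono2')
      have "0 < 1 / real (Suc j)" "1 / real (Suc j) \<le> 1" by auto
      then show "0 < ?c j" "?c j \<le> b + 2" using b_pos by linarith+
    qed auto
    then have "al * (b + 2) powr (-1/2 - real n) * m \<le> al * ?c j powr (-1/2 - real n) * m"
      using al m by (intro mult_right_mono mult_left_mono) auto
    also have "\<dots> \<le> (\<integral>z. ?t z * (?c j - W z) powr (-1/2) \<partial>(circ \<Otimes>\<^sub>M circ))"
      unfolding al_def m_def by (rule shifted_kernel_moment_ge) simp
    finally show ?thesis .
  qed
  then have "al * (b + 2) powr (-1/2 - real n) * m \<le> sl l"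
    unfolding sl_eq_double by (intro LIMSEQ_le_const[OF lim]) auto
  moreover have "al * (b + 2) powr (-1/2 - real n) * m > 0" using al m b_pos by simp
  ultimately show ?thesis by linarith
qed

end

section \<open>Eigenfunctions\<close>

definition trig_series :: "(int \<Rightarrow> real) \<Rightarrow> real \<Rightarrow> complex" where
  "trig_series c t = (\<Sum>\<^sub>\<infinity>l. of_real (c l) * fexp l t)"

context
  fixes c :: "int \<Rightarrow> real"
  assumes c: "(\<lambda>l. \<bar>c l\<bar>) summable_on UNIV"
begin

lemma trig_series_has_sum: "((\<lambda>l. of_real (c l) * fexp l t) has_sum trig_series c t) UNIV"
proof -
  have "(\<lambda>l. norm (of_real (c l) * fexp l t)) summable_on UNIV" using c by (simp add: norm_mult)
  then show ?thesis unfolding trig_series_def by (intro has_sum_infsum) (rule abs_summable_summable)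
qed

lemma trig_series_uniform_limit:
  "uniform_limit UNIV (\<lambda>F t. \<Sum>l\<in>F. of_real (c l) * fexp l t) (trig_series c) (finite_subsets_at_top UNIV)"
  unfolding trig_series_def[abs_def]
  by (rule Weierstrass_m_test_general[OF _ c]) (simp add: norm_mult)

lemma trig_series_continuous: "continuous_on UNIV (trig_series c)"
  by (rule uniform_limit_theorem[OF _ trig_series_uniform_limit])
     (auto intro!: always_eventually continuous_intros)

lemma trig_series_borel: "trig_series c \<in> borel_measurable borel"
  by (rule borel_measurable_continuous_onI[OF trig_series_continuous])

lemma trig_series_bound: "norm (trig_series c t) \<le> (\<Sum>\<^sub>\<infinity>l. \<bar>c l\<bar>)"
  by (rule norm_infsum_le[OF trig_series_has_sum has_sum_infsum[OF c]]) (simp add: norm_mult)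

lemma integrable_mult_trig_series:
  fixes K :: "real \<Rightarrow> complex"
  assumes K: "integrable circ K"
  shows "integrable circ (\<lambda>t. K t * trig_series c t)"
proof (rule Bochner_Integration.integrable_bound)
  have [measurable]: "K \<in> borel_measurable circ" using K by auto
  have [measurable]: "trig_series c \<in> borel_measurable circ"
    by (rule borel_measurable_circ[OF trig_series_borel])
  show "(\<lambda>t. K t * trig_series c t) \<in> borel_measurable circ" by measurable
  show "integrable circ (\<lambda>t. (\<Sum>\<^sub>\<infinity>l. \<bar>c l\<bar>) * norm (K t))" using K by (intro integrable_mult_right integrable_norm)
  show "AE t in circ. norm (K t * trig_series c t) \<le> norm ((\<Sum>\<^sub>\<infinity>l. \<bar>c l\<bar>) * norm (K t))"
  proof (intro AE_I2)
    fix t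
    have "norm (K t) * norm (trig_series c t) \<le> norm (K t) * (\<Sum>\<^sub>\<infinity>l. \<bar>c l\<bar>)"
      by (intro mult_left_mono trig_series_bound) auto
    also have "\<dots> \<le> norm ((\<Sum>\<^sub>\<infinity>l. \<bar>c l\<bar>) * norm (K t))" by (simp add: abs_mult mult.commute mult_left_mono)
    finally show "norm (K t * trig_series c t) \<le> norm ((\<Sum>\<^sub>\<infinity>l. \<bar>c l\<bar>) * norm (K t))"
      by (simp add: norm_mult)
  qed
qed

text \<open>The series converges uniformly, so it may be integrated termwise against any integrable
  kernel; no boundedness of \<open>K\<close> enters, which matters for the singular kernels.\<close>

lemma has_sum_integral_trig_series:
  fixes K :: "real \<Rightarrow> complex"
  assumes K: "integrable circ K"
  shows "((\<lambda>l. of_real (c l) * (\<integral>t. K t * fexp l t \<partial>circ)) has_sum (\<integral>t. K t * trig_series c t \<partial>circ)) UNIV"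
  unfolding has_sum_def
proof (rule tendstoI)
  fix \<epsilon> :: real assume \<epsilon>: "\<epsilon> > 0"
  \<comment> \<open>The uniform error is taken as epsilon / (N + 1), since N may be 0.\<close>
  define N where "N = (\<integral>t. norm (K t) \<partial>circ)"
  have N: "N \<ge> 0" by (simp add: N_def)
  have iK: "integrable circ (\<lambda>t. K t * fexp l t)" for l
  proof (rule Bochner_Integration.integrable_bound[OF K])
    have [measurable]: "K \<in> borel_measurable circ" using K by auto
    show "(\<lambda>t. K t * fexp l t) \<in> borel_measurable circ" by measurable
  qed (simp add: norm_mult)
  have "\<forall>\<^sub>F F in finite_subsets_at_top UNIV. \<forall>t\<in>UNIV. dist (\<Sum>l\<in>F. of_real (c l) * fexp l t) (trig_series c t) < \<epsilon> / (N + 1)"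
    using trig_series_uniform_limit \<epsilon> N by (intro uniform_limitD) auto
  then show "\<forall>\<^sub>F F in finite_subsets_at_top UNIV.
      dist (\<Sum>l\<in>F. of_real (c l) * (\<integral>t. K t * fexp l t \<partial>circ)) (\<integral>t. K t * trig_series c t \<partial>circ) < \<epsilon>"
  proof eventually_elim
    case (elim F)
    let ?gF = "\<lambda>t. \<Sum>l\<in>F. of_real (c l) * fexp l t"
    have e: "K t * ?gF t = (\<Sum>l\<in>F. of_real (c l) * (K t * fexp l t))" for t
      by (simp add: sum_distrib_left mult_ac)
    have iF: "integrable circ (\<lambda>t. K t * ?gF t)"
      unfolding e by (intro Bochner_Integration.integrable_sum integrable_mult_right iK)
    have vF: "(\<integral>t. K t * ?gF t \<partial>circ) = (\<Sum>l\<in>F. of_real (c l) * (\<integral>t. K t * fexp l t \<partial>circ))"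
      unfolding e by (subst Bochner_Integration.integral_sum) (auto intro!: integrable_mult_right iK)
    note ig = integrable_mult_trig_series[OF K]
    have "dist (\<Sum>l\<in>F. of_real (c l) * (\<integral>t. K t * fexp l t \<partial>circ)) (\<integral>t. K t * trig_series c t \<partial>circ) =
        norm (\<integral>t. K t * ?gF t - K t * trig_series c t \<partial>circ)"
      unfolding vF[symmetric] dist_norm Bochner_Integration.integral_diff[OF iF ig] ..
    also have "\<dots> \<le> (\<integral>t. norm (K t * ?gF t - K t * trig_series c t) \<partial>circ)" by (rule integral_norm_bound)
    also have "\<dots> \<le> (\<integral>t. \<epsilon> / (N + 1) * norm (K t) \<partial>circ)"
    proof (intro integral_mono integrable_norm Bochner_Integration.integrable_diff iF ig integrable_mult_right K)
      fix t
      have "norm (K t * ?gF t - K t * trig_series c t) = norm (K t) * dist (?gF t) (trig_series c t)"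
        by (simp add: dist_norm norm_mult[symmetric] right_diff_distrib)
      also have "\<dots> \<le> norm (K t) * (\<epsilon> / (N + 1))"
        by (intro mult_left_mono) (use elim in \<open>auto intro: less_imp_le\<close>)
      finally show "norm (K t * ?gF t - K t * trig_series c t) \<le> \<epsilon> / (N + 1) * norm (K t)" by (simp add: mult.commute)
    qed
    also have "\<dots> = \<epsilon> * (N / (N + 1))" by (simp add: N_def)
    also have "\<dots> < \<epsilon>" using \<epsilon> N by (simp add: field_simps)
    finally show ?case .
  qed
qed

text \<open>Termwise integration against \<open>fexp (- m)\<close> recovers 2 * pi * c m.\<close>

lemma trig_series_nonzero:
  assumes m: "c m \<noteq> 0"
  shows "\<not> (AE t in lborel. t \<in> {0..2*pi} \<longrightarrow> trig_series c t = 0)"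
proof
  assume "AE t in lborel. t \<in> {0..2*pi} \<longrightarrow> trig_series c t = 0"
  then have ae: "AE t in circ. trig_series c t = 0" by (simp add: AE_circ)
  have i: "integrable circ (fexp (- m))" by (intro integrable_circ_continuous continuous_intros)
  have "(\<integral>t. fexp (- m) t * trig_series c t \<partial>circ) = 0"
    by (rule integral_eq_zero_AE) (use ae in \<open>eventually_elim, simp\<close>)
  then have 1: "((\<lambda>l. of_real (c l) * (\<integral>t. fexp (- m) t * fexp l t \<partial>circ)) has_sum 0) UNIV"
    using has_sum_integral_trig_series[OF i] by simp
  have "((\<lambda>l. of_real (c l) * (\<integral>t. fexp (- m) t * fexp l t \<partial>circ)) has_sum (of_real (c m) * complex_of_real (2 * pi))) UNIV"
    by (subst has_sum_cong_neutral[where T = "{m}" and g = "\<lambda>_. of_real (c m) * complex_of_real (2 * pi)"])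
       (auto simp: fexp_mult integral_circ_fexp measure_circ scaleR_conv_of_real intro!: has_sum_finiteI)
  from has_sum_unique[OF 1 this] m show False by simp
qed

lemma trig_series_shift: "((\<lambda>l. of_real (c (l - j)) * fexp l t) has_sum fexp j t * trig_series c t) UNIV"
proof -
  have "((\<lambda>l. fexp j t * (of_real (c l) * fexp l t)) has_sum fexp j t * trig_series c t) UNIV"
    by (intro has_sum_cmult_right trig_series_has_sum)
  also have "?this \<longleftrightarrow> ?thesis"
    by (rule has_sum_reindex_bij_witness[where i = "\<lambda>l. l - j" and j = "\<lambda>l. l + j"])
       (auto simp: mult_ac fexp_mult)
  finally show ?thesis .
qed

end

text \<open>After multiplication by the weight the function is still bounded. Bessel makes its
  Fourier coefficients square summable, and the Sobolev weights are at most 1.\<close>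

lemma trig_series_in_H_space:
  assumes c: "(\<lambda>l. \<bar>c l\<bar>) summable_on UNIV" and xi: "0 < xi" "xi < 1"
  shows "trig_series c \<in> H_space xi"
proof -
  let ?h = "\<lambda>t. of_real (psi xi t powr (3/2)) * trig_series c t"
  define D where "D = 2 powr (3/2) * (\<Sum>\<^sub>\<infinity>l. \<bar>c l\<bar>)"
  have hb: "norm (?h t) \<le> D" for t
  proof -
    have "\<bar>xi * cos t\<bar> \<le> 1 * 1" unfolding abs_mult using xi by (intro mult_mono) auto
    then have "0 \<le> psi xi t" "psi xi t \<le> 2" unfolding psi_def by linarith+
    then have "psi xi t powr (3/2) \<le> 2 powr (3/2)" by (intro powr_mono2) auto
    then show ?thesis unfolding norm_mult D_def
      by (intro mult_mono trig_series_bound[OF c]) auto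
  qed
  have hm: "?h \<in> borel_measurable circ"
  proof (rule borel_measurable_circ)
    note ident_measurable_circ [measurable del] trig_series_borel[OF c, measurable]
    show "?h \<in> borel_measurable borel" unfolding psi_def by measurable
  qed
  have "(\<lambda>l. (1 / (2 * pi))\<^sup>2 * (norm (\<integral>t. ?h t * fexp (- l) t \<partial>circ))\<^sup>2) summable_on UNIV"
    by (intro summable_on_cmult_right Bessel_circ[OF hm, of D] hb)
  then have "(\<lambda>l::int. (1 + (of_int l)\<^sup>2) powr (-1/2) * (cmod (fourier_coeff ?h l))\<^sup>2) summable_on UNIV"
  proof (rule summable_on_comparison_test)
    fix l :: int
    have "exp (- \<i> * of_int l * of_real t) = fexp (- l) t" for t :: real by (simp add: fexp_eq_exp)
    then have fc: "fourier_coeff ?h l = (\<integral>t. ?h t * fexp (- l) t \<partial>circ) / of_real (2 * pi)"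
      unfolding fourier_coeff_def integral_circ by simp
    have p: "(1 + (real_of_int l)\<^sup>2) powr (-1/2) \<le> 1"
      using powr_mono2'[of "-1/2" 1 "1 + (real_of_int l)\<^sup>2"] by simp
    have "(1 + (of_int l)\<^sup>2) powr (-1/2) * (cmod (fourier_coeff ?h l))\<^sup>2 \<le> 1 * (cmod (fourier_coeff ?h l))\<^sup>2"
      by (intro mult_right_mono p) auto
    also have "\<dots> = (1 / (2 * pi))\<^sup>2 * (norm (\<integral>t. ?h t * fexp (- l) t \<partial>circ))\<^sup>2"
      unfolding fc norm_divide by (simp add: power_divide)
    finally show "(1 + (of_int l)\<^sup>2) powr (-1/2) * (cmod (fourier_coeff ?h l))\<^sup>2
       \<le> (1 / (2 * pi))\<^sup>2 * (norm (\<integral>t. ?h t * fexp (- l) t \<partial>circ))\<^sup>2" .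
  qed auto
  moreover have "set_integrable lborel {0..2*pi} ?h"
    unfolding integrable_circ[symmetric] by (rule integrable_circ_bounded[OF hm]) (rule hb)
  ultimately show ?thesis unfolding H_space_def in_Hminus_half_def by simp
qed

section \<open>Convolution with even periodic kernels\<close>

lemma circ_odd_integral_zero:
  fixes f :: "real \<Rightarrow> real"
  assumes "f \<in> borel_measurable borel" "integrable circ f" "\<And>t. f (t + 2 * pi) = f t" "\<And>t. f (- t) = - f t"
  shows "(\<integral>t. f t \<partial>circ) = 0"
proof -
  have "f (2 * pi - t) = - f t" for t using assms(3)[of "- t"] assms(4)[of t] by (simp add: algebra_simps)
  then show ?thesis using integral_circ_reflect(2)[OF assms(1-3), of "2 * pi"] by simp
qed

lemma trig_int_periodic: "cos (of_int l * (t + 2 * pi)) = cos (of_int l * t)" "sin (of_int l * (t + 2 * pi)) = sin (of_int l * t)"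
  for t :: real
  using sin_int_2pin[of l] cos_int_2pin[of l] by (simp_all add: distrib_left cos_add sin_add mult_ac)

lemma fexp_periodic: "fexp l (t + 2 * pi) = fexp l t"
  by (simp add: fexp_def complex_eq_iff trig_int_periodic)

lemma integral_even_fexp:
  fixes K :: "real \<Rightarrow> real"
  assumes Kb: "K \<in> borel_measurable borel" and K: "integrable circ K"
    and per: "\<And>t. K (t + 2 * pi) = K t" and even: "\<And>t. K (- t) = K t"
  shows "integrable circ (\<lambda>t. of_real (K t) * fexp l t)"
    and "(\<integral>t. of_real (K t) * fexp l t \<partial>circ) = of_real (\<integral>t. K t * cos (of_int l * t) \<partial>circ)"
proof -
  have m: "(\<lambda>t. of_real (K t) * fexp l t) \<in> borel_measurable borel"
    and ms: "(\<lambda>t. K t * sin (of_int l * t)) \<in> borel_measurable borel"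
  proof -
    note ident_measurable_circ [measurable del] Kb [measurable]
    show "(\<lambda>t. of_real (K t) * fexp l t) \<in> borel_measurable borel" "(\<lambda>t. K t * sin (of_int l * t)) \<in> borel_measurable borel"
      by measurable
  qed
  show i: "integrable circ (\<lambda>t. of_real (K t) * fexp l t)"
    by (rule Bochner_Integration.integrable_bound[OF K borel_measurable_circ[OF m]]) (simp add: norm_mult)
  have iIm: "integrable circ (\<lambda>t. K t * sin (of_int l * t))"
    using integrable_Im[OF i] by (simp add: fexp_def)
  have "(\<integral>t. K t * sin (of_int l * t) \<partial>circ) = 0"
    by (rule circ_odd_integral_zero[OF ms iIm]) (simp_all add: per even trig_int_periodic)
  moreover have "Im (\<integral>t. of_real (K t) * fexp l t \<partial>circ) = (\<integral>t. K t * sin (of_int l * t) \<partial>circ)"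
    by (subst integral_Im[OF i, symmetric]) (simp add: fexp_def)
  moreover have "Re (\<integral>t. of_real (K t) * fexp l t \<partial>circ) = (\<integral>t. K t * cos (of_int l * t) \<partial>circ)"
    by (subst integral_Re[OF i, symmetric]) (simp add: fexp_def)
  ultimately show "(\<integral>t. of_real (K t) * fexp l t \<partial>circ) = of_real (\<integral>t. K t * cos (of_int l * t) \<partial>circ)"
    by (simp add: complex_eq_iff)
qed

text \<open>Exponentials diagonalise convolution: reflecting t to a - t pulls out
  \<open>fexp l a\<close>, and evenness of \<open>K\<close> leaves its cosine coefficient.\<close>

lemma convolution_fexp:
  fixes K :: "real \<Rightarrow> real"
  assumes Kb: "K \<in> borel_measurable borel" and K: "integrable circ K"
    and per: "\<And>t. K (t + 2 * pi) = K t" and even: "\<And>t. K (- t) = K t" and a: "0 \<le> a" "a \<le> 2 * pi"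
  shows "integrable circ (\<lambda>t. of_real (K (a - t)) * fexp l t)"
    and "(\<integral>t. of_real (K (a - t)) * fexp l t \<partial>circ) = of_real (\<integral>t. K t * cos (of_int l * t) \<partial>circ) * fexp l a"
proof -
  let ?f = "\<lambda>t. of_real (K t) * fexp (- l) t"
  have m: "?f \<in> borel_measurable borel"
  proof -
    note ident_measurable_circ [measurable del] Kb [measurable]
    show ?thesis by measurable
  qed
  have fp: "?f (t + 2 * pi) = ?f t" for t by (simp add: per fexp_periodic)
  note r = integral_circ_reflect[OF m integral_even_fexp(1)[OF Kb K per even] fp a]
  have e: "of_real (K (a - t)) * fexp l t = fexp l a * ?f (a - t)" for t
  proof -
    have "fexp l a * fexp (- l) (a - t) = fexp l t" by (simp add: fexp_def cis_mult algebra_simps)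
    then show ?thesis by (simp add: mult_ac)
  qed
  show "integrable circ (\<lambda>t. of_real (K (a - t)) * fexp l t)"
    unfolding e by (intro integrable_mult_right r)
  show "(\<integral>t. of_real (K (a - t)) * fexp l t \<partial>circ) = of_real (\<integral>t. K t * cos (of_int l * t) \<partial>circ) * fexp l a"
    unfolding e integral_mult_right_zero r(2) integral_even_fexp(2)[OF Kb K per even] by (simp add: mult.commute)
qed

section \<open>From sequences back to the operator\<close>

context torus begin

lemma symbol: "torus_symbol xi sl rl (pi * r0)"
  by unfold_locales (use xi sl_pos sl_even r0_pos n_sl_tendsto rl_square_summable n_sl_step in auto)

interpretation sym: torus_symbol xi sl rl "pi * r0" by (rule symbol)

lemma dK_ae: "AE e in circ. dK e = (sK e - rK e) / (1 - xi\<^sup>2)"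
  using AE_circ_interior by eventually_elim (use dK_eq one_minus_cos_pos in auto)

lemma rK_integrable: "integrable circ rK"
proof -
  obtain C where C: "\<And>e. \<bar>rK e\<bar> \<le> C" using rK_bounded by blast
  show ?thesis
    by (rule integrable_circ_bounded[OF borel_measurable_circ[OF rK_borel], of C]) (use C in auto)
qed

lemma dK_integrable: "integrable circ dK"
proof -
  have "integrable circ (\<lambda>e. (sK e - rK e) / (1 - xi\<^sup>2))"
    by (intro integrable_divide_zero Bochner_Integration.integrable_diff sK_integrable rK_integrable)
  then show ?thesis
    using integrable_cong_AE[OF borel_measurable_circ[OF dK_borel] borel_measurable_integrable dK_ae] by blast
qed

lemma dK_coeff: "(\<integral>e. dK e * cos (of_int l * e) \<partial>circ) = sym.d l"
proof -
  have mul: "integrable circ (\<lambda>e. K e * cos (of_int l * e))" if K: "integrable circ K" for K :: "real \<Rightarrow> real"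
  proof (rule Bochner_Integration.integrable_bound[OF K])
    have [measurable]: "K \<in> borel_measurable circ" using K by auto
    show "(\<lambda>e. K e * cos (of_int l * e)) \<in> borel_measurable circ" by measurable
    show "AE e in circ. norm (K e * cos (of_int l * e)) \<le> norm (K e)"
    proof (rule AE_I2)
      fix e show "norm (K e * cos (of_int l * e)) \<le> norm (K e)"
        using mult_left_mono[of "\<bar>cos (of_int l * e)\<bar>" 1 "\<bar>K e\<bar>"] by (simp add: abs_mult)
    qed
  qed
  have "(\<integral>e. dK e * cos (of_int l * e) \<partial>circ) = (\<integral>e. (sK e * cos (of_int l * e) - rK e * cos (of_int l * e)) / (1 - xi\<^sup>2) \<partial>circ)"
  proof (rule integral_cong_AE)
    show "AE e in circ. dK e * cos (of_int l * e) = (sK e * cos (of_int l * e) - rK e * cos (of_int l * e)) / (1 - xi\<^sup>2)"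
      using dK_ae by eventually_elim (simp add: left_diff_distrib)
    show "(\<lambda>e. dK e * cos (of_int l * e)) \<in> borel_measurable circ"
      by (rule borel_measurable_integrable[OF mul[OF dK_integrable]])
    show "(\<lambda>e. (sK e * cos (of_int l * e) - rK e * cos (of_int l * e)) / (1 - xi\<^sup>2)) \<in> borel_measurable circ"
      by (intro borel_measurable_integrable integrable_divide_zero Bochner_Integration.integrable_diff mul sK_integrable rK_integrable)
  qed
  also have "\<dots> = sym.d l"
    unfolding integral_divide_zero sym.d_def sl_def rl_def
    by (subst Bochner_Integration.integral_diff[OF mul[OF sK_integrable] mul[OF rK_integrable]]) (rule refl)
  finally show ?thesis .
qed

lemma psi_pos: "psi xi e > 0"
proof -
  have "xi * cos e \<le> xi * 1" using xi by (intro mult_left_mono) auto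
  then show ?thesis using xi unfolding psi_def by linarith
qed

text \<open>\<open>F\<close> and \<open>X\<close> are even in the angle, so only the cosine part of
  the exponential survives.\<close>

lemma kernel_integral_real:
  fixes F :: "real \<Rightarrow> real"
  assumes Fb: "F \<in> borel_measurable borel" "\<And>p. \<bar>F p\<bar> \<le> C" "\<And>p. F (p + 2 * pi) = F p" "\<And>p. F (- p) = F p"
    and e: "1 - cos e > 0" and a: "a \<le> 0"
  shows "(LINT \<phi>:{0..2*pi}|lborel. exp (- \<i> * of_int k * of_real \<phi>) * of_real (F \<phi> * X \<phi> e powr a)) =
    of_real (\<integral>p. cos (of_int k * p) * (F p * X p e powr a) \<partial>circ)"
proof -
  have m: "(\<lambda>p. F p * X p e powr a) \<in> borel_measurable borel"
  proof -
    note ident_measurable_circ [measurable del] Fb(1) [measurable]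
    show ?thesis unfolding X_def by measurable
  qed
  have i: "integrable circ (\<lambda>p. F p * X p e powr a)"
    by (rule X_powr_integrable[OF e a Fb(1,2)])
  have "(LINT \<phi>:{0..2*pi}|lborel. exp (- \<i> * of_int k * of_real \<phi>) * of_real (F \<phi> * X \<phi> e powr a)) =
     (\<integral>p. of_real (F p * X p e powr a) * fexp (- k) p \<partial>circ)"
    unfolding integral_circ by (simp add: fexp_eq_exp mult.commute)
  also have "\<dots> = of_real (\<integral>t. F t * X t e powr a * cos (of_int (- k) * t) \<partial>circ)"
    by (rule integral_even_fexp(2)[OF m i]) (simp_all add: Fb X_def)
  finally show ?thesis by (simp add: mult_ac)
qed

lemma a_kernel_eq:
  assumes "1 - cos (e - e') > 0"
  shows "a_kernel xi k e e' = of_real (1 / psi xi e) * of_real (sK (e - e')) - of_real (dK (e - e'))"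
proof -
  have "(LINT \<phi>:{0..2*pi}|lborel. exp (- \<i> * of_int k * of_real \<phi>) * of_real ((mu xi \<phi> - cos (e - e')) powr (-1/2))) =
    complex_of_real (sK (e - e'))"
    using kernel_integral_real[of "\<lambda>_. 1" 1 "e - e'" "-1/2"] assms unfolding X_eq_mu sK_def by simp
  moreover have "(LINT \<phi>:{0..2*pi}|lborel. exp (- \<i> * of_int k * of_real \<phi>) * of_real ((1 - cos \<phi>) * (mu xi \<phi> - cos (e - e')) powr (-3/2))) =
    complex_of_real (\<integral>p. cos (of_int k * p) * ((1 - cos p) * X p (e - e') powr (-3/2)) \<partial>circ)"
  proof -
    have "\<bar>1 - cos p\<bar> \<le> 2" for p :: real using cos_ge_minus_one[of p] cos_le_one[of p] by linarith
    then show ?thesis unfolding X_eq_mu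
      by (intro kernel_integral_real[where C = 2]) (use assms in auto)
  qed
  ultimately show ?thesis unfolding a_kernel_def dK_def of_real_mult by simp
qed

lemma AE_off_diagonal:
  assumes "0 \<le> a" "a \<le> 2 * pi"
  shows "AE t in circ. 1 - cos (a - t) > 0"
proof -
  \<comment> \<open>If \<open>a\<close> is an endpoint of the interval, the singularity also occurs
    at the other endpoint; hence the translates by 2 pi.\<close>
  have "AE t in lborel. t \<noteq> a \<and> t \<noteq> a - 2 * pi \<and> t \<noteq> a + 2 * pi"
    using AE_lborel_singleton[of a] AE_lborel_singleton[of "a - 2 * pi"] AE_lborel_singleton[of "a + 2 * pi"]
    by eventually_elim auto
  then show ?thesis unfolding AE_circ
  proof eventually_elim
    case (elim t)
    show ?case
    proof
      assume t: "t \<in> {0..2*pi}"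
      show "1 - cos (a - t) > 0"
      proof (cases "a > t")
        case True
        then show ?thesis using elim t assms by (intro one_minus_cos_pos) auto
      next
        case False
        then have "1 - cos (t - a) > 0" using elim t assms by (intro one_minus_cos_pos) auto
        then show ?thesis using cos_minus[of "a - t"] by simp
      qed
    qed
  qed
qed

lemma a_kernel_borel: "(\<lambda>e'. a_kernel xi k e e') \<in> borel_measurable borel"
proof -
  have m: "(\<lambda>e'. \<integral>p. exp (- \<i> * of_int k * of_real p) * of_real (F p * (mu xi p - cos (e - e')) powr a) \<partial>circ) \<in> borel_measurable borel"
    if [measurable]: "F \<in> borel_measurable borel" for F a
    by (rule circ.borel_measurable_lebesgue_integral) (unfold case_prod_beta mu_def, measurable)
  show ?thesis
    unfolding a_kernel_def integral_circ[symmetric]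
    using m[of "\<lambda>_. 1" "-1/2"] m[of "\<lambda>p. 1 - cos p" "-3/2"]
    by (intro borel_measurable_diff borel_measurable_times borel_measurable_const) auto
qed

lemma a_kernel_integrable_and_symbol:
  assumes a: "0 \<le> a" "a \<le> 2 * pi"
  shows "integrable circ (\<lambda>t. a_kernel xi k a t)"
    and "(\<integral>t. a_kernel xi k a t * fexp l t \<partial>circ) = of_real (sl l / psi xi a - sym.d l) * fexp l a"
proof -
  note cs = convolution_fexp[OF sK_borel sK_integrable K_periodic(1) K_even(1) a]
  note cd = convolution_fexp[OF dK_borel dK_integrable K_periodic(2) K_even(2) a]
  let ?K = "\<lambda>l t. of_real (1 / psi xi a) * (of_real (sK (a - t)) * fexp l t) - of_real (dK (a - t)) * fexp l t"
  have i: "integrable circ (?K l)" for l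
    by (intro Bochner_Integration.integrable_diff integrable_mult_right cs(1) cd(1))
  have ae: "AE t in circ. a_kernel xi k a t * fexp l t = ?K l t" for l
    using AE_off_diagonal[OF a] by eventually_elim (simp add: a_kernel_eq left_diff_distrib mult.assoc)
  have m: "(\<lambda>t. a_kernel xi k a t * fexp l t) \<in> borel_measurable circ" for l
    by (rule borel_measurable_circ) (intro borel_measurable_times a_kernel_borel fexp_borel)
  \<comment> \<open>Integrability of the kernel itself is the case l = 0, as \<open>fexp 0\<close>
    is constantly 1.\<close>
  have "integrable circ (\<lambda>t. a_kernel xi k a t * fexp 0 t)"
    using integrable_cong_AE[OF m borel_measurable_integrable[OF i] ae] i by blast
  then show "integrable circ (\<lambda>t. a_kernel xi k a t)" by simp
  have "(\<integral>t. a_kernel xi k a t * fexp l t \<partial>circ) = (\<integral>t. ?K l t \<partial>circ)"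
    by (rule integral_cong_AE[OF m borel_measurable_integrable[OF i] ae])
  also have "\<dots> = of_real (1 / psi xi a) * (of_real (sl l) * fexp l a) - of_real (sym.d l) * fexp l a"
    unfolding Bochner_Integration.integral_diff[OF integrable_mult_right[OF cs(1)] cd(1)]
      integral_mult_right_zero cs(2) cd(2) dK_coeff sl_def ..
  finally show "(\<integral>t. a_kernel xi k a t * fexp l t \<partial>circ) = of_real (sl l / psi xi a - sym.d l) * fexp l a"
    by (simp add: algebra_simps)
qed

text \<open>Termwise integration of the Fourier series of \<open>g\<close> gives S g / psi - D g,
  and the recurrence says psi * (lam g + D g) = S g. The eigenvalue equation therefore holds at
  every point of the interval.\<close>

lemma symbol_eigenvector_imp_eigenvalue:
  assumes g: "sym.is_symbol_eigenvector lam g"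
  shows "is_eigenvalue_A xi k (of_real lam)"
proof -
  have g1: "(\<lambda>l. \<bar>g l\<bar>) summable_on UNIV" and "\<exists>m. g m \<noteq> 0"
    and eq: "\<And>l. (lam + sym.d l) * g l - xi / 2 * ((lam + sym.d (l - 1)) * g (l - 1) + (lam + sym.d (l + 1)) * g (l + 1)) = sl l * g l"
    using g unfolding sym.is_symbol_eigenvector_def by blast+
  then obtain m where m: "g m \<noteq> 0" by blast
  define x where "x l = (lam + sym.d l) * g l" for l
  have x1: "(\<lambda>l. \<bar>x l\<bar>) summable_on UNIV"
  proof (rule summable_on_comparison_test)
    \<comment> \<open>A uniform bound for |d l|: it is at most 1 + (d l)^2, and one square is at
      most the whole sum.\<close>
    let ?D = "1 + (\<Sum>\<^sub>\<infinity>l. (sym.d l)\<^sup>2)"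
    show "(\<lambda>l. (\<bar>lam\<bar> + ?D) * \<bar>g l\<bar>) summable_on UNIV" by (intro summable_on_cmult_right g1)
    show "\<bar>x l\<bar> \<le> (\<bar>lam\<bar> + ?D) * \<bar>g l\<bar>" for l
    proof -
      have "(sym.d l)\<^sup>2 \<le> (\<Sum>\<^sub>\<infinity>l. (sym.d l)\<^sup>2)"
        using finite_sum_le_infsum[OF sym.d_square, of "{l}"] by simp
      moreover have "\<bar>sym.d l\<bar> \<le> 1 + (sym.d l)\<^sup>2"
        using sum_squares_bound[of "\<bar>sym.d l\<bar>" 1] by simp
      ultimately have "\<bar>lam + sym.d l\<bar> \<le> \<bar>lam\<bar> + ?D" by linarith
      then show ?thesis unfolding x_def abs_mult by (intro mult_right_mono) auto
    qed
  qed auto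
  have A: "A_op xi k (trig_series g) a = of_real lam * trig_series g a" if a: "0 \<le> a" "a \<le> 2 * pi" for a
  proof -
    \<comment> \<open>By its coefficients \<open>Y\<close> is lam g + D g at the point
      \<open>a\<close>; the shifts by 1 then show psi * Y = S g.\<close>
    define Y where "Y = trig_series x a"
    have sh: "((\<lambda>l. of_real (x l) * fexp l a) has_sum Y) UNIV"
      "((\<lambda>l. of_real (x (l - 1)) * fexp l a) has_sum fexp 1 a * Y) UNIV"
      "((\<lambda>l. of_real (x (l + 1)) * fexp l a) has_sum fexp (- 1) a * Y) UNIV"
      unfolding Y_def using trig_series_has_sum[OF x1] trig_series_shift[OF x1, of 1] trig_series_shift[OF x1, of "-1"] by auto
    have "((\<lambda>l. of_real (x l) * fexp l a + of_real (- xi / 2) * (of_real (x (l - 1)) * fexp l a + of_real (x (l + 1)) * fexp l a))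
       has_sum (Y + of_real (- xi / 2) * (fexp 1 a * Y + fexp (- 1) a * Y))) UNIV"
      by (intro has_sum_add has_sum_cmult_right sh)
    also have "(\<lambda>l. of_real (x l) * fexp l a + of_real (- xi / 2) * (of_real (x (l - 1)) * fexp l a + of_real (x (l + 1)) * fexp l a))
       = (\<lambda>l. of_real (sl l * g l) * fexp l a)"
    proof
      fix l
      have "of_real (sl l * g l) * fexp l a = of_real (x l - xi / 2 * (x (l - 1) + x (l + 1))) * fexp l a"
        unfolding x_def eq ..
      then show "of_real (x l) * fexp l a + of_real (- xi / 2) * (of_real (x (l - 1)) * fexp l a + of_real (x (l + 1)) * fexp l a)
        = of_real (sl l * g l) * fexp l a" by (simp add: algebra_simps)
    qed
    also have "Y + of_real (- xi / 2) * (fexp 1 a * Y + fexp (- 1) a * Y) = of_real (psi xi a) * Y"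
    proof -
      have "fexp 1 a + fexp (- 1) a = of_real (2 * cos a)" by (simp add: fexp_def complex_eq_iff)
      then have "fexp 1 a * Y + fexp (- 1) a * Y = of_real (2 * cos a) * Y" by (metis distrib_right)
      then show ?thesis by (simp add: psi_def algebra_simps)
    qed
    finally have S: "((\<lambda>l. of_real (sl l * g l) * fexp l a) has_sum of_real (psi xi a) * Y) UNIV" .
    note K = a_kernel_integrable_and_symbol[OF a]
    have h1: "((\<lambda>l. of_real (g l) * (of_real (sl l / psi xi a - sym.d l) * fexp l a)) has_sum
        (\<integral>t. a_kernel xi k a t * trig_series g t \<partial>circ)) UNIV"
      using has_sum_integral_trig_series[OF g1 K(1)] unfolding K(2) .
    have h2: "((\<lambda>l. of_real (1 / psi xi a) * (of_real (sl l * g l) * fexp l a) + ((- 1) * (of_real (x l) * fexp l a) + of_real lam * (of_real (g l) * fexp l a)))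
       has_sum (of_real (1 / psi xi a) * (of_real (psi xi a) * Y) + ((- 1) * Y + of_real lam * trig_series g a))) UNIV"
      by (intro has_sum_add has_sum_cmult_right S sh trig_series_has_sum g1)
    have h3: "(\<lambda>l. of_real (1 / psi xi a) * (of_real (sl l * g l) * fexp l a) + ((- 1) * (of_real (x l) * fexp l a) + of_real lam * (of_real (g l) * fexp l a)))
      = (\<lambda>l. of_real (g l) * (of_real (sl l / psi xi a - sym.d l) * fexp l a))"
      by (simp add: x_def fun_eq_iff algebra_simps)
    have "(\<integral>t. a_kernel xi k a t * trig_series g t \<partial>circ) =
        of_real (1 / psi xi a) * (of_real (psi xi a) * Y) + ((- 1) * Y + of_real lam * trig_series g a)"
      using has_sum_unique[OF h1 h2[unfolded h3]] .
    also have "\<dots> = of_real lam * trig_series g a" using psi_pos[of a] by simp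
    finally show ?thesis unfolding A_op_def integral_circ .
  qed
  show ?thesis
    unfolding is_eigenvalue_A_def
  proof (intro exI[of _ "trig_series g"] conjI)
    show "trig_series g \<in> H_space xi" by (rule trig_series_in_H_space[OF g1 xi])
    show "\<not> (AE \<eta> in lborel. \<eta> \<in> {0..2*pi} \<longrightarrow> trig_series g \<eta> = 0)" by (rule trig_series_nonzero[OF g1 m])
    show "AE \<eta> in lborel. \<eta> \<in> {0..2*pi} \<longrightarrow> set_integrable lborel {0..2*pi} (\<lambda>\<eta>'. a_kernel xi k \<eta> \<eta>' * trig_series g \<eta>')"
      unfolding integrable_circ[symmetric]
      by (intro AE_I2 impI integrable_mult_trig_series[OF g1] a_kernel_integrable_and_symbol) auto
    show "AE \<eta> in lborel. \<eta> \<in> {0..2*pi} \<longrightarrow> A_op xi k (trig_series g) \<eta> = of_real lam * trig_series g \<eta>"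
      using A by (intro AE_I2) auto
  qed
qed

lemma exists_eigenvalues:
  "(\<exists>lam>0. is_eigenvalue_A xi k (of_real lam)) \<and> (\<exists>lam<0. is_eigenvalue_A xi k (of_real lam))"
  using sym.exists_positive_symbol_eigenvector sym.exists_negative_symbol_eigenvector symbol_eigenvector_imp_eigenvalue by blast

end

theorem theorem4p1:
  fixes \<xi> :: real
  assumes "0 < \<xi>" and "\<xi> < 1"
  shows "\<exists>k0::nat. k0 > 0 \<and>
           (\<forall>k::int. \<bar>k\<bar> > int k0 \<longrightarrow>
              (\<exists>lam::real. lam > 0 \<and> is_eigenvalue_A \<xi> k (of_real lam)) \<and>
              (\<exists>lam::real. lam < 0 \<and> is_eigenvalue_A \<xi> k (of_real lam)))"
\<comment> \<open>The locale is interpreted at each such \<open>k\<close> separately; the threshold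
  is the least positive integer.\<close>
proof (rule exI[of _ 1], intro conjI allI impI)
  fix k :: int
  interpret torus \<xi> k by standard (use assms in auto)
  show "\<exists>lam::real. lam > 0 \<and> is_eigenvalue_A \<xi> k (of_real lam)"
    "\<exists>lam::real. lam < 0 \<and> is_eigenvalue_A \<xi> k (of_real lam)"
    using exists_eigenvalues by auto
qed simp

end
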